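(* Let $F$ be a computable family of finite linear orders with $|F|>1$, and let $L=\mathrm{Shuffle}(F)$. Then $\mathrm{PrCat}(L)=\mathrm{Cone}(\Delta^0_3)$.
   Context: For a family $F$ of linear orders, $\mathrm{Shuffle}(F)$ is the linear order obtained by replacing each point of $\eta$ (the order type of the rationals) with a copy of a member of $F$ in such a way that between any two of these inserted copies there is a copy of each member of $F$. A structure is punctual if its domain is $\omega$ and its relations are uniformly primitive recursive. For total $f,g:\omega\to\omega$, write $f\le_{PR}g$ if $f$ is primitive recursive relative to $g$; the induced equivalence classes are PR-degrees, and $f\le_{PR}\mathbf d$ means $f\le_{PR}$ a member of $\mathbf d$. For a punctual structure $A$, $\mathrm{PrCat}(A)$ is the set of PR-degrees $\mathbf d$ such that for every punctual $B\cong A$ there is an isomorphism $f:A\to B$ with $f\le_{PR}\mathbf d$ and $f^{-1}\le_{PR}\mathbf d$; for an isomorphism type $S$ with a punctual presentation, $\mathrm{PrCat}(S)$ means $\mathrm{PrCat}(A)$ for a punctual $A\cong S$ (independent of the choice of $A$). $\mathrm{Cone}(\Delta^0_3)$ is the set of PR-degrees $\mathbf d$ such that $f\le_{PR}\mathbf d$ for every total $\Delta^0_3$ function $f:\omega\to\omega$. *)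

theory Defs
  imports Complex_Main
begin

section \<open>Primitive recursive and computable functions\<close>

text \<open>
  An \<open>n\<close>-ary function on the natural numbers is represented by a function on lists of which only the
  values on lists of length \<open>n\<close> matter.  The parameter \<open>Orc\<close> is a set of unary oracle functions:
  \<open>Orc = {}\<close> gives the primitive recursive functions, \<open>Orc = {g}\<close> those primitive recursive in \<open>g\<close>.
\<close>

inductive prim_rec_in :: "(nat \<Rightarrow> nat) set \<Rightarrow> nat \<Rightarrow> (nat list \<Rightarrow> nat) \<Rightarrow> bool"
  for Orc :: "(nat \<Rightarrow> nat) set" where
  zero: "prim_rec_in Orc n (\<lambda>xs. 0)"
| succ: "prim_rec_in Orc 1 (\<lambda>xs. Suc (xs ! 0))"
| proj: "i < n \<Longrightarrow> prim_rec_in Orc n (\<lambda>xs. xs ! i)"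
| query: "g \<in> Orc \<Longrightarrow> prim_rec_in Orc 1 (\<lambda>xs. g (xs ! 0))"
| comp: "prim_rec_in Orc (length hs) f \<Longrightarrow> (\<forall>h\<in>set hs. prim_rec_in Orc n h) \<Longrightarrow>
    prim_rec_in Orc n (\<lambda>xs. f (map (\<lambda>h. h xs) hs))"
| prec: "prim_rec_in Orc n f \<Longrightarrow> prim_rec_in Orc (Suc (Suc n)) h \<Longrightarrow>
    prim_rec_in Orc (Suc n) (\<lambda>xs. rec_nat (f (tl xs)) (\<lambda>m r. h (m # r # tl xs)) (hd xs))"

text \<open>
  The total computable functions: the same closure conditions together with minimization applied to
  regular functions, i.e. where a zero exists for all values of the parameters.
\<close>

inductive computable_fun :: "nat \<Rightarrow> (nat list \<Rightarrow> nat) \<Rightarrow> bool" where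
  zero: "computable_fun n (\<lambda>xs. 0)"
| succ: "computable_fun 1 (\<lambda>xs. Suc (xs ! 0))"
| proj: "i < n \<Longrightarrow> computable_fun n (\<lambda>xs. xs ! i)"
| comp: "computable_fun (length hs) f \<Longrightarrow> (\<forall>h\<in>set hs. computable_fun n h) \<Longrightarrow>
    computable_fun n (\<lambda>xs. f (map (\<lambda>h. h xs) hs))"
| prec: "computable_fun n f \<Longrightarrow> computable_fun (Suc (Suc n)) h \<Longrightarrow>
    computable_fun (Suc n) (\<lambda>xs. rec_nat (f (tl xs)) (\<lambda>m r. h (m # r # tl xs)) (hd xs))"
| mu: "computable_fun (Suc n) f \<Longrightarrow> (\<forall>xs. length xs = n \<longrightarrow> (\<exists>y. f (y # xs) = 0)) \<Longrightarrow>
    computable_fun n (\<lambda>xs. LEAST y. f (y # xs) = 0)"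

definition prim_rec_pred :: "nat \<Rightarrow> (nat list \<Rightarrow> bool) \<Rightarrow> bool" where
  "prim_rec_pred n P \<longleftrightarrow>
    (\<exists>f. prim_rec_in {} n f \<and> (\<forall>xs. length xs = n \<longrightarrow> f xs = (if P xs then 1 else 0)))"

definition computable_pred :: "nat \<Rightarrow> (nat list \<Rightarrow> bool) \<Rightarrow> bool" where
  "computable_pred n P \<longleftrightarrow>
    (\<exists>f. computable_fun n f \<and> (\<forall>xs. length xs = n \<longrightarrow> f xs = (if P xs then 1 else 0)))"


section \<open>Arithmetical hierarchy\<close>

primrec Sigma0 :: "nat \<Rightarrow> nat \<Rightarrow> (nat list \<Rightarrow> bool) \<Rightarrow> bool" where
  "Sigma0 0 n P \<longleftrightarrow> computable_pred n P"
| "Sigma0 (Suc k) n P \<longleftrightarrow>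
    (\<exists>Q. Sigma0 k (Suc n) Q \<and> (\<forall>xs. length xs = n \<longrightarrow> (P xs \<longleftrightarrow> (\<exists>y. \<not> Q (y # xs)))))"

definition Pi0 :: "nat \<Rightarrow> nat \<Rightarrow> (nat list \<Rightarrow> bool) \<Rightarrow> bool" where
  "Pi0 k n P \<longleftrightarrow> Sigma0 k n (\<lambda>xs. \<not> P xs)"

definition Delta0 :: "nat \<Rightarrow> nat \<Rightarrow> (nat list \<Rightarrow> bool) \<Rightarrow> bool" where
  "Delta0 k n P \<longleftrightarrow> Sigma0 k n P \<and> Pi0 k n P"

text \<open>A total function is \<open>\<Delta>\<^sup>0\<^sub>k\<close> if its graph is.\<close>

definition Delta0_fun :: "nat \<Rightarrow> (nat \<Rightarrow> nat) \<Rightarrow> bool" where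
  "Delta0_fun k f \<longleftrightarrow> Delta0 k 2 (\<lambda>xs. f (xs ! 0) = xs ! 1)"


section \<open>PR-degrees\<close>

definition le_PR :: "(nat \<Rightarrow> nat) \<Rightarrow> (nat \<Rightarrow> nat) \<Rightarrow> bool"  (infix "\<le>\<^sub>P\<^sub>R" 50) where
  "f \<le>\<^sub>P\<^sub>R g \<longleftrightarrow> (\<exists>h. prim_rec_in {g} 1 h \<and> (\<forall>x. f x = h [x]))"

definition PR_degrees :: "(nat \<Rightarrow> nat) set set" where
  "PR_degrees = UNIV // {(f, g). f \<le>\<^sub>P\<^sub>R g \<and> g \<le>\<^sub>P\<^sub>R f}"

definition below_degree :: "(nat \<Rightarrow> nat) \<Rightarrow> (nat \<Rightarrow> nat) set \<Rightarrow> bool" where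
  "below_degree f d \<longleftrightarrow> (\<exists>g\<in>d. f \<le>\<^sub>P\<^sub>R g)"

definition Cone_Delta3 :: "(nat \<Rightarrow> nat) set set" where
  "Cone_Delta3 = {d \<in> PR_degrees. \<forall>f. Delta0_fun 3 f \<longrightarrow> below_degree f d}"


section \<open>Linear orders and shuffles\<close>

text \<open>
  Linear orders are reflexive relations; the domain of \<open>r\<close> is \<open>Field r\<close>.  The library constant \<open>iso\<close>
  is meaningful for arbitrary (not just well-) orders, see \<open>iso_iff2\<close>.
\<close>

definition isomorphic :: "'a rel \<Rightarrow> 'b rel \<Rightarrow> bool" where
  "isomorphic r s \<longleftrightarrow> (\<exists>f. iso r s f)"

text \<open>The order obtained from the rationals by replacing each \<open>q\<close> with \<open>G q\<close>.\<close>

definition rat_sum :: "(rat \<Rightarrow> 'a rel) \<Rightarrow> (rat \<times> 'a) rel" where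
  "rat_sum G = {((p, x), (q, y)) | p x q y.
     x \<in> Field (G p) \<and> y \<in> Field (G q) \<and> (p < q \<or> p = q \<and> (x, y) \<in> G p)}"

text \<open>
  All ways of forming the shuffle of the family \<open>F\<close>; up to isomorphism there is only one.
\<close>

definition Shuffle :: "('i \<Rightarrow> 'a rel) \<Rightarrow> (rat \<times> 'a) rel set" where
  "Shuffle F = {rat_sum G | G.
     (\<forall>q. \<exists>i. isomorphic (G q) (F i)) \<and>
     (\<forall>p q. p < q \<longrightarrow> (\<forall>i. \<exists>r. p < r \<and> r < q \<and> isomorphic (G r) (F i)))}"

text \<open>
  A computable family is a uniformly computable sequence of orders whose domains are sets of natural
  numbers.  Uniform computability of the domains is included, as \<open>x \<in> Field (F i)\<close> iff
  \<open>(x, x) \<in> F i\<close>.  Repetitions are allowed, so finite families are covered.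
\<close>

definition computable_family :: "(nat \<Rightarrow> nat rel) \<Rightarrow> bool" where
  "computable_family F \<longleftrightarrow>
    (\<forall>i. Linear_order (F i)) \<and> computable_pred 3 (\<lambda>xs. (xs ! 1, xs ! 2) \<in> F (xs ! 0))"


section \<open>Punctual linear orders and punctual categoricity\<close>

definition punctual :: "nat rel \<Rightarrow> bool" where
  "punctual A \<longleftrightarrow> linear_order_on UNIV A \<and> prim_rec_pred 2 (\<lambda>xs. (xs ! 0, xs ! 1) \<in> A)"

text \<open>
  For punctual \<open>A\<close> and \<open>B\<close>, both fields are \<open>UNIV\<close>, so every \<open>f\<close> with \<open>iso A B f\<close> is a bijection of
  the natural numbers and \<open>inv f\<close> is its inverse.
\<close>

definition PrCat :: "nat rel \<Rightarrow> (nat \<Rightarrow> nat) set set" where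
  "PrCat A = {d \<in> PR_degrees. \<forall>B. punctual B \<and> isomorphic A B \<longrightarrow>
     (\<exists>f. iso A B f \<and> below_degree f d \<and> below_degree (inv f) d)}"

definition punctual_presentation :: "nat rel \<Rightarrow> 'b rel set \<Rightarrow> bool" where
  "punctual_presentation A S \<longleftrightarrow> punctual A \<and> (\<exists>L\<in>S. isomorphic A L)"

end

theory Submission
  imports Defs "HOL-Library.Nat_Bijection" "HOL-Library.Infinite_Set" "HOL-Library.Countable_Set"
begin

text \<open>
  Upper bound: in a shuffle of finite orders the block of a point is read off from the successor
  relation, which is \<open>\<Pi>\<^sup>0\<^sub>1\<close>, and from the property of having no successor, which is \<open>\<Pi>\<^sup>0\<^sub>2\<close>.  Hence the
  isomorphism produced by the back-and-forth argument is \<open>\<Delta>\<^sup>0\<^sub>3\<close>.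

  Lower bound: let \<open>k\<close> be the least and \<open>m\<close> another block size, and let \<open>g\<close> be \<open>\<Delta>\<^sup>0\<^sub>3\<close>.  The initial segment
  of \<open>g\<close> of length \<open>l + 1\<close> has a unique \<open>\<Pi>\<^sup>0\<^sub>2\<close> witness \<open>\<sigma>\<close>.  In a punctual copy \<open>B\<^sub>2\<close> of the shuffle, all
  candidates \<open>\<sigma>\<close> for level \<open>l\<close> start as blocks of size \<open>k\<close>; a potential counterexample \<open>v\<close> to \<open>\<sigma>\<close> enlarges
  the block to size \<open>m\<close>, and the additional points are split off again when \<open>v\<close> is refuted.  So every
  level contributes exactly one block of size \<open>k\<close>, whose name carries the values of \<open>g\<close>.  In another copy
  \<open>B\<^sub>1\<close> there is a primitive recursive sequence of first points of blocks of size \<open>k\<close>.  An isomorphism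
  \<open>B\<^sub>1 \<rightarrow> B\<^sub>2\<close> sends \<open>x + 1\<close> of them to different levels, hence one of them to a level \<open>\<ge> x\<close>.
\<close>

section \<open>Classes closed under primitive recursion\<close>

text \<open>The construction is shaped by what a punctual copy cannot do. It never deletes a point,
  so a refuted counterexample must leave a legitimate block behind; hence a detached group of
  \<open>m - k\<close> points, whose size need not occur in the family, is filled up to
  \<open>m\<close>. It also cannot know sizes: no bounds on the domains of a computable family are
  given, so sizes are only enumerable from below. As \<open>k\<close> is the least size, differing
  from \<open>k\<close> is the enumerable event \<open>k < N i\<close>, and a node for a family
  member can stay empty until that event. So no block of size \<open>k\<close> arises by accident.
  An isomorphism chooses freely among the small blocks, so nothing can be aimed at a particular
  argument. Every small block must carry correct information and a level may accept only one of
  them, which forces unique witnesses; and every level \<open>l \<ge> x\<close> must be able to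
  serve for \<open>x\<close>, which forces whole segments of \<open>g\<close> instead of single
  values. The construction is made for an arbitrary predicate \<open>P\<close> and used twice: a
  trivial \<open>P\<close> gives the copy with many known small blocks, the witnesses for
  \<open>g\<close> give the copy with one per level.\<close>

named_theorems pr

text \<open>One interface for several classes: functions primitive recursive in an oracle, total
  computable functions, functions with graph in a class such as \<open>S3\<close>, and the class of
  all functions. The rule \<open>cong\<close> confines attention to argument lists of the right
  length.\<close>

locale pr_class =
  fixes C :: "nat \<Rightarrow> (nat list \<Rightarrow> nat) \<Rightarrow> bool"
  assumes cong: "C n f \<Longrightarrow> (\<And>xs. length xs = n \<Longrightarrow> f xs = g xs) \<Longrightarrow> C n g"
    and zero: "C n (\<lambda>xs. 0)"
    and succ: "C 1 (\<lambda>xs. Suc (xs ! 0))"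
    and proj: "i < n \<Longrightarrow> C n (\<lambda>xs. xs ! i)"
    and comp: "C (length hs) f \<Longrightarrow> (\<forall>h\<in>set hs. C n h) \<Longrightarrow> C n (\<lambda>xs. f (map (\<lambda>h. h xs) hs))"
    and prec: "C n f \<Longrightarrow> C (Suc (Suc n)) h \<Longrightarrow>
      C (Suc n) (\<lambda>xs. rec_nat (f (tl xs)) (\<lambda>m r. h (m # r # tl xs)) (hd xs))"
begin

lemma lift1: "C 1 (\<lambda>xs. F (xs ! 0)) \<Longrightarrow> C n a \<Longrightarrow> C n (\<lambda>xs. F (a xs))"
  using comp[of "[a]" "\<lambda>xs. F (xs ! 0)" n] by simp

lemma lift2: "C 2 (\<lambda>xs. F (xs ! 0) (xs ! 1)) \<Longrightarrow> C n a \<Longrightarrow> C n b \<Longrightarrow> C n (\<lambda>xs. F (a xs) (b xs))"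
  using comp[of "[a, b]" "\<lambda>xs. F (xs ! 0) (xs ! 1)" n] by (simp add: numeral_eq_Suc)

lemma lift3: "C 3 (\<lambda>xs. F (xs ! 0) (xs ! 1) (xs ! 2)) \<Longrightarrow> C n a \<Longrightarrow> C n b \<Longrightarrow> C n c \<Longrightarrow>
    C n (\<lambda>xs. F (a xs) (b xs) (c xs))"
  using comp[of "[a, b, c]" "\<lambda>xs. F (xs ! 0) (xs ! 1) (xs ! 2)" n] by (simp add: numeral_eq_Suc)

lemma lift4: "C 4 (\<lambda>xs. F (xs ! 0) (xs ! 1) (xs ! 2) (xs ! 3)) \<Longrightarrow>
    C n a \<Longrightarrow> C n b \<Longrightarrow> C n c \<Longrightarrow> C n d \<Longrightarrow> C n (\<lambda>xs. F (a xs) (b xs) (c xs) (d xs))"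
  using comp[of "[a, b, c, d]" "\<lambda>xs. F (xs ! 0) (xs ! 1) (xs ! 2) (xs ! 3)" n]
  by (simp add: numeral_eq_Suc)

lemma var [pr]:
  "i < n \<Longrightarrow> C n (\<lambda>xs. xs ! i)"
  "Suc i < n \<Longrightarrow> C n (\<lambda>xs. tl xs ! i)"
  "Suc (Suc i) < n \<Longrightarrow> C n (\<lambda>xs. tl (tl xs) ! i)"
  "Suc (Suc (Suc i)) < n \<Longrightarrow> C n (\<lambda>xs. tl (tl (tl xs)) ! i)"
  "Suc (Suc (Suc (Suc i))) < n \<Longrightarrow> C n (\<lambda>xs. tl (tl (tl (tl xs))) ! i)"
      apply (erule proj)
     apply (rule cong[OF proj[of "Suc i"]]; simp add: nth_tl)
    apply (rule cong[OF proj[of "Suc (Suc i)"]]; simp add: nth_tl)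
   apply (rule cong[OF proj[of "Suc (Suc (Suc i))"]]; simp add: nth_tl)
  apply (rule cong[OF proj[of "Suc (Suc (Suc (Suc i)))"]]; simp add: nth_tl)
  done

lemma weaken_tl: "C n f \<Longrightarrow> C (Suc n) (\<lambda>xs. f (tl xs))"
proof -
  assume f: "C n f"
  have "C (Suc n) (\<lambda>xs. f (map (\<lambda>h. h xs) (map (\<lambda>i xs. xs ! Suc i) [0..<n])))"
    using f by (intro comp) (auto intro: proj)
  then show ?thesis
  proof (rule cong)
    fix xs :: "nat list" assume "length xs = Suc n"
    then have "map (\<lambda>h. h xs) (map (\<lambda>i xs. xs ! Suc i) [0..<n]) = tl xs"
      by (intro nth_equalityI) (auto simp: nth_tl)
    then show "f (map (\<lambda>h. h xs) (map (\<lambda>i xs. xs ! Suc i) [0..<n])) = f (tl xs)" by simp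
  qed
qed

lemma subst_hd: "C (Suc n) f \<Longrightarrow> C n b \<Longrightarrow> C n (\<lambda>xs. f (b xs # xs))"
proof -
  assume f: "C (Suc n) f" and b: "C n b"
  have "C n (\<lambda>xs. f (map (\<lambda>h. h xs) (b # map (\<lambda>i xs. xs ! i) [0..<n])))"
    using f b by (intro comp) (auto intro: proj)
  then show ?thesis
  proof (rule cong)
    fix xs :: "nat list" assume "length xs = n"
    then have "map (\<lambda>h. h xs) (b # map (\<lambda>i xs. xs ! i) [0..<n]) = b xs # xs"
      by (auto intro: nth_equalityI)
    then show "f (map (\<lambda>h. h xs) (b # map (\<lambda>i xs. xs ! i) [0..<n])) = f (b xs # xs)" by simp
  qed
qed

lemma Suc [pr]: "C n f \<Longrightarrow> C n (\<lambda>xs. Suc (f xs))"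
  using lift1[of Suc] succ by simp

lemma const: "C n (\<lambda>xs. c)"
  by (induction c) (auto intro: zero Suc)

lemma numerals [pr]: "C n (\<lambda>xs. 0)" "C n (\<lambda>xs. 1)" "C n (\<lambda>xs. numeral k)"
  by (rule const)+

lemma rec: "C n z \<Longrightarrow> C (Suc (Suc n)) (\<lambda>xs. h (xs ! 0) (xs ! 1) (tl (tl xs))) \<Longrightarrow> C n b \<Longrightarrow>
    C n (\<lambda>xs. rec_nat (z xs) (\<lambda>m r. h m r xs) (b xs))"
proof -
  assume a: "C n z" "C (Suc (Suc n)) (\<lambda>xs. h (xs ! 0) (xs ! 1) (tl (tl xs)))" "C n b"
  show ?thesis
    using subst_hd[OF prec[OF a(1,2)] a(3)] by simp
qed

lemma pred: "C n f \<Longrightarrow> C n (\<lambda>xs. f xs - 1)"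
proof -
  assume f: "C n f"
  have "C n (\<lambda>xs. rec_nat 0 (\<lambda>m r. m) (f xs))"
    by (intro rec pr f) simp
  moreover have "rec_nat 0 (\<lambda>m r. m) x = x - 1" for x :: nat by (cases x) auto
  ultimately show ?thesis by simp
qed

lemma add [pr]: assumes "C n f" "C n g" shows "C n (\<lambda>xs. f xs + g xs)"
proof -
  have "C n (\<lambda>xs. rec_nat (f xs) (\<lambda>m r. Suc r) (g xs))"
    by (intro rec pr assms) simp
  moreover have "rec_nat x (\<lambda>m r. Suc r) y = x + y" for x y :: nat by (induction y) auto
  ultimately show ?thesis by simp
qed

lemma diff [pr]: assumes "C n f" "C n g" shows "C n (\<lambda>xs. f xs - g xs)"
proof -
  have "C n (\<lambda>xs. rec_nat (f xs) (\<lambda>m r. r - 1) (g xs))"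
    by (intro rec pr pred assms) simp
  moreover have "rec_nat x (\<lambda>m r. r - 1) y = x - y" for x y :: nat by (induction y) auto
  ultimately show ?thesis by simp
qed

lemma mult [pr]: assumes "C n f" "C n g" shows "C n (\<lambda>xs. f xs * g xs)"
proof -
  have "C n (\<lambda>xs. rec_nat 0 (\<lambda>m r. f xs + r) (g xs))"
    by (intro rec pr assms weaken_tl[of "Suc n" "\<lambda>xs. f (tl xs)"] weaken_tl) simp
  moreover have "rec_nat 0 (\<lambda>m r. x + r) y = x * y" for x y :: nat by (induction y) auto
  ultimately show ?thesis by simp
qed

text \<open>Predicates are represented by \<open>of_bool\<close>.\<close>

lemma cong_pred: "C n (\<lambda>xs. of_bool (P xs)) \<Longrightarrow> (\<And>xs. length xs = n \<Longrightarrow> P xs = Q xs) \<Longrightarrow>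
    C n (\<lambda>xs. of_bool (Q xs))"
  by (erule cong) simp

lemma conj [pr]: "C n (\<lambda>xs. of_bool (P xs)) \<Longrightarrow> C n (\<lambda>xs. of_bool (Q xs)) \<Longrightarrow>
    C n (\<lambda>xs. of_bool (P xs \<and> Q xs))"
  using mult[of n "\<lambda>xs. of_bool (P xs)" "\<lambda>xs. of_bool (Q xs)"] by (simp add: of_bool_conj)

lemma neg [pr]: assumes "C n (\<lambda>xs. of_bool (P xs))" shows "C n (\<lambda>xs. of_bool (\<not> P xs))"
proof -
  have "C n (\<lambda>xs. 1 - of_bool (P xs))" by (intro pr assms)
  then show ?thesis by (rule cong) auto
qed

lemma disj [pr]: assumes "C n (\<lambda>xs. of_bool (P xs))" "C n (\<lambda>xs. of_bool (Q xs))"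
  shows "C n (\<lambda>xs. of_bool (P xs \<or> Q xs))"
proof -
  have "C n (\<lambda>xs. of_bool (\<not> (\<not> P xs \<and> \<not> Q xs)))" by (intro pr assms)
  then show ?thesis by simp
qed

lemma imp [pr]: assumes "C n (\<lambda>xs. of_bool (P xs))" "C n (\<lambda>xs. of_bool (Q xs))"
  shows "C n (\<lambda>xs. of_bool (P xs \<longrightarrow> Q xs))"
proof -
  have "C n (\<lambda>xs. of_bool (\<not> P xs \<or> Q xs))" by (intro pr assms)
  then show ?thesis by (rule cong) auto
qed

lemma le [pr]: assumes "C n f" "C n g" shows "C n (\<lambda>xs. of_bool (f xs \<le> g xs))"
proof -
  have "C n (\<lambda>xs. 1 - (f xs - g xs))" by (intro pr assms)
  then show ?thesis by (rule cong) auto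
qed

lemma less [pr]: assumes "C n f" "C n g" shows "C n (\<lambda>xs. of_bool (f xs < g xs))"
proof -
  have "C n (\<lambda>xs. of_bool (Suc (f xs) \<le> g xs))" by (intro pr assms)
  then show ?thesis by (rule cong) auto
qed

lemma eq [pr]: assumes "C n f" "C n g" shows "C n (\<lambda>xs. of_bool (f xs = g xs))"
proof -
  have "C n (\<lambda>xs. of_bool (f xs \<le> g xs \<and> g xs \<le> f xs))" by (intro pr assms)
  then show ?thesis by (rule cong) auto
qed

lemma if_then [pr]: assumes "C n (\<lambda>xs. of_bool (P xs))" "C n f" "C n g"
  shows "C n (\<lambda>xs. if P xs then f xs else g xs)"
proof -
  have "C n (\<lambda>xs. of_bool (P xs) * f xs + (1 - of_bool (P xs)) * g xs)" by (intro pr assms)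
  then show ?thesis by (rule cong) auto
qed

lemma of_bool_if [pr]: assumes "C n (\<lambda>xs. of_bool (P xs))" "C n (\<lambda>xs. of_bool (Q xs))" "C n (\<lambda>xs. of_bool (R xs))"
  shows "C n (\<lambda>xs. of_bool (if P xs then Q xs else R xs))"
  using if_then[OF assms] by (rule cong) auto

lemma bex [pr]: assumes "C (Suc n) (\<lambda>xs. of_bool (P (xs ! 0) (tl xs)))" "C n b"
  shows "C n (\<lambda>xs. of_bool (\<exists>i<b xs. P i xs))"
proof -
  have 1: "C (Suc (Suc n)) (\<lambda>xs. of_bool (P (xs ! 0) (tl (tl xs))))"
  proof -
    have "C (Suc (Suc n)) (\<lambda>xs. (\<lambda>ys. of_bool (P (ys ! 0) (tl ys)))
        (map (\<lambda>h. h xs) ((\<lambda>xs. xs ! 0) # map (\<lambda>i xs. xs ! Suc (Suc i)) [0..<n])))"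
      using assms by (intro comp) (auto intro: proj)
    then show ?thesis
    proof (rule cong)
      fix xs :: "nat list" assume "length xs = Suc (Suc n)"
      then have "map (\<lambda>h. h xs) (map (\<lambda>i xs. xs ! Suc (Suc i)) [0..<n]) = tl (tl xs)"
        by (intro nth_equalityI) (auto simp: nth_tl)
      then show "(\<lambda>ys. of_bool (P (ys ! 0) (tl ys)))
        (map (\<lambda>h. h xs) ((\<lambda>xs. xs ! 0) # map (\<lambda>i xs. xs ! Suc (Suc i)) [0..<n])) =
        of_bool (P (xs ! 0) (tl (tl xs)))" by simp
    qed
  qed
  have "C n (\<lambda>xs. rec_nat 0 (\<lambda>i r. of_bool (r = 1 \<or> P i xs)) (b xs))"
    by (intro rec pr assms 1) simp
  moreover have "rec_nat 0 (\<lambda>i r. of_bool (r = 1 \<or> P i xs)) m = (of_bool (\<exists>i<m. P i xs) :: nat)" for m xs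
    by (induction m) (auto simp: less_Suc_eq)
  ultimately show ?thesis by (simp only:)
qed

lemma ball [pr]: assumes "C (Suc n) (\<lambda>xs. of_bool (P (xs ! 0) (tl xs)))" "C n b"
  shows "C n (\<lambda>xs. of_bool (\<forall>i<b xs. P i xs))"
proof -
  have "C n (\<lambda>xs. of_bool (\<not> (\<exists>i<b xs. \<not> P i xs)))" by (intro pr assms)
  then show ?thesis by (rule cong) auto
qed

lemma bex_le [pr]: assumes "C (Suc n) (\<lambda>xs. of_bool (P (xs ! 0) (tl xs)))" "C n b"
  shows "C n (\<lambda>xs. of_bool (\<exists>i\<le>b xs. P i xs))"
  using bex[OF assms(1) Suc[OF assms(2)]] by (simp add: less_Suc_eq_le)

text \<open>A counter that increases until it meets a witness and then stays put equals, after
  \<open>m\<close> steps, the minimum of \<open>m\<close> and the least witness; so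
  \<open>b xs\<close> steps reach it.\<close>

lemma bounded_least: assumes "C (Suc n) (\<lambda>xs. of_bool (P (xs ! 0) (tl xs)))" "C n b"
    "\<And>xs. length xs = n \<Longrightarrow> \<exists>i\<le>b xs. P i xs"
  shows "C n (\<lambda>xs. LEAST i. P i xs)"
proof -
  have 1: "C (Suc (Suc n)) (\<lambda>xs. of_bool (P (xs ! 1) (tl (tl xs))))"
    using weaken_tl[OF assms(1)] by (rule cong) (simp add: nth_tl)
  have "C n (\<lambda>xs. rec_nat 0 (\<lambda>i r. if P r xs then r else Suc r) (b xs))"
    by (intro rec pr assms 1) simp_all
  then show ?thesis
  proof (rule cong)
    fix xs :: "nat list" assume "length xs = n"
    from assms(3)[OF this] obtain i where i: "i \<le> b xs" "P i xs" by blast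
    let ?l = "LEAST i. P i xs"
    have l: "P ?l xs" "?l \<le> b xs" using i by (auto intro: LeastI Least_le order.trans)
    have "rec_nat 0 (\<lambda>i r. if P r xs then r else Suc r) m = min m ?l" for m
    proof (induction m)
      case (Suc m)
      show ?case
      proof (cases "m < ?l")
        case True
        then show ?thesis using Suc not_less_Least[of m "\<lambda>i. P i xs"] by auto
      next
        case False
        then show ?thesis using Suc l by auto
      qed
    qed simp
    then show "rec_nat 0 (\<lambda>i r. if P r xs then r else Suc r) (b xs) = ?l" using l by simp
  qed
qed

lemma even [pr]: assumes "C n f" shows "C n (\<lambda>xs. of_bool (even (f xs)))"
proof -
  have "C n (\<lambda>xs. of_bool (\<exists>i\<le>f xs. i + i = f xs))"
    by (intro pr assms weaken_tl) simp_all
  then show ?thesis by (rule cong_pred) presburger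
qed

lemma div2 [pr]: assumes "C n f" shows "C n (\<lambda>xs. f xs div 2)"
proof -
  have "C n (\<lambda>xs. LEAST i. f xs \<le> Suc (i + i))"
    by (rule bounded_least[where b = f]) (intro pr assms weaken_tl | simp | fastforce)+
  moreover have "(LEAST i. x \<le> Suc (i + i)) = x div 2" for x :: nat
    by (rule Least_equality) presburger+
  ultimately show ?thesis by simp
qed

end

section \<open>Codes of pairs and lists\<close>

definition p1 :: "nat \<Rightarrow> nat" where "p1 c = fst (prod_decode c)"
definition p2 :: "nat \<Rightarrow> nat" where "p2 c = snd (prod_decode c)"

lemma p_simps [simp]: "p1 (prod_encode (a, b)) = a" "p2 (prod_encode (a, b)) = b"
  "prod_encode (p1 c, p2 c) = c"
  by (auto simp: p1_def p2_def)

lemma p_le: "p1 c \<le> c" "p2 c \<le> c"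
  by (metis le_prod_encode_1 p_simps(3)) (metis le_prod_encode_2 p_simps(3))

text \<open>\<open>chd\<close> and \<open>ctl\<close> are 0 on the code 0 of the empty list.\<close>

definition chd :: "nat \<Rightarrow> nat" where "chd c = p1 (c - 1)"
definition ctl :: "nat \<Rightarrow> nat" where "ctl c = p2 (c - 1)"
definition cdrop :: "nat \<Rightarrow> nat \<Rightarrow> nat" where "cdrop i c = (ctl ^^ i) c"
definition cnth :: "nat \<Rightarrow> nat \<Rightarrow> nat" where "cnth c i = chd (cdrop i c)"
definition clen :: "nat \<Rightarrow> nat" where "clen c = length (list_decode c)"

lemma p_0 [simp]: "p1 0 = 0" "p2 0 = 0"
  using p_le[of 0] by auto

lemma ctl_encode [simp]: "ctl (list_encode xs) = list_encode (tl xs)"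
  by (cases xs) (auto simp: ctl_def)

lemma chd_encode: "xs \<noteq> [] \<Longrightarrow> chd (list_encode xs) = hd xs"
  by (cases xs) (auto simp: chd_def)

lemma cdrop_encode [simp]: "cdrop i (list_encode xs) = list_encode (drop i xs)"
  unfolding cdrop_def by (induction i) (auto simp: drop_Suc tl_drop)

lemma cnth_encode [simp]: "i < length xs \<Longrightarrow> cnth (list_encode xs) i = xs ! i"
  by (simp add: cnth_def chd_encode hd_drop_conv_nth)

lemma clen_encode [simp]: "clen (list_encode xs) = length xs"
  by (simp add: clen_def)

lemma length_le_encode: "length xs \<le> list_encode xs"
proof (induction xs)
  case (Cons a xs)
  then show ?case using le_prod_encode_2[of "list_encode xs" a] by simp
qed simp

lemma clen_le: "clen c \<le> c"
  using length_le_encode[of "list_decode c"] by (simp add: clen_def)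

lemma list_encode_eq_0 [simp]: "list_encode xs = 0 \<longleftrightarrow> xs = []"
  by (cases xs) auto

context pr_class
begin

lemma prod_encode [pr]: assumes "C n f" "C n g" shows "C n (\<lambda>xs. prod_encode (f xs, g xs))"
proof -
  have "C 1 (\<lambda>xs. rec_nat 0 (\<lambda>m r. r + Suc m) (xs ! 0))"
    by (intro rec pr) simp_all
  moreover have "rec_nat 0 (\<lambda>m r. r + Suc m) x = triangle x" for x
    by (induction x) auto
  ultimately have "C 1 (\<lambda>xs. triangle (xs ! 0))" by simp
  from lift1[OF this add[OF assms]] show ?thesis
    using add[OF _ assms(1)] by (auto simp: prod_encode_def)
qed

lemma p1 [pr]: assumes "C n f" shows "C n (\<lambda>xs. p1 (f xs))"
proof -
  have "C 1 (\<lambda>xs. LEAST a. \<exists>b\<le>xs ! 0. prod_encode (a, b) = xs ! 0)"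
    apply (rule bounded_least[where b = "\<lambda>xs. xs ! 0"])
      apply (intro pr; simp)
     apply (intro pr; simp)
    subgoal for xs
      using p_le[of "xs ! 0"] p_simps(3)[of "xs ! 0"] by blast
    done
  moreover have "(LEAST a. \<exists>b\<le>x. prod_encode (a, b) = x) = p1 x" for x
    by (rule Least_equality) (use p_le[of x] p_simps(3)[of x] p_simps(1) in \<open>blast | fastforce\<close>)+
  ultimately show ?thesis using lift1[OF _ assms] by simp
qed

lemma p2 [pr]: assumes "C n f" shows "C n (\<lambda>xs. p2 (f xs))"
proof -
  have "C 1 (\<lambda>xs. LEAST b. prod_encode (p1 (xs ! 0), b) = xs ! 0)"
    apply (rule bounded_least[where b = "\<lambda>xs. xs ! 0"])
      apply (intro pr; simp)
     apply (intro pr; simp)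
    subgoal for xs
      using p_le[of "xs ! 0"] p_simps(3)[of "xs ! 0"] by blast
    done
  moreover have "(LEAST b. prod_encode (p1 x, b) = x) = p2 x" for x
    by (rule Least_equality) (simp, metis p_simps(2) order_refl)
  ultimately show ?thesis using lift1[OF _ assms] by simp
qed

lemma chd [pr]: "C n f \<Longrightarrow> C n (\<lambda>xs. chd (f xs))"
  unfolding chd_def by (intro pr)

lemma ctl [pr]: "C n f \<Longrightarrow> C n (\<lambda>xs. ctl (f xs))"
  unfolding ctl_def by (intro pr)

lemma cdrop [pr]: assumes "C n f" "C n g" shows "C n (\<lambda>xs. cdrop (f xs) (g xs))"
proof -
  have "C n (\<lambda>xs. rec_nat (g xs) (\<lambda>i r. ctl r) (f xs))" by (intro rec pr assms) simp
  moreover have "rec_nat x (\<lambda>i r. ctl r) y = cdrop y x" for x y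
    unfolding cdrop_def by (induction y) auto
  ultimately show ?thesis by simp
qed

lemma cnth [pr]: assumes "C n f" "C n g" shows "C n (\<lambda>xs. cnth (f xs) (g xs))"
  unfolding cnth_def by (intro pr assms)

lemma clen [pr]: assumes "C n f" shows "C n (\<lambda>xs. clen (f xs))"
proof -
  have eq: "cdrop i x = 0 \<longleftrightarrow> clen x \<le> i" for i x
    using cdrop_encode[of i "list_decode x"] by (simp add: clen_def)
  have "C 1 (\<lambda>xs. LEAST i. cdrop i (xs ! 0) = 0)"
    apply (rule bounded_least[where b = "\<lambda>xs. xs ! 0"])
    by (intro pr | simp)+ (auto simp: eq intro: clen_le)
  moreover have "(LEAST i. cdrop i x = 0) = clen x" for x
    unfolding eq by (rule Least_equality) auto
  ultimately show ?thesis using lift1[OF _ assms] by simp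
qed

text \<open>Recursion over a list becomes recursion over the lengths of its suffixes: step
  \<open>i\<close> passes from the suffix of length \<open>i\<close> to the one of length
  \<open>i + 1\<close>.\<close>

lemma rec_list: assumes "C n z"
    "C (Suc (Suc (Suc n))) (\<lambda>xs. h (xs ! 0) (xs ! 1) (xs ! 2) (tl (tl (tl xs))))" "C n b"
  shows "C n (\<lambda>xs. rec_list (z xs) (\<lambda>a l r. h a (list_encode l) r xs) (list_decode (b xs)))"
proof -
  let ?d = "\<lambda>i xs. cdrop (clen (b xs) - Suc i) (b xs)"
  have "C (Suc (Suc n)) (\<lambda>xs. (\<lambda>ys. h (ys ! 0) (ys ! 1) (ys ! 2) (tl (tl (tl ys))))
     (map (\<lambda>h. h xs) ((\<lambda>xs. chd (?d (xs ! 0) (tl (tl xs)))) # (\<lambda>xs. ctl (?d (xs ! 0) (tl (tl xs)))) #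
       (\<lambda>xs. xs ! 1) # map (\<lambda>i xs. xs ! Suc (Suc i)) [0..<n])))"
    using assms(2) by (intro comp)
      (auto intro!: pr assms weaken_tl[of "Suc n" "\<lambda>xs. b (tl xs)"] weaken_tl)
  then have 1: "C (Suc (Suc n)) (\<lambda>xs. h (chd (?d (xs ! 0) (tl (tl xs)))) (ctl (?d (xs ! 0) (tl (tl xs))))
       (xs ! 1) (tl (tl xs)))"
  proof (rule cong)
    fix xs :: "nat list" assume "length xs = Suc (Suc n)"
    then have "map ((\<lambda>h. h xs) \<circ> (\<lambda>i xs. xs ! Suc (Suc i))) [0..<n] = tl (tl xs)"
      by (intro nth_equalityI) (auto simp: nth_tl)
    then show "(\<lambda>ys. h (ys ! 0) (ys ! 1) (ys ! 2) (tl (tl (tl ys))))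
     (map (\<lambda>h. h xs) ((\<lambda>xs. chd (?d (xs ! 0) (tl (tl xs)))) # (\<lambda>xs. ctl (?d (xs ! 0) (tl (tl xs)))) #
       (\<lambda>xs. xs ! 1) # map (\<lambda>i xs. xs ! Suc (Suc i)) [0..<n])) =
       h (chd (?d (xs ! 0) (tl (tl xs)))) (ctl (?d (xs ! 0) (tl (tl xs)))) (xs ! 1) (tl (tl xs))"
      by (simp add: numeral_eq_Suc)
  qed
  have "C n (\<lambda>xs. rec_nat (z xs) (\<lambda>i r. h (chd (?d i xs)) (ctl (?d i xs)) r xs) (clen (b xs)))"
    by (intro rec pr assms 1)
  then show ?thesis
  proof (rule cong)
    fix xs :: "nat list"
    define l where "l = list_decode (b xs)"
    have b: "b xs = list_encode l" by (simp add: l_def)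
    have "i \<le> length l \<Longrightarrow> rec_nat (z xs) (\<lambda>i r. h (chd (?d i xs)) (ctl (?d i xs)) r xs) i =
       rec_list (z xs) (\<lambda>a l r. h a (list_encode l) r xs) (drop (length l - i) l)" for i
    proof (induction i)
      case (Suc i)
      let ?k = "length l - Suc i"
      have "drop ?k l = l ! ?k # drop (length l - i) l"
        using Suc.prems by (metis Cons_nth_drop_Suc Suc_diff_Suc Suc_le_lessD diff_less zero_less_Suc
            length_greater_0_conv list.size(3) not_less_zero order_less_le_trans)
      then show ?case using Suc by (simp add: b chd_encode)
    qed simp
    from this[of "length l"]
    show "rec_nat (z xs) (\<lambda>i r. h (chd (?d i xs)) (ctl (?d i xs)) r xs) (clen (b xs)) =
      rec_list (z xs) (\<lambda>a l r. h a (list_encode l) r xs) (list_decode (b xs))"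
      by (simp add: b)
  qed
qed

end

text \<open>The inductive definitions are not extensional: they fix the values on lists of the wrong length.\<close>

definition ext_closure :: "(nat \<Rightarrow> (nat list \<Rightarrow> nat) \<Rightarrow> bool) \<Rightarrow> nat \<Rightarrow> (nat list \<Rightarrow> nat) \<Rightarrow> bool" where
  "ext_closure C n f \<longleftrightarrow> (\<exists>f'. C n f' \<and> (\<forall>xs. length xs = n \<longrightarrow> f xs = f' xs))"

abbreviation primf :: "(nat \<Rightarrow> nat) set \<Rightarrow> nat \<Rightarrow> (nat list \<Rightarrow> nat) \<Rightarrow> bool" where
  "primf Orc \<equiv> ext_closure (prim_rec_in Orc)"

lemma choose_on_set:
  assumes "\<forall>h\<in>set hs. \<exists>h'. Q h' \<and> R h h'"
  shows "\<exists>hs'. length hs' = length hs \<and> (\<forall>h\<in>set hs'. Q h) \<and> (\<forall>i<length hs. R (hs ! i) (hs' ! i))"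
proof -
  from assms obtain F where "\<forall>h\<in>set hs. Q (F h) \<and> R h (F h)" by metis
  then show ?thesis by (intro exI[of _ "map F hs"]) auto
qed

lemma pr_class_ext_closure:
  assumes zero: "\<And>n. C n (\<lambda>xs. 0)"
    and succ: "C 1 (\<lambda>xs. Suc (xs ! 0))"
    and proj: "\<And>i n. i < n \<Longrightarrow> C n (\<lambda>xs. xs ! i)"
    and comp: "\<And>hs f n. C (length hs) f \<Longrightarrow> (\<forall>h\<in>set hs. C n h) \<Longrightarrow> C n (\<lambda>xs. f (map (\<lambda>h. h xs) hs))"
    and prec: "\<And>n f h. C n f \<Longrightarrow> C (Suc (Suc n)) h \<Longrightarrow>
      C (Suc n) (\<lambda>xs. rec_nat (f (tl xs)) (\<lambda>m r. h (m # r # tl xs)) (hd xs))"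
  shows "pr_class (ext_closure C)"
proof
  show "ext_closure C n f \<Longrightarrow> (\<And>xs. length xs = n \<Longrightarrow> f xs = g xs) \<Longrightarrow> ext_closure C n g" for n f g
    unfolding ext_closure_def by metis
  show "ext_closure C n (\<lambda>xs. 0)" for n using zero ext_closure_def by blast
  show "ext_closure C 1 (\<lambda>xs. Suc (xs ! 0))" using succ ext_closure_def by blast
  show "i < n \<Longrightarrow> ext_closure C n (\<lambda>xs. xs ! i)" for i n using proj ext_closure_def by blast
next
  fix hs and f n assume f: "ext_closure C (length hs) f" and hs: "\<forall>h\<in>set hs. ext_closure C n h"
  from f obtain f' where f': "C (length hs) f'" "\<And>xs. length xs = length hs \<Longrightarrow> f xs = f' xs"
    unfolding ext_closure_def by auto
  from choose_on_set[OF hs[unfolded ext_closure_def]] obtain hs' where hs': "length hs' = length hs"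
    "\<forall>h\<in>set hs'. C n h" "\<And>i xs. i < length hs \<Longrightarrow> length xs = n \<Longrightarrow> (hs ! i) xs = (hs' ! i) xs"
    by metis
  have "C n (\<lambda>xs. f' (map (\<lambda>h. h xs) hs'))"
    using f' hs' by (intro comp) auto
  moreover have "f (map (\<lambda>h. h xs) hs) = f' (map (\<lambda>h. h xs) hs')" if "length xs = n" for xs
  proof -
    have "map (\<lambda>h. h xs) hs = map (\<lambda>h. h xs) hs'" using hs' that by (intro nth_equalityI) auto
    then show ?thesis using f'(2) hs'(1) by simp
  qed
  ultimately show "ext_closure C n (\<lambda>xs. f (map (\<lambda>h. h xs) hs))" unfolding ext_closure_def by blast
next
  fix n f h assume "ext_closure C n f" "ext_closure C (Suc (Suc n)) h"
  then obtain f' h' where 1: "C n f'" "\<And>xs. length xs = n \<Longrightarrow> f xs = f' xs"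
    "C (Suc (Suc n)) h'" "\<And>xs. length xs = Suc (Suc n) \<Longrightarrow> h xs = h' xs"
    unfolding ext_closure_def by auto
  from prec[OF 1(1,3)]
  show "ext_closure C (Suc n) (\<lambda>xs. rec_nat (f (tl xs)) (\<lambda>m r. h (m # r # tl xs)) (hd xs))"
    unfolding ext_closure_def by (intro exI conjI) (assumption, simp add: 1)
qed

lemma pr_class_primf: "pr_class (primf Orc)"
  by (rule pr_class_ext_closure) (rule prim_rec_in.intros; assumption)+

lemma pr_class_computable: "pr_class (ext_closure computable_fun)"
  by (rule pr_class_ext_closure) (rule computable_fun.intros; assumption)+

text \<open>Minimality of the inductive definition. With an oracle class as \<open>C\<close> it
  replaces one oracle by another, hence transitivity of \<open>\<le>\<^sub>P\<^sub>R\<close>; with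
  no oracle it embeds the primitive recursive functions into every class considered.\<close>

lemma (in pr_class) prim_rec_in_imp:
  assumes "prim_rec_in Orc n f" and "\<And>g. g \<in> Orc \<Longrightarrow> C 1 (\<lambda>xs. g (xs ! 0))"
  shows "C n f"
  using assms(1) by induction (auto intro: zero succ proj comp prec assms(2) simp flip: One_nat_def)

lemma (in pr_class) primf_imp:
  assumes "primf Orc n f" and "\<And>g. g \<in> Orc \<Longrightarrow> C 1 (\<lambda>xs. g (xs ! 0))"
  shows "C n f"
  using assms prim_rec_in_imp unfolding ext_closure_def by (metis cong)

lemma (in pr_class) primf_empty: "primf {} n f \<Longrightarrow> C n f"
  by (rule primf_imp) auto

section \<open>Arithmetical classes of predicates\<close>

interpretation PR: pr_class "primf {}" by (rule pr_class_primf)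

text \<open>A primitive recursive change of arguments. Substitution into a predicate is then
  justified by assembling the new argument list from \<open>vec_Cons\<close> and tails.\<close>

definition vec :: "nat \<Rightarrow> nat \<Rightarrow> (nat list \<Rightarrow> nat list) \<Rightarrow> bool" where
  "vec n m us \<longleftrightarrow> (\<exists>hs. length hs = m \<and> (\<forall>h\<in>set hs. primf {} n h) \<and>
     (\<forall>xs. length xs = n \<longrightarrow> us xs = map (\<lambda>h. h xs) hs))"

named_theorems vec

lemma vec_Nil [vec]: "vec n 0 (\<lambda>xs. [])"
  unfolding vec_def by auto

lemma vec_Cons [vec]: "primf {} n f \<Longrightarrow> vec n m us \<Longrightarrow> vec n (Suc m) (\<lambda>xs. f xs # us xs)"
  unfolding vec_def by clarify (rule_tac x="f # hs" in exI; simp)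

lemma vec_map: "length hs = m \<Longrightarrow> (\<forall>h\<in>set hs. primf {} n h) \<Longrightarrow> vec n m (\<lambda>xs. map (\<lambda>h. h xs) hs)"
  unfolding vec_def by auto

lemma vec_drop: "vec (n + m) m (\<lambda>xs. drop n xs)"
  unfolding vec_def
  by (intro exI[of _ "map (\<lambda>i xs. xs ! i) [n..<n + m]"]) (auto intro: PR.proj nth_equalityI)

lemma vec_id [vec]: "vec n n (\<lambda>xs. xs)"
  using vec_drop[of 0 n] by simp

lemma vec_tl [vec]: "vec (Suc n) n tl"
  using vec_drop[of 1 n] by (simp add: drop_Suc)

lemma vec_tl_tl [vec]: "vec (Suc (Suc n)) n (\<lambda>xs. tl (tl xs))"
  using vec_drop[of 2 n] by (simp add: drop_Suc numeral_2_eq_2)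

lemma vec_tl_tl_tl [vec]: "vec (Suc (Suc (Suc n))) n (\<lambda>xs. tl (tl (tl xs)))"
  using vec_drop[of 3 n] by (simp add: drop_Suc numeral_3_eq_3)

lemma vec_tl_tl_tl_tl [vec]: "vec (Suc (Suc (Suc (Suc n)))) n (\<lambda>xs. tl (tl (tl (tl xs))))"
  using vec_drop[of 4 n] by (simp add: drop_Suc numeral_eq_Suc)

lemma primf_vec: "primf {} m f \<Longrightarrow> vec n m us \<Longrightarrow> primf {} n (\<lambda>xs. f (us xs))"
  unfolding vec_def by (auto intro: PR.cong[OF PR.comp])

lemma primf_tl: "primf {} n f \<Longrightarrow> primf {} (Suc n) (\<lambda>xs. f (tl xs))"
  by (erule primf_vec) (rule vec)

lemma primf_hd [pr]: "primf {} (Suc n) hd"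
  by (rule PR.cong[OF PR.proj[of 0]]) (auto simp: length_Suc_conv)

text \<open>Closure under negation is left out on purpose: the interface has to fit single prefix
  classes such as \<open>\<Sigma>\<^sup>0\<^sub>1\<close> and
  \<open>\<Pi>\<^sup>0\<^sub>2\<close>.\<close>

locale good =
  fixes K :: "nat \<Rightarrow> (nat list \<Rightarrow> bool) \<Rightarrow> bool"
  assumes cong: "K n P \<Longrightarrow> (\<And>xs. length xs = n \<Longrightarrow> P xs = Q xs) \<Longrightarrow> K n Q"
    and base: "primf {} n (\<lambda>xs. of_bool (P xs)) \<Longrightarrow> K n P"
    and subst': "K (length hs) P \<Longrightarrow> (\<forall>h\<in>set hs. primf {} n h) \<Longrightarrow>
      K n (\<lambda>xs. P (map (\<lambda>h. h xs) hs))"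
    and conj: "K n P \<Longrightarrow> K n Q \<Longrightarrow> K n (\<lambda>xs. P xs \<and> Q xs)"
    and disj: "K n P \<Longrightarrow> K n Q \<Longrightarrow> K n (\<lambda>xs. P xs \<or> Q xs)"
    and ball': "K (Suc n) P \<Longrightarrow> primf {} n b \<Longrightarrow> K n (\<lambda>xs. \<forall>i<b xs. P (i # xs))"
begin

lemma subst: "K m P \<Longrightarrow> vec n m us \<Longrightarrow> K n (\<lambda>xs. P (us xs))"
  unfolding vec_def by (auto intro: cong[OF subst'])

lemma ball: "K (Suc n) (\<lambda>xs. P (xs ! 0) (tl xs)) \<Longrightarrow> primf {} n b \<Longrightarrow> K n (\<lambda>xs. \<forall>i<b xs. P i xs)"
  using ball'[of n "\<lambda>xs. P (xs ! 0) (tl xs)" b] by simp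

lemma list_conj: "(\<forall>P\<in>set Ps. K n P) \<Longrightarrow> K n (\<lambda>xs. \<forall>P\<in>set Ps. P xs)"
proof (induction Ps)
  case Nil
  have "K n (\<lambda>xs. True)" by (intro base) (simp add: PR.const)
  then show ?case by simp
next
  case (Cons P Ps)
  then show ?case using conj[of n P "\<lambda>xs. \<forall>P\<in>set Ps. P xs"] by simp
qed

lemma lift2: "K 2 (\<lambda>xs. F (xs ! 0) (xs ! 1)) \<Longrightarrow> primf {} n a \<Longrightarrow> primf {} n b \<Longrightarrow> K n (\<lambda>xs. F (a xs) (b xs))"
  using subst'[of "[a, b]" "\<lambda>xs. F (xs ! 0) (xs ! 1)" n] by (simp add: numeral_eq_Suc)

lemma lift3: "K 3 (\<lambda>xs. F (xs ! 0) (xs ! 1) (xs ! 2)) \<Longrightarrow> primf {} n a \<Longrightarrow> primf {} n b \<Longrightarrow> primf {} n c \<Longrightarrow>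
    K n (\<lambda>xs. F (a xs) (b xs) (c xs))"
  using subst'[of "[a, b, c]" "\<lambda>xs. F (xs ! 0) (xs ! 1) (xs ! 2)" n] by (simp add: numeral_eq_Suc)

end

section \<open>Quantifier prefixes over primitive recursive predicates\<close>

definition PRp :: "nat \<Rightarrow> (nat list \<Rightarrow> bool) \<Rightarrow> bool" where
  "PRp n P \<longleftrightarrow> primf {} n (\<lambda>xs. of_bool (P xs))"

text \<open>\<open>EXc PRp\<close>, \<open>ALLc (EXc PRp)\<close> and
  \<open>EXc (ALLc (EXc PRp))\<close> are the classes \<open>\<Sigma>\<^sup>0\<^sub>1\<close>,
  \<open>\<Pi>\<^sup>0\<^sub>2\<close> and \<open>\<Sigma>\<^sup>0\<^sub>3\<close> in normal form,
  with a primitive recursive matrix.\<close>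

definition EXc :: "(nat \<Rightarrow> (nat list \<Rightarrow> bool) \<Rightarrow> bool) \<Rightarrow> nat \<Rightarrow> (nat list \<Rightarrow> bool) \<Rightarrow> bool" where
  "EXc K n P \<longleftrightarrow> (\<exists>Q. K (Suc n) Q \<and> (\<forall>xs. length xs = n \<longrightarrow> P xs \<longleftrightarrow> (\<exists>y. Q (y # xs))))"

definition ALLc :: "(nat \<Rightarrow> (nat list \<Rightarrow> bool) \<Rightarrow> bool) \<Rightarrow> nat \<Rightarrow> (nat list \<Rightarrow> bool) \<Rightarrow> bool" where
  "ALLc K n P \<longleftrightarrow> (\<exists>Q. K (Suc n) Q \<and> (\<forall>xs. length xs = n \<longrightarrow> P xs \<longleftrightarrow> (\<forall>y. Q (y # xs))))"

lemma EXcI: "K (Suc n) Q \<Longrightarrow> (\<And>xs. length xs = n \<Longrightarrow> P xs \<longleftrightarrow> (\<exists>y. Q (y # xs))) \<Longrightarrow> EXc K n P"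
  unfolding EXc_def by blast

lemma ALLcI: "K (Suc n) Q \<Longrightarrow> (\<And>xs. length xs = n \<Longrightarrow> P xs \<longleftrightarrow> (\<forall>y. Q (y # xs))) \<Longrightarrow> ALLc K n P"
  unfolding ALLc_def by blast

lemma good_PRp: "good PRp"
proof
  show "PRp n P \<Longrightarrow> (\<And>xs. length xs = n \<Longrightarrow> P xs = Q xs) \<Longrightarrow> PRp n Q" for n P Q
    unfolding PRp_def by (rule PR.cong_pred)
  show "PRp n P \<Longrightarrow> PRp n Q \<Longrightarrow> PRp n (\<lambda>xs. P xs \<or> Q xs)" for n P Q
    unfolding PRp_def by (rule PR.disj)
  show "PRp (length hs) P \<Longrightarrow> \<forall>h\<in>set hs. primf {} n h \<Longrightarrow> PRp n (\<lambda>xs. P (map (\<lambda>h. h xs) hs))" for hs P n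
    unfolding PRp_def using PR.comp[of hs "\<lambda>xs. of_bool (P xs)"] by simp
  fix n P b assume "PRp (Suc n) P" "primf {} n b"
  then show "PRp n (\<lambda>xs. \<forall>i<b xs. P (i # xs))"
    unfolding PRp_def
    by (intro PR.ball) (auto elim!: PR.cong_pred simp: length_Suc_conv)
qed (auto simp: PRp_def intro: PR.cong_pred PR.conj PR.disj)

lemma list_code_exists:
  assumes "\<forall>i<b. \<exists>y. Q y i"
  shows "\<exists>c. \<forall>i<b. Q (cnth c i) i"
proof -
  from assms obtain y where "\<forall>i<b. Q (y i) i" by metis
  then show ?thesis by (intro exI[of _ "list_encode (map y [0..<b])"]) simp
qed

lemma pair_ex: "(\<exists>x y. P x y) \<longleftrightarrow> (\<exists>c. P (p1 c) (p2 c))"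
  by (metis p_simps(1,2))

lemma pair_all: "(\<forall>x y. P x y) \<longleftrightarrow> (\<forall>c. P (p1 c) (p2 c))"
  by (metis p_simps(1,2))

text \<open>A conjunction needs a pair of witnesses and a bounded universal quantifier a coded list
  of them; a disjunction can share one variable.\<close>

lemma (in good) good_EXc: "good (EXc K)"
proof
  show "EXc K n P \<Longrightarrow> (\<And>xs. length xs = n \<Longrightarrow> P xs = Q xs) \<Longrightarrow> EXc K n Q" for n P Q
    unfolding EXc_def by auto
  show "primf {} n (\<lambda>xs. of_bool (P xs)) \<Longrightarrow> EXc K n P" for n P
    by (rule EXcI[where Q = "\<lambda>ys. P (tl ys)"]) (auto intro: base primf_tl)
next
  fix hs P n assume P: "EXc K (length hs) P" and hs: "\<forall>h\<in>set hs. primf {} n h"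
  from P obtain Q where Q: "K (Suc (length hs)) Q" "\<And>xs. length xs = length hs \<Longrightarrow> P xs \<longleftrightarrow> (\<exists>y. Q (y # xs))"
    unfolding EXc_def by blast
  have "K (Suc n) (\<lambda>ys. Q (hd ys # map (\<lambda>h. h ys) (map (\<lambda>h ys. h (tl ys)) hs)))"
    by (rule subst[OF Q(1)]) (intro vec vec_map pr; use hs in \<open>auto intro: primf_tl\<close>)
  then show "EXc K n (\<lambda>xs. P (map (\<lambda>h. h xs) hs))"
    by (rule EXcI) (simp add: Q(2) comp_def)
next
  fix n P P' assume "EXc K n P" "EXc K n P'"
  then obtain Q Q' where Q: "K (Suc n) Q" "\<And>xs. length xs = n \<Longrightarrow> P xs \<longleftrightarrow> (\<exists>y. Q (y # xs))"
    "K (Suc n) Q'" "\<And>xs. length xs = n \<Longrightarrow> P' xs \<longleftrightarrow> (\<exists>y. Q' (y # xs))"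
    unfolding EXc_def by auto
  have "K (Suc n) (\<lambda>ys. Q (p1 (hd ys) # tl ys) \<and> Q' (p2 (hd ys) # tl ys))"
    by (intro conj subst[OF Q(1)] subst[OF Q(3)] vec pr)
  then show "EXc K n (\<lambda>xs. P xs \<and> P' xs)"
    by (rule EXcI) (simp add: Q pair_ex[symmetric, of "\<lambda>x y. Q (x # _) \<and> Q' (y # _)"])
  show "EXc K n (\<lambda>xs. P xs \<or> P' xs)"
    using disj[OF Q(1,3)] by (rule EXcI) (auto simp add: Q)
next
  fix n P b assume "EXc K (Suc n) P" and b: "primf {} n b"
  then obtain Q where Q: "K (Suc (Suc n)) Q" "\<And>xs. length xs = Suc n \<Longrightarrow> P xs \<longleftrightarrow> (\<exists>y. Q (y # xs))"
    unfolding EXc_def by auto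
  have "K (Suc n) (\<lambda>ys. \<forall>i<b (tl ys). Q (cnth (ys ! 0) i # i # tl ys))"
    by (intro ball subst[OF Q(1)] vec pr primf_tl b) simp_all
  then show "EXc K n (\<lambda>xs. \<forall>i<b xs. P (i # xs))"
    by (rule EXcI) (auto simp add: Q intro: list_code_exists[of _ "\<lambda>y i. Q (y # i # _)"])
qed

lemma (in good) EXc_ex: assumes "EXc K (Suc n) (\<lambda>xs. P (xs ! 0) (tl xs))" shows "EXc K n (\<lambda>xs. \<exists>y. P y xs)"
proof -
  from assms obtain Q where Q: "K (Suc (Suc n)) Q" "\<And>xs. length xs = Suc n \<Longrightarrow> P (xs ! 0) (tl xs) \<longleftrightarrow> (\<exists>y. Q (y # xs))"
    unfolding EXc_def by auto
  have "K (Suc n) (\<lambda>ys. Q (p2 (ys ! 0) # p1 (ys ! 0) # tl ys))"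
    by (intro subst[OF Q(1)] vec pr) simp_all
  then show ?thesis
  proof (rule EXcI)
    fix xs :: "nat list" assume "length xs = n"
    then have "P y xs \<longleftrightarrow> (\<exists>z. Q (z # y # xs))" for y using Q(2)[of "y # xs"] by simp
    then show "(\<exists>y. P y xs) \<longleftrightarrow> (\<exists>y. Q (p2 ((y # xs) ! 0) # p1 ((y # xs) ! 0) # tl (y # xs)))"
      using pair_ex[of "\<lambda>y z. Q (z # y # xs)"] by simp
  qed
qed

text \<open>The costs are exchanged: a disjunction needs two independent universal variables, merged
  into a pair, while a bounded universal quantifier commutes with the prefix.\<close>

lemma (in good) good_ALLc: "good (ALLc K)"
proof
  show "ALLc K n P \<Longrightarrow> (\<And>xs. length xs = n \<Longrightarrow> P xs = Q xs) \<Longrightarrow> ALLc K n Q" for n P Q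
    unfolding ALLc_def by auto
  show "primf {} n (\<lambda>xs. of_bool (P xs)) \<Longrightarrow> ALLc K n P" for n P
    by (rule ALLcI[where Q = "\<lambda>ys. P (tl ys)"]) (auto intro: base primf_tl)
next
  fix hs P n assume P: "ALLc K (length hs) P" and hs: "\<forall>h\<in>set hs. primf {} n h"
  from P obtain Q where Q: "K (Suc (length hs)) Q" "\<And>xs. length xs = length hs \<Longrightarrow> P xs \<longleftrightarrow> (\<forall>y. Q (y # xs))"
    unfolding ALLc_def by blast
  have "K (Suc n) (\<lambda>ys. Q (hd ys # map (\<lambda>h. h ys) (map (\<lambda>h ys. h (tl ys)) hs)))"
    by (rule subst[OF Q(1)]) (intro vec vec_map pr; use hs in \<open>auto intro: primf_tl\<close>)
  then show "ALLc K n (\<lambda>xs. P (map (\<lambda>h. h xs) hs))"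
    by (rule ALLcI) (simp add: Q(2) comp_def)
next
  fix n P P' assume "ALLc K n P" "ALLc K n P'"
  then obtain Q Q' where Q: "K (Suc n) Q" "\<And>xs. length xs = n \<Longrightarrow> P xs \<longleftrightarrow> (\<forall>y. Q (y # xs))"
    "K (Suc n) Q'" "\<And>xs. length xs = n \<Longrightarrow> P' xs \<longleftrightarrow> (\<forall>y. Q' (y # xs))"
    unfolding ALLc_def by auto
  have "K (Suc n) (\<lambda>ys. Q (p1 (hd ys) # tl ys) \<or> Q' (p2 (hd ys) # tl ys))"
    by (intro disj subst[OF Q(1)] subst[OF Q(3)] vec pr)
  then show "ALLc K n (\<lambda>xs. P xs \<or> P' xs)"
    by (rule ALLcI) (simp add: Q pair_all[symmetric, of "\<lambda>x y. Q (x # _) \<or> Q' (y # _)"])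
  show "ALLc K n (\<lambda>xs. P xs \<and> P' xs)"
    using conj[OF Q(1,3)] by (rule ALLcI) (auto simp add: Q)
next
  fix n P b assume "ALLc K (Suc n) P" and b: "primf {} n b"
  then obtain Q where Q: "K (Suc (Suc n)) Q" "\<And>xs. length xs = Suc n \<Longrightarrow> P xs \<longleftrightarrow> (\<forall>y. Q (y # xs))"
    unfolding ALLc_def by auto
  have "K (Suc n) (\<lambda>ys. \<forall>i<b (tl ys). Q (ys ! 0 # i # tl ys))"
    by (intro ball subst[OF Q(1)] vec pr primf_tl b) simp_all
  then show "ALLc K n (\<lambda>xs. \<forall>i<b xs. P (i # xs))"
    by (rule ALLcI) (auto simp add: Q)
qed

lemma (in good) ALLc_all: assumes "K (Suc n) (\<lambda>xs. P (xs ! 0) (tl xs))" shows "ALLc K n (\<lambda>xs. \<forall>y. P y xs)"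
  using assms by (rule ALLcI) simp

section \<open>Functions with graph in a given class\<close>

definition FG :: "(nat \<Rightarrow> (nat list \<Rightarrow> bool) \<Rightarrow> bool) \<Rightarrow> nat \<Rightarrow> (nat list \<Rightarrow> nat) \<Rightarrow> bool" where
  "FG K n f \<longleftrightarrow> K (Suc n) (\<lambda>ys. f (tl ys) = hd ys)"

locale mu_class = pr_class +
  assumes mu: "C (Suc n) f \<Longrightarrow> (\<And>xs. length xs = n \<Longrightarrow> \<exists>y. f (y # xs) = 0) \<Longrightarrow>
    C n (\<lambda>xs. LEAST y. f (y # xs) = 0)"
begin

lemma least: assumes "C (Suc n) (\<lambda>xs. of_bool (P (xs ! 0) (tl xs)))" "\<And>xs. length xs = n \<Longrightarrow> \<exists>y. P y xs"
  shows "C n (\<lambda>xs. LEAST y. P y xs)"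
  using mu[OF neg[OF assms(1)]] assms(2) by simp

end

locale good_ex = good +
  assumes ex: "K (Suc n) (\<lambda>xs. P (xs ! 0) (tl xs)) \<Longrightarrow> K n (\<lambda>xs. \<exists>y. P y xs)"
begin

lemma FG_subst: "FG K m f \<Longrightarrow> vec n m us \<Longrightarrow> primf {} n g \<Longrightarrow> K n (\<lambda>xs. f (us xs) = g xs)"
  unfolding FG_def using subst[of "Suc m" "\<lambda>ys. f (tl ys) = hd ys" n "\<lambda>xs. g xs # us xs"]
  by (simp add: vec_Cons)

lemma FG_primf: "primf {} n f \<Longrightarrow> FG K n f"
  unfolding FG_def by (intro base pr primf_tl)

text \<open>Intermediate values are guessed by an existential quantifier: composition asks for a
  coded list of the inner values, recursion for a coded sequence of all earlier values. The graph
  conditions then determine the guess as far as it is used.\<close>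

lemma mu_class_FG: "mu_class (FG K)"
proof
  show "FG K n f \<Longrightarrow> (\<And>xs. length xs = n \<Longrightarrow> f xs = g xs) \<Longrightarrow> FG K n g" for n f g
    unfolding FG_def by (erule cong) simp
  show "FG K n (\<lambda>xs. 0)" for n by (intro FG_primf pr)
  show "FG K 1 (\<lambda>xs. Suc (xs ! 0))" by (intro FG_primf pr) simp
  show "i < n \<Longrightarrow> FG K n (\<lambda>xs. xs ! i)" for i n by (intro FG_primf pr)
next
  fix hs f n assume f: "FG K (length hs) f" and hs: "\<forall>h\<in>set hs. FG K n h"
  have 1: "K (Suc (Suc n)) (\<lambda>ys. f (map (\<lambda>h. h ys) (map (\<lambda>i ys. cnth (ys ! 0) i) [0..<length hs])) = tl ys ! 0)"
    by (intro FG_subst[OF f] vec_map pr) (auto intro!: PR.cnth PR.const PR.proj)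
  have 2: "K (Suc (Suc n)) (\<lambda>ys. \<forall>P\<in>set (map (\<lambda>i ys. (hs ! i) (tl (tl ys)) = cnth (ys ! 0) i) [0..<length hs]). P ys)"
    using hs by (intro list_conj) (auto intro!: FG_subst[where m = n] vec PR.cnth PR.const PR.proj)
  have "K (Suc n) (\<lambda>ys. \<exists>c. (\<forall>P\<in>set (map (\<lambda>i ys. (hs ! i) (tl ys) = cnth c i) [0..<length hs]). P ys) \<and>
     f (map (\<lambda>i. cnth c i) [0..<length hs]) = ys ! 0)"
    by (rule ex, rule cong[OF conj[OF 2 1]]) (simp add: comp_def)
  then show "FG K n (\<lambda>xs. f (map (\<lambda>h. h xs) hs))"
    unfolding FG_def
  proof (rule cong)
    fix ys :: "nat list" assume ys: "length ys = Suc n"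
    obtain c where c: "\<forall>i<length hs. (hs ! i) (tl ys) = cnth c i"
      using list_code_exists[of "length hs" "\<lambda>y i. (hs ! i) (tl ys) = y"] by auto
    have m: "map (cnth c) [0..<length hs] = map (\<lambda>h. h (tl ys)) hs"
      if "\<forall>i<length hs. (hs ! i) (tl ys) = cnth c i" for c
      using that by (auto intro: nth_equalityI)
    have "(\<exists>c. (\<forall>P\<in>set (map (\<lambda>i ys. (hs ! i) (tl ys) = cnth c i) [0..<length hs]). P ys) \<and>
        f (map (\<lambda>i. cnth c i) [0..<length hs]) = ys ! 0) \<longleftrightarrow>
      (\<exists>c. (\<forall>i<length hs. (hs ! i) (tl ys) = cnth c i) \<and> f (map (cnth c) [0..<length hs]) = hd ys)"
      using ys by (auto simp: length_Suc_conv)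
    also have "\<dots> \<longleftrightarrow> f (map (\<lambda>h. h (tl ys)) hs) = hd ys"
    proof
      assume "\<exists>c. (\<forall>i<length hs. (hs ! i) (tl ys) = cnth c i) \<and> f (map (cnth c) [0..<length hs]) = hd ys"
      then obtain c where c: "\<forall>i<length hs. (hs ! i) (tl ys) = cnth c i"
        "f (map (cnth c) [0..<length hs]) = hd ys" by blast
      show "f (map (\<lambda>h. h (tl ys)) hs) = hd ys" using c(2) unfolding m[OF c(1)] .
    next
      assume "f (map (\<lambda>h. h (tl ys)) hs) = hd ys"
      then show "\<exists>c. (\<forall>i<length hs. (hs ! i) (tl ys) = cnth c i) \<and> f (map (cnth c) [0..<length hs]) = hd ys"
        using c by (intro exI[of _ c]) (simp add: m[OF c])
    qed
    finally show "(\<exists>c. (\<forall>P\<in>set (map (\<lambda>i ys. (hs ! i) (tl ys) = cnth c i) [0..<length hs]). P ys) \<and>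
     f (map (\<lambda>i. cnth c i) [0..<length hs]) = ys ! 0) \<longleftrightarrow> f (map (\<lambda>h. h (tl ys)) hs) = hd ys" .
  qed
next
  fix n f h assume f: "FG K n f" and h: "FG K (Suc (Suc n)) h"
  let ?r = "\<lambda>xs. rec_nat (f (tl xs)) (\<lambda>m r. h (m # r # tl xs)) (hd xs)"
  have "K (Suc (Suc n)) (\<lambda>ys. \<exists>c. (f (tl (tl ys)) = cnth c 0 \<and>
    (\<forall>i<ys ! Suc 0. h (i # cnth c i # tl (tl ys)) = cnth c (Suc i))) \<and> cnth c (ys ! Suc 0) = ys ! 0)"
    by (intro ex conj ball FG_subst[OF f] FG_subst[OF h] vec pr base) simp_all
  then show "FG K (Suc n) ?r"
    unfolding FG_def
  proof (rule cong)
    fix ys :: "nat list" assume "length ys = Suc (Suc n)"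
    then obtain y m xs where ys: "ys = y # m # xs" by (auto simp: length_Suc_conv)
    let ?v = "rec_nat (f xs) (\<lambda>m r. h (m # r # xs))"
    obtain c where c: "i \<le> m \<Longrightarrow> cnth c i = ?v i" for i
      using list_code_exists[of "Suc m" "\<lambda>y i. y = ?v i"] by (auto simp: less_Suc_eq_le)
    have *: "cnth c m = ?v m" if "f xs = cnth c 0" "\<forall>i<m. h (i # cnth c i # xs) = cnth c (Suc i)" for c
    proof -
      have "i \<le> m \<Longrightarrow> cnth c i = ?v i" for i
        by (induction i) (use that in \<open>auto simp flip: that(2)[rule_format]\<close>)
      then show ?thesis by simp
    qed
    have "?v m = y \<Longrightarrow> \<exists>c. (f xs = cnth c 0 \<and>
        (\<forall>i<m. h (i # cnth c i # xs) = cnth c (Suc i))) \<and> cnth c m = y"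
      by (rule exI[of _ c]) (simp add: c)
    with * show "(\<exists>c. (f (tl (tl ys)) = cnth c 0 \<and>
    (\<forall>i<ys ! Suc 0. h (i # cnth c i # tl (tl ys)) = cnth c (Suc i))) \<and> cnth c (ys ! Suc 0) = ys ! 0) \<longleftrightarrow>
      ?r (tl ys) = hd ys"
      by (auto simp: ys)
  qed
next
  fix n f assume f: "FG K (Suc n) f" and tot: "\<And>xs. length xs = n \<Longrightarrow> \<exists>y. f (y # xs) = 0"
  have "K (Suc n) (\<lambda>ys. f (ys ! 0 # tl ys) = 0 \<and> (\<forall>i<ys ! 0. \<exists>z. f (i # tl ys) = Suc z))"
    by (intro ex conj ball FG_subst[OF f] vec pr base) simp_all
  then show "FG K n (\<lambda>xs. LEAST y. f (y # xs) = 0)"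
    unfolding FG_def
  proof (rule cong)
    fix ys :: "nat list" assume "length ys = Suc n"
    then obtain y xs where ys: "ys = y # xs" "length xs = n" by (auto simp: length_Suc_conv)
    have "(LEAST y. f (y # xs) = 0) = y \<longleftrightarrow> f (y # xs) = 0 \<and> (\<forall>i<y. f (i # xs) \<noteq> 0)"
    proof
      assume "(LEAST y. f (y # xs) = 0) = y"
      then show "f (y # xs) = 0 \<and> (\<forall>i<y. f (i # xs) \<noteq> 0)"
        using LeastI_ex[OF tot[OF ys(2)]] not_less_Least[of _ "\<lambda>y. f (y # xs) = 0"] by blast
    next
      assume "f (y # xs) = 0 \<and> (\<forall>i<y. f (i # xs) \<noteq> 0)"
      then show "(LEAST y. f (y # xs) = 0) = y"
        by (intro Least_equality) (auto simp flip: not_less)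
    qed
    moreover have "(\<exists>z. f (i # xs) = Suc z) \<longleftrightarrow> f (i # xs) \<noteq> 0" for i
      by (cases "f (i # xs)") auto
    ultimately show "(f (ys ! 0 # tl ys) = 0 \<and> (\<forall>i<ys ! 0. \<exists>z. f (i # tl ys) = Suc z)) \<longleftrightarrow>
       (LEAST y. f (y # tl ys) = 0) = hd ys"
      by (simp add: ys)
  qed
qed

end

section \<open>The classes \<open>S3\<close> and \<open>D3\<close> and the arithmetical
  hierarchy\<close>

lemma (in good) good_ex_EXc: "good_ex (EXc K)"
  by (intro good_ex.intro good_EXc good_ex_axioms.intro EXc_ex)

interpretation PRp: good PRp by (rule good_PRp)
interpretation E: good_ex "EXc PRp" by (rule PRp.good_ex_EXc)
interpretation AE: good "ALLc (EXc PRp)" by (rule E.good_ALLc)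

definition S3 :: "nat \<Rightarrow> (nat list \<Rightarrow> bool) \<Rightarrow> bool" where "S3 = EXc (ALLc (EXc PRp))"
definition D3 :: "nat \<Rightarrow> (nat list \<Rightarrow> nat) \<Rightarrow> bool" where "D3 = FG S3"

interpretation S3: good_ex S3 unfolding S3_def by (rule AE.good_ex_EXc)
interpretation D3: mu_class D3 unfolding D3_def by (rule S3.mu_class_FG)
interpretation FE: mu_class "FG (EXc PRp)" by (rule E.mu_class_FG)

text \<open>The normal form theorem in graph form. Functions with
  \<open>\<Sigma>\<^sup>0\<^sub>1\<close> graph are closed under all generating rules, minimization
  included, so induction suffices.\<close>

lemma computable_fun_FG: "computable_fun n f \<Longrightarrow> FG (EXc PRp) n f"
  by (induction rule: computable_fun.induct)
    (auto intro: FE.zero FE.proj FE.comp FE.prec FE.mu FE.succ[unfolded One_nat_def])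

lemma computable_pred_E: assumes "computable_pred n P" shows "EXc PRp n P" "EXc PRp n (\<lambda>xs. \<not> P xs)"
proof -
  from assms obtain f where f: "computable_fun n f" "\<And>xs. length xs = n \<Longrightarrow> f xs = (if P xs then 1 else 0)"
    unfolding computable_pred_def by blast
  have 1: "EXc PRp n (\<lambda>xs. f xs = 1)" "EXc PRp n (\<lambda>xs. f xs = 0)"
    by (intro E.FG_subst[OF computable_fun_FG[OF f(1)]] vec pr)+
  show "EXc PRp n P" "EXc PRp n (\<lambda>xs. \<not> P xs)"
    by (rule E.cong[OF 1(1)], simp add: f(2)) (rule E.cong[OF 1(2)], simp add: f(2))
qed

lemma computable_predI: assumes "PRp n P" shows "computable_pred n P"
proof -
  interpret pr_class "ext_closure computable_fun" by (rule pr_class_computable)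
  have "ext_closure computable_fun n (\<lambda>xs. of_bool (P xs))" using assms primf_empty PRp_def by blast
  then show ?thesis unfolding computable_pred_def ext_closure_def of_bool_def by metis
qed

text \<open>The negations in \<open>Sigma0\<close> yield the prefix exists-forall-exists over a
  negated computable predicate. The latter is itself \<open>\<Sigma>\<^sup>0\<^sub>1\<close> with
  primitive recursive matrix, and its quantifier merges with the innermost one.\<close>

lemma Sigma0_3_iff: "Sigma0 3 n P \<longleftrightarrow> S3 n P"
proof
  assume "Sigma0 3 n P"
  then obtain Q2 Q1 Q0 where Q: "\<And>xs. length xs = n \<Longrightarrow> P xs \<longleftrightarrow> (\<exists>y. \<not> Q2 (y # xs))"
    "\<And>xs. length xs = Suc n \<Longrightarrow> Q2 xs \<longleftrightarrow> (\<exists>y. \<not> Q1 (y # xs))"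
    "\<And>xs. length xs = Suc (Suc n) \<Longrightarrow> Q1 xs \<longleftrightarrow> (\<exists>y. \<not> Q0 (y # xs))"
    "computable_pred (Suc (Suc (Suc n))) Q0"
    by (auto simp: numeral_3_eq_3)
  have "EXc PRp (Suc (Suc n)) (\<lambda>ys. \<exists>w. \<not> Q0 (w # ys))"
    by (intro E.ex E.subst[OF computable_pred_E(2)[OF Q(4)]] vec pr) simp
  then have "EXc PRp (Suc (Suc n)) (\<lambda>ys. \<exists>w. \<not> Q0 (w # ys ! 0 # tl ys))"
    by (rule E.cong) (auto simp: length_Suc_conv)
  then have "ALLc (EXc PRp) (Suc n) (\<lambda>ys. \<forall>v. \<exists>w. \<not> Q0 (w # v # ys))"
    by (rule E.ALLc_all)
  then show "S3 n P"
    unfolding S3_def by (rule EXcI) (simp add: Q)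
next
  assume "S3 n P"
  then obtain Q1 Q2 T where Q: "\<And>xs. length xs = n \<Longrightarrow> P xs \<longleftrightarrow> (\<exists>y. Q1 (y # xs))"
    "\<And>xs. length xs = Suc n \<Longrightarrow> Q1 xs \<longleftrightarrow> (\<forall>y. Q2 (y # xs))"
    "\<And>xs. length xs = Suc (Suc n) \<Longrightarrow> Q2 xs \<longleftrightarrow> (\<exists>y. T (y # xs))"
    "PRp (Suc (Suc (Suc n))) T"
    unfolding S3_def EXc_def ALLc_def by metis
  have "Sigma0 0 (Suc (Suc (Suc n))) (\<lambda>xs. \<not> T xs)"
    using Q(4) by (auto intro!: computable_predI pr simp: PRp_def)
  then have "Sigma0 (Suc 0) (Suc (Suc n)) Q2"
    using Q(3) unfolding Sigma0.simps(2)[of 0] by (intro exI[of _ "\<lambda>xs. \<not> T xs"]) simp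
  then have "Sigma0 (Suc (Suc 0)) (Suc n) (\<lambda>xs. \<not> Q1 xs)"
    using Q(2) unfolding Sigma0.simps(2)[of "Suc 0"] by (intro exI[of _ Q2]) simp
  then show "Sigma0 3 n P"
    using Q(1) unfolding numeral_3_eq_3 Sigma0.simps(2)[of "Suc (Suc 0)"] by (intro exI[of _ "\<lambda>xs. \<not> Q1 xs"]) simp
qed

text \<open>For a total function a \<open>\<Sigma>\<^sup>0\<^sub>3\<close> graph is enough:
  \<open>f x\<close> differs from \<open>y\<close> iff some number other than \<open>y\<close> is
  the value, which is \<open>\<Sigma>\<^sup>0\<^sub>3\<close> again.\<close>

lemma Delta0_fun_iff: "Delta0_fun 3 f \<longleftrightarrow> D3 1 (\<lambda>xs. f (xs ! 0))"
proof
  assume "Delta0_fun 3 f"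
  then have 1: "S3 2 (\<lambda>xs. f (xs ! 0) = xs ! 1)"
    unfolding Delta0_fun_def Delta0_def Sigma0_3_iff by blast
  have "S3 2 (\<lambda>xs. f (xs ! 1) = xs ! 0)"
    by (rule S3.lift2[where F = "\<lambda>x y. f x = y", OF 1]) (intro pr; simp)+
  then show "D3 1 (\<lambda>xs. f (xs ! 0))"
    unfolding D3_def FG_def One_nat_def numeral_2_eq_2 by (rule S3.cong) (auto simp: length_Suc_conv)
next
  assume D: "D3 1 (\<lambda>xs. f (xs ! 0))"
  then have 0: "S3 2 (\<lambda>xs. f (xs ! 1) = xs ! 0)"
    unfolding D3_def FG_def One_nat_def numeral_2_eq_2 by (rule S3.cong) (auto simp: length_Suc_conv)
  have 1: "S3 2 (\<lambda>xs. f (xs ! 0) = xs ! 1)"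
    by (rule S3.lift2[where F = "\<lambda>x y. f y = x", OF 0]) (intro pr; simp)+
  have "S3 (Suc 2) (\<lambda>xs. f (tl xs ! 0) = xs ! 0 \<and> xs ! 0 \<noteq> tl xs ! 1)"
    by (rule S3.conj, rule S3.lift2[where F = "\<lambda>x y. f y = x", OF 0]) (intro pr S3.base; simp)+
  from S3.ex[OF this] have 2: "S3 2 (\<lambda>xs. f (xs ! 0) \<noteq> xs ! 1)" by simp
  show "Delta0_fun 3 f"
    unfolding Delta0_fun_def Delta0_def Pi0_def Sigma0_3_iff
    using 1 2 by simp
qed

lemma D3_of_bool: assumes "S3 n P" "S3 n (\<lambda>xs. \<not> P xs)" shows "D3 n (\<lambda>xs. of_bool (P xs))"
proof -
  have "S3 (Suc n) (\<lambda>ys. (ys ! 0 = 1 \<and> P (tl ys)) \<or> (ys ! 0 = 0 \<and> \<not> P (tl ys)))"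
    by (intro S3.disj S3.conj S3.base pr S3.subst[OF assms(1)] S3.subst[OF assms(2)] vec) simp_all
  then show ?thesis
    unfolding D3_def FG_def by (rule S3.cong) (auto simp: length_Suc_conv)
qed

lemma E_S3: "EXc PRp n P \<Longrightarrow> S3 n P"
  unfolding S3_def
  by (rule EXcI[where Q = "\<lambda>ys. P (tl ys)"], rule ALLcI[where Q = "\<lambda>ys. P (tl (tl ys))"])
    (auto intro: E.subst vec)

lemma AE_S3: "ALLc (EXc PRp) n P \<Longrightarrow> S3 n P"
  unfolding S3_def
  by (rule EXcI[where Q = "\<lambda>ys. P (tl ys)"]) (auto intro: AE.subst vec)

section \<open>Effective back-and-forth\<close>

text \<open>\<open>\<rho>\<close> and \<open>\<sigma>\<close> code the type of a pair of points, so
  agreement on all pairs makes a finite set a partial isomorphism. That it is single-valued and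
  injective comes from the hypothesis \<open>sep\<close> of the next lemma.\<close>

definition compat :: "(nat \<Rightarrow> nat \<Rightarrow> nat) \<Rightarrow> (nat \<Rightarrow> nat \<Rightarrow> nat) \<Rightarrow> (nat \<times> nat) set \<Rightarrow> bool" where
  "compat \<rho> \<sigma> S \<longleftrightarrow> (\<forall>p\<in>S. \<forall>q\<in>S. \<rho> (fst p) (fst q) = \<sigma> (snd p) (snd q))"

definition pairs :: "nat \<Rightarrow> (nat \<times> nat) set" where
  "pairs c = prod_decode ` set (list_decode c)"

definition add_pair :: "nat \<Rightarrow> nat \<Rightarrow> nat \<Rightarrow> nat" where
  "add_pair x y c = Suc (prod_encode (prod_encode (x, y), c))"

lemma pairs_0 [simp]: "pairs 0 = {}"
  by (simp add: pairs_def)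

lemma pairs_add_pair [simp]: "pairs (add_pair x y c) = insert (x, y) (pairs c)"
  by (simp add: pairs_def add_pair_def)

lemma finite_pairs [simp]: "finite (pairs c)"
  by (simp add: pairs_def)

lemma compat_pairs: "compat \<rho> \<sigma> (pairs c) \<longleftrightarrow> (\<forall>i<clen c. \<forall>j<clen c.
    \<rho> (p1 (cnth c i)) (p1 (cnth c j)) = \<sigma> (p2 (cnth c i)) (p2 (cnth c j)))"
proof -
  define l where "l = list_decode c"
  have "c = list_encode l" by (simp add: l_def)
  then show ?thesis
    by (simp add: compat_def pairs_def p1_def p2_def all_set_conv_all_nth)
qed

text \<open>Finite partial maps are coded by numbers and extended by unbounded search. Stage
  \<open>n\<close> gives \<open>n\<close> first an image and then a preimage, so \<open>f n\<close>
  and \<open>g n\<close> can be read off there; \<open>sep\<close> makes them inverse to each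
  other.\<close>

lemma (in mu_class) back_and_forth:
  assumes C: "C 2 (\<lambda>xs. \<rho> (xs ! 0) (xs ! 1))" "C 2 (\<lambda>xs. \<sigma> (xs ! 0) (xs ! 1))"
    and forth: "\<And>S x. finite S \<Longrightarrow> compat \<rho> \<sigma> S \<Longrightarrow> \<exists>y. compat \<rho> \<sigma> (insert (x, y) S)"
    and bck: "\<And>S y. finite S \<Longrightarrow> compat \<rho> \<sigma> S \<Longrightarrow> \<exists>x. compat \<rho> \<sigma> (insert (x, y) S)"
    and sep: "\<And>x y y'. \<rho> x x = \<sigma> y y' \<Longrightarrow> \<rho> x x = \<sigma> y' y \<Longrightarrow> y = y'"
      "\<And>x x' y. \<rho> x x' = \<sigma> y y \<Longrightarrow> \<rho> x' x = \<sigma> y y \<Longrightarrow> x = x'"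
  obtains f g where "C 1 (\<lambda>xs. f (xs ! 0))" "C 1 (\<lambda>xs. g (xs ! 0))"
    "\<And>x. g (f x) = x" "\<And>y. f (g y) = y" "\<And>x x'. \<rho> x x' = \<sigma> (f x) (f x')"
proof -
  let ?c = "\<lambda>c. compat \<rho> \<sigma> (pairs c)"
  \<comment> \<open>Minimization requires totality. The premise \<open>?c c\<close> makes the search
    succeed even if \<open>c\<close> codes an incompatible set.\<close>
  define fo where "fo c x = (LEAST y. ?c c \<longrightarrow> ?c (add_pair x y c))" for c x
  define ba where "ba c y = (LEAST x. ?c c \<longrightarrow> ?c (add_pair x y c))" for c y
  have fo: "?c (add_pair x (fo c x) c)" if "?c c" for c x
    using LeastI_ex[of "\<lambda>y. ?c c \<longrightarrow> ?c (add_pair x y c)"] forth[OF finite_pairs that] that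
    unfolding fo_def by simp
  have ba: "?c (add_pair (ba c y) y c)" if "?c c" for c y
    using LeastI_ex[of "\<lambda>x. ?c c \<longrightarrow> ?c (add_pair x y c)"] bck[OF finite_pairs that] that
    unfolding ba_def by simp
  define half where "half c n = add_pair n (fo c n) c" for c n
  define st where "st = rec_nat 0 (\<lambda>n c. add_pair (ba (half c n) n) n (half c n))"
  define f where "f n = fo (st n) n" for n
  define g where "g n = ba (half (st n) n) n" for n
  have st_Suc: "pairs (st (Suc n)) = {(g n, n), (n, f n)} \<union> pairs (st n)" for n
    by (simp add: st_def half_def f_def g_def)
  have st: "?c (st n)" for n
  proof (induction n)
    case (Suc n)
    then have "?c (half (st n) n)" unfolding half_def by (rule fo)
    then show ?case by (simp add: st_def ba del: pairs_add_pair)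
  qed (simp add: st_def compat_def)
  have mono: "m \<le> n \<Longrightarrow> pairs (st m) \<subseteq> pairs (st n)" for m n
    by (rule lift_Suc_mono_le[of "\<lambda>n. pairs (st n)"]) (auto simp: st_Suc)
  have comm: "\<rho> (fst p) (fst q) = \<sigma> (snd p) (snd q)"
    if "p \<in> {(g m, m), (m, f m)}" "q \<in> {(g n, n), (n, f n)}" for p q m n
  proof -
    have "p \<in> pairs (st (Suc m))" "q \<in> pairs (st (Suc n))" using that st_Suc by auto
    then have "p \<in> pairs (st (Suc (max m n)))" "q \<in> pairs (st (Suc (max m n)))"
      using mono[of "Suc m" "Suc (max m n)"] mono[of "Suc n" "Suc (max m n)"] by auto
    then show ?thesis using st unfolding compat_def by blast
  qed
  have gf: "g (f n) = n" for n
    using comm[of "(g (f n), f n)" "f n" "(n, f n)" n] comm[of "(n, f n)" n "(g (f n), f n)" "f n"]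
    by (auto intro: sep)
  have fg: "f (g n) = n" for n
    using comm[of "(g n, f (g n))" "g n" "(g n, n)" n] comm[of "(g n, n)" n "(g n, f (g n))" "g n"]
    by (auto intro: sep)
  have ff: "\<rho> m n = \<sigma> (f m) (f n)" for m n
    using comm[of "(m, f m)" m "(n, f n)" n] by auto
  have add_pair: "C n a \<Longrightarrow> C n b \<Longrightarrow> C n c \<Longrightarrow> C n (\<lambda>xs. add_pair (a xs) (b xs) (c xs))" for n a b c
    unfolding add_pair_def by (intro pr)
  have cc: "C 1 (\<lambda>xs. of_bool (?c (xs ! 0)))"
    unfolding compat_pairs by (intro pr lift2[OF C(1)] lift2[OF C(2)]; simp)
  have cc: "C n c \<Longrightarrow> C n (\<lambda>xs. of_bool (?c (c xs)))" for n c
    by (rule lift1[OF cc])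
  have fo': "C 2 (\<lambda>xs. fo (xs ! 0) (xs ! 1))"
    unfolding fo_def
    by (intro least pr cc add_pair; simp?) (use forth[OF finite_pairs] in auto)
  have ba': "C 2 (\<lambda>xs. ba (xs ! 0) (xs ! 1))"
    unfolding ba_def
    by (intro least pr cc add_pair; simp?) (use bck[OF finite_pairs] in auto)
  have half: "C n c \<Longrightarrow> C n x \<Longrightarrow> C n (\<lambda>xs. half (c xs) (x xs))" for n c x
    unfolding half_def by (intro add_pair lift2[OF fo'])
  have st': "C n x \<Longrightarrow> C n (\<lambda>xs. st (x xs))" for n x
    unfolding st_def by (intro rec pr add_pair half lift2[OF ba']) simp_all
  have "C 1 (\<lambda>xs. f (xs ! 0))" "C 1 (\<lambda>xs. g (xs ! 0))"
    unfolding f_def g_def by (intro lift2[OF fo'] lift2[OF ba'] st' half pr; simp)+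
  then show thesis using gf fg ff that by blast
qed

section \<open>Shuffles of finite orders\<close>

text \<open>\<open>\<pi>\<close> maps each point to (a name of) its block; \<open>S\<close> is the set of block sizes.\<close>

definition block :: "'a rel \<Rightarrow> ('a \<Rightarrow> 'b) \<Rightarrow> 'a \<Rightarrow> 'a set" where
  "block r \<pi> x = {y \<in> Field r. \<pi> y = \<pi> x}"

text \<open>An intrinsic description by sizes alone: finite convex blocks, those of each size in
  \<open>S\<close> being dense between distinct blocks and unbounded in both directions. Sizes
  suffice because finite linear orders of equal size are isomorphic.\<close>

definition shuffle_map :: "nat set \<Rightarrow> 'a rel \<Rightarrow> ('a \<Rightarrow> 'b) \<Rightarrow> bool" where
  "shuffle_map S r \<pi> \<longleftrightarrow> Linear_order r \<and> Field r \<noteq> {} \<and>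
    (\<forall>x\<in>Field r. finite (block r \<pi> x) \<and> card (block r \<pi> x) \<in> S) \<and>
    (\<forall>x y z. (x, y) \<in> r \<and> (y, z) \<in> r \<and> \<pi> x = \<pi> z \<longrightarrow> \<pi> y = \<pi> x) \<and>
    (\<forall>x y. \<forall>c\<in>S. (x, y) \<in> r \<and> \<pi> x \<noteq> \<pi> y \<longrightarrow>
      (\<exists>z. (x, z) \<in> r \<and> (z, y) \<in> r \<and> \<pi> z \<noteq> \<pi> x \<and> \<pi> z \<noteq> \<pi> y \<and> card (block r \<pi> z) = c)) \<and>
    (\<forall>x\<in>Field r. \<forall>c\<in>S. \<exists>z. (x, z) \<in> r \<and> \<pi> z \<noteq> \<pi> x \<and> card (block r \<pi> z) = c) \<and>
    (\<forall>x\<in>Field r. \<forall>c\<in>S. \<exists>z. (z, x) \<in> r \<and> \<pi> z \<noteq> \<pi> x \<and> card (block r \<pi> z) = c)"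

lemma block_converse [simp]: "block (r\<inverse>) \<pi> = block r \<pi>"
  unfolding block_def by (simp add: fun_eq_iff)

lemma shuffle_mapD:
  assumes "shuffle_map S r \<pi>"
  shows "Linear_order r" "Field r \<noteq> {}"
    "\<And>x. x \<in> Field r \<Longrightarrow> finite (block r \<pi> x)"
    "\<And>x. x \<in> Field r \<Longrightarrow> card (block r \<pi> x) \<in> S"
    "\<And>x y z. (x, y) \<in> r \<Longrightarrow> (y, z) \<in> r \<Longrightarrow> \<pi> x = \<pi> z \<Longrightarrow> \<pi> y = \<pi> x"
    "\<And>x y c. c \<in> S \<Longrightarrow> (x, y) \<in> r \<Longrightarrow> \<pi> x \<noteq> \<pi> y \<Longrightarrow>
      \<exists>z. (x, z) \<in> r \<and> (z, y) \<in> r \<and> \<pi> z \<noteq> \<pi> x \<and> \<pi> z \<noteq> \<pi> y \<and> card (block r \<pi> z) = c"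
    "\<And>x c. x \<in> Field r \<Longrightarrow> c \<in> S \<Longrightarrow> \<exists>z. (x, z) \<in> r \<and> \<pi> z \<noteq> \<pi> x \<and> card (block r \<pi> z) = c"
    "\<And>x c. x \<in> Field r \<Longrightarrow> c \<in> S \<Longrightarrow> \<exists>z. (z, x) \<in> r \<and> \<pi> z \<noteq> \<pi> x \<and> card (block r \<pi> z) = c"
  using assms unfolding shuffle_map_def by blast+

lemma shuffle_map_converse: "shuffle_map S r \<pi> \<Longrightarrow> shuffle_map S (r\<inverse>) \<pi>"
proof -
  assume "shuffle_map S r \<pi>"
  note S = shuffle_mapD[OF this]
  show ?thesis
    unfolding shuffle_map_def block_converse Field_converse converse_iff
    apply (intro conjI)
    subgoal using S(1) by simp
    subgoal by (rule S(2))
    subgoal using S(3,4) by simp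
    subgoal using S(5) by metis
    subgoal using S(6) by metis
    subgoal by (intro ballI) (rule S(8))
    subgoal by (intro ballI) (rule S(7))
    done
qed

lemma iso_Linear_order:
  assumes f: "iso r s f" and s: "Linear_order s"
  shows "Linear_order r"
proof -
  have bij: "bij_betw f (Field r) (Field s)" and
    le: "\<And>a b. a \<in> Field r \<Longrightarrow> b \<in> Field r \<Longrightarrow> (a, b) \<in> r \<longleftrightarrow> (f a, f b) \<in> s"
    using f unfolding iso_iff2 by auto
  have F: "x \<in> Field r \<Longrightarrow> f x \<in> Field s" for x using bij bij_betwE by blast
  have inj: "x \<in> Field r \<Longrightarrow> y \<in> Field r \<Longrightarrow> f x = f y \<Longrightarrow> x = y" for x y
    using bij by (auto simp: bij_betw_def inj_on_def)
  have fld: "(a, b) \<in> r \<Longrightarrow> a \<in> Field r \<and> b \<in> Field r" for a b by (auto simp: Field_def)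
  have S: "refl_on (Field s) s" "trans s" "antisym s" "total_on (Field s) s"
    using s unfolding order_on_defs by auto
  show ?thesis
    unfolding order_on_defs
  proof (intro conjI)
    show "r \<subseteq> Field r \<times> Field r" using fld by auto
    show "refl_on (Field r) r" using S(1) F le unfolding refl_on_def by blast
    show "trans r"
    proof (rule transI)
      fix x y z assume h: "(x, y) \<in> r" "(y, z) \<in> r"
      then have "(f x, f z) \<in> s" using le fld S(2) by (meson transD)
      then show "(x, z) \<in> r" using le fld h by blast
    qed
    show "antisym r"
    proof (rule antisymI)
      fix x y assume h: "(x, y) \<in> r" "(y, x) \<in> r"
      then have "f x = f y" using le fld S(3) by (meson antisymD)
      then show "x = y" using inj fld h by blast
    qed
    show "total_on (Field r) r"
      using S(4) F inj le unfolding total_on_def by metis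
  qed
qed

lemma finite_Linear_order_max:
  assumes "Linear_order r" "finite A" "A \<noteq> {}" "A \<subseteq> Field r"
  shows "\<exists>m\<in>A. \<forall>z\<in>A. (z, m) \<in> r"
proof -
  have r: "refl_on (Field r) r" "trans r" "total_on (Field r) r"
    using assms(1) unfolding order_on_defs by auto
  show ?thesis
    using assms(2-)
  proof (induction rule: finite_ne_induct)
    case (singleton x)
    then show ?case using r(1) by (auto simp: refl_on_def)
  next
    case (insert x A)
    then obtain m where m: "m \<in> A" "\<forall>z\<in>A. (z, m) \<in> r" by auto
    have f: "x \<in> Field r" "m \<in> Field r" using insert m by auto
    then have x: "(x, x) \<in> r" using r(1) by (auto simp: refl_on_def)
    have "(x, m) \<in> r \<or> (m, x) \<in> r" using r(3) f x unfolding total_on_def by metis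
    then show ?case
    proof
      assume "(m, x) \<in> r"
      then have "\<forall>z\<in>insert x A. (z, x) \<in> r" using m x r(2) by (auto dest: transD)
      then show ?thesis by blast
    qed (use m in auto)
  qed
qed

lemma shuffle_map_iso:
  assumes s: "shuffle_map S s \<pi>" and f: "iso r s f"
  shows "shuffle_map S r (\<lambda>x. \<pi> (f x))"
proof -
  have bij: "bij_betw f (Field r) (Field s)" and
    le: "\<And>a b. a \<in> Field r \<Longrightarrow> b \<in> Field r \<Longrightarrow> (a, b) \<in> r \<longleftrightarrow> (f a, f b) \<in> s"
    using f unfolding iso_iff2 by auto
  have fld: "(a, b) \<in> r \<Longrightarrow> a \<in> Field r \<and> b \<in> Field r" for a b by (auto simp: Field_def)
  have fld': "(a, b) \<in> s \<Longrightarrow> a \<in> Field s \<and> b \<in> Field s" for a b by (auto simp: Field_def)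
  have fF: "x \<in> Field r \<Longrightarrow> f x \<in> Field s" for x using bij bij_betwE by blast
  have pre: "y \<in> Field s \<Longrightarrow> \<exists>x\<in>Field r. y = f x" for y using bij by (auto simp: bij_betw_def)
  have blk: "bij_betw f (block r (\<lambda>x. \<pi> (f x)) x) (block s \<pi> (f x))" if "x \<in> Field r" for x
    using bij unfolding block_def bij_betw_def inj_on_def by auto
  note card = bij_betw_same_card[OF blk] bij_betw_finite[OF blk]
  have le': "(a, b) \<in> r \<longleftrightarrow> a \<in> Field r \<and> b \<in> Field r \<and> (f a, f b) \<in> s" for a b
    using le fld by blast
  note S = shuffle_mapD[OF s]
  have 1: "\<exists>z. (x, z) \<in> r \<and> (z, y) \<in> r \<and> \<pi> (f z) \<noteq> \<pi> (f x) \<and> \<pi> (f z) \<noteq> \<pi> (f y) \<and> card (block r (\<lambda>x. \<pi> (f x)) z) = c"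
    if h: "c \<in> S" "(x, y) \<in> r" "\<pi> (f x) \<noteq> \<pi> (f y)" for x y c
  proof -
    have xy: "x \<in> Field r" "y \<in> Field r" "(f x, f y) \<in> s" using h(2) le' by blast+
    then obtain z' where z': "(f x, z') \<in> s" "(z', f y) \<in> s" "\<pi> z' \<noteq> \<pi> (f x)" "\<pi> z' \<noteq> \<pi> (f y)"
      "card (block s \<pi> z') = c" using S(6)[OF h(1) xy(3) h(3)] by blast
    then obtain z where "z \<in> Field r" "z' = f z" using pre fld' by metis
    then show ?thesis using z' h(2) by (intro exI[of _ z]) (simp add: le' xy card(1))
  qed
  have 2: "\<exists>z. (x, z) \<in> r \<and> \<pi> (f z) \<noteq> \<pi> (f x) \<and> card (block r (\<lambda>x. \<pi> (f x)) z) = c"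
    if h: "c \<in> S" "x \<in> Field r" for x c
  proof -
    obtain z' where z': "(f x, z') \<in> s" "\<pi> z' \<noteq> \<pi> (f x)"
      "card (block s \<pi> z') = c" using S(7)[OF fF[OF h(2)] h(1)] by blast
    then obtain z where "z \<in> Field r" "z' = f z" using pre fld' by metis
    then show ?thesis using z' h(2) by (intro exI[of _ z]) (simp add: le' card(1))
  qed
  have 3: "\<exists>z. (z, x) \<in> r \<and> \<pi> (f z) \<noteq> \<pi> (f x) \<and> card (block r (\<lambda>x. \<pi> (f x)) z) = c"
    if h: "c \<in> S" "x \<in> Field r" for x c
  proof -
    obtain z' where z': "(z', f x) \<in> s" "\<pi> z' \<noteq> \<pi> (f x)"
      "card (block s \<pi> z') = c" using S(8)[OF fF[OF h(2)] h(1)] by blast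
    then obtain z where "z \<in> Field r" "z' = f z" using pre fld' by metis
    then show ?thesis using z' h(2) by (intro exI[of _ z]) (simp add: le' card(1))
  qed
  have 4: "Field r \<noteq> {}" using S(2) pre by blast
  have 5: "finite (block r (\<lambda>x. \<pi> (f x)) x) \<and> card (block r (\<lambda>x. \<pi> (f x)) x) \<in> S" if "x \<in> Field r" for x
    using card[OF that] S(3,4)[OF fF[OF that]] by simp
  have 6: "\<pi> (f y) = \<pi> (f x)" if "(x, y) \<in> r" "(y, z) \<in> r" "\<pi> (f x) = \<pi> (f z)" for x y z
  proof (rule S(5))
    show "(f x, f y) \<in> s" "(f y, f z) \<in> s" using that(1,2) le'[of x y] le'[of y z] by simp_all
    show "\<pi> (f x) = \<pi> (f z)" by (rule that(3))
  qed
  show ?thesis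
    unfolding shuffle_map_def
    apply (intro conjI)
    subgoal by (rule iso_Linear_order[OF f S(1)])
    subgoal by (rule 4)
    subgoal by (intro ballI 5)
    subgoal by (intro allI impI, elim conjE) (rule 6)
    subgoal by (intro allI ballI impI, elim conjE) (rule 1)
    subgoal by (intro ballI) (rule 2)
    subgoal by (intro ballI) (rule 3)
    done
qed

section \<open>Blocks recovered from the order\<close>

definition isuc :: "'a rel \<Rightarrow> 'a \<Rightarrow> 'a \<Rightarrow> bool" where
  "isuc r x y \<longleftrightarrow> (x, y) \<in> r \<and> x \<noteq> y \<and> (\<forall>z. (x, z) \<in> r \<longrightarrow> z = x \<or> (y, z) \<in> r)"

definition nosuc :: "'a rel \<Rightarrow> 'a \<Rightarrow> bool" where
  "nosuc r x \<longleftrightarrow> (\<forall>y. \<not> isuc r x y)"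

text \<open>At the last point of a block the step stands still, so iteration never leaves the block.
  The disjunct inside the minimization keeps the latter total.\<close>

definition nxt :: "nat rel \<Rightarrow> nat \<Rightarrow> nat" where
  "nxt r x = (if nosuc r x then x else LEAST y. nosuc r x \<or> isuc r x y)"

definition nright :: "nat rel \<Rightarrow> nat \<Rightarrow> nat" where
  "nright r x = (LEAST n. nosuc r ((nxt r ^^ n) x))"

definition lend :: "nat rel \<Rightarrow> nat \<Rightarrow> nat" where
  "lend r x = (nxt (r\<inverse>) ^^ nright (r\<inverse>) x) x"

text \<open>Counts are stored for \<open>x\<close> only, since compatibility ranges over all ordered
  pairs. The block is named by its first point \<open>lend\<close> and not by \<open>\<pi>\<close>,
  which need not be effective.\<close>

definition rho :: "nat rel \<Rightarrow> nat \<Rightarrow> nat \<Rightarrow> nat" where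
  "rho r x x' = prod_encode (of_bool ((x, x') \<in> r), prod_encode (of_bool (lend r x = lend r x'),
     prod_encode (nright (r\<inverse>) x, nright r x)))"

lemma rho_eq_iff: "rho r x x' = rho s y y' \<longleftrightarrow> ((x, x') \<in> r \<longleftrightarrow> (y, y') \<in> s) \<and>
    (lend r x = lend r x' \<longleftrightarrow> lend s y = lend s y') \<and>
    nright (r\<inverse>) x = nright (s\<inverse>) y \<and> nright r x = nright s y"
  unfolding rho_def by (auto simp: prod_encode_eq of_bool_eq_iff)

locale shuf =
  fixes S :: "nat set" and r :: "nat rel" and \<pi> :: "nat \<Rightarrow> 'b"
  assumes sm: "shuffle_map S r \<pi>" and UNIV: "Field r = UNIV"
begin

lemma conv: "shuf S (r\<inverse>) \<pi>"
  using sm UNIV by unfold_locales (auto intro: shuffle_map_converse)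

lemma le_refl: "(x, x) \<in> r"
  and le_trans: "(x, y) \<in> r \<Longrightarrow> (y, z) \<in> r \<Longrightarrow> (x, z) \<in> r"
  and le_antisym: "(x, y) \<in> r \<Longrightarrow> (y, x) \<in> r \<Longrightarrow> x = y"
  and le_total: "(x, y) \<in> r \<or> (y, x) \<in> r"
  using shuffle_mapD(1)[OF sm] UNIV le_refl
  unfolding order_on_defs refl_on_def trans_def antisym_def total_on_def by (blast, blast, blast, metis UNIV_I)

lemma finite_max: "finite A \<Longrightarrow> A \<noteq> {} \<Longrightarrow> \<exists>m\<in>A. \<forall>z\<in>A. (z, m) \<in> r"
  using finite_Linear_order_max[OF shuffle_mapD(1)[OF sm]] UNIV by simp

lemma fin_block [simp]: "finite (block r \<pi> x)"
  using shuffle_mapD(3)[OF sm] UNIV by simp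

lemma card_block: "card (block r \<pi> x) \<in> S"
  using shuffle_mapD(4)[OF sm] UNIV by simp

lemma convex: "(x, y) \<in> r \<Longrightarrow> (y, z) \<in> r \<Longrightarrow> \<pi> x = \<pi> z \<Longrightarrow> \<pi> y = \<pi> x"
  by (rule shuffle_mapD(5)[OF sm])

lemma mem_block: "y \<in> block r \<pi> x \<longleftrightarrow> \<pi> y = \<pi> x"
  unfolding block_def using UNIV by simp

lemma block_cong: "\<pi> x = \<pi> y \<Longrightarrow> block r \<pi> x = block r \<pi> y"
  unfolding block_def by simp

lemma le_cong: assumes "\<pi> x = \<pi> y" "\<pi> x \<noteq> \<pi> z" shows "(x, z) \<in> r \<longleftrightarrow> (y, z) \<in> r" "(z, x) \<in> r \<longleftrightarrow> (z, y) \<in> r"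
proof -
  have "(y, z) \<in> r" if "(x, z) \<in> r" "\<pi> x = \<pi> y" "\<pi> x \<noteq> \<pi> z" for x y
    using that le_total[of y z] convex[of x z y] by metis
  moreover have "(z, y) \<in> r" if "(z, x) \<in> r" "\<pi> x = \<pi> y" "\<pi> x \<noteq> \<pi> z" for x y
    using that le_total[of y z] convex[of y z x] by metis
  ultimately show "(x, z) \<in> r \<longleftrightarrow> (y, z) \<in> r" "(z, x) \<in> r \<longleftrightarrow> (z, y) \<in> r" using assms by metis+
qed

definition above :: "nat \<Rightarrow> nat set" where
  "above x = {y \<in> block r \<pi> x. (x, y) \<in> r \<and> x \<noteq> y}"

lemma fin_above [simp]: "finite (above x)"
  unfolding above_def by simp

lemma isuc_unique: "isuc r x y \<Longrightarrow> isuc r x z \<Longrightarrow> y = z"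
  unfolding isuc_def by (metis le_antisym)

text \<open>Density puts a third point between points of different blocks, so an immediate successor
  cannot cross a block boundary.\<close>

lemma isuc_block: assumes "isuc r x y" shows "\<pi> y = \<pi> x"
proof (rule ccontr)
  assume "\<pi> y \<noteq> \<pi> x"
  with assms obtain z where "(x, z) \<in> r" "(z, y) \<in> r" "\<pi> z \<noteq> \<pi> x" "\<pi> z \<noteq> \<pi> y"
    using shuffle_mapD(6)[OF sm card_block] unfolding isuc_def by metis
  then show False using assms unfolding isuc_def by (metis le_antisym)
qed

text \<open>The least later point of the same block works: by convexity, points of other blocks to
  the right of \<open>x\<close> are to the right of the whole block.\<close>

lemma ex_isuc: assumes "above x \<noteq> {}" shows "\<exists>y\<in>above x. isuc r x y"
proof -
  interpret cv: shuf S "r\<inverse>" \<pi> by (rule conv)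
  from cv.finite_max[OF fin_above assms] obtain m where m: "m \<in> above x" "\<forall>z\<in>above x. (m, z) \<in> r" by auto
  have "(m, z) \<in> r" if z: "(x, z) \<in> r" "z \<noteq> x" for z
  proof (cases "\<pi> z = \<pi> x")
    case True
    then show ?thesis using m z unfolding above_def mem_block by auto
  next
    case False
    then show ?thesis using m z le_cong(1)[of m x z] unfolding above_def mem_block by auto
  qed
  then show ?thesis using m unfolding isuc_def above_def by blast
qed

lemma nosuc_iff: "nosuc r x \<longleftrightarrow> above x = {}"
  using ex_isuc[of x] isuc_block[of x] unfolding nosuc_def above_def mem_block isuc_def by auto

lemma nxt_isuc: "\<not> nosuc r x \<Longrightarrow> isuc r x (nxt r x)"
  unfolding nxt_def using LeastI_ex[of "\<lambda>y. nosuc r x \<or> isuc r x y"] by (auto simp: nosuc_def)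

lemma nxt_block [simp]: "\<pi> (nxt r x) = \<pi> x"
  using nxt_isuc isuc_block by (cases "nosuc r x") (auto simp: nxt_def)

lemma above_nxt: assumes "\<not> nosuc r x" shows "above x = insert (nxt r x) (above (nxt r x))"
proof -
  have n: "(x, nxt r x) \<in> r" "x \<noteq> nxt r x" "\<And>z. (x, z) \<in> r \<Longrightarrow> z = x \<or> (nxt r x, z) \<in> r"
    using nxt_isuc[OF assms] unfolding isuc_def by auto
  have "(x, z) \<in> r \<and> x \<noteq> z" if "(nxt r x, z) \<in> r" for z
    using le_trans[OF n(1) that] le_antisym[of x "nxt r x"] n(1,2) that by blast
  then show ?thesis
    using n unfolding above_def by (auto simp: mem_block)
qed

lemma card_above_nxt: "card (above (nxt r x)) = card (above x) - 1"
proof (cases "nosuc r x")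
  case True
  then show ?thesis by (simp add: nxt_def nosuc_iff)
next
  case False
  have "nxt r x \<notin> above (nxt r x)" unfolding above_def by simp
  then show ?thesis using above_nxt[OF False] by (simp add: card_insert_if)
qed

lemma card_above_iter: "card (above ((nxt r ^^ n) x)) = card (above x) - n"
  by (induction n) (auto simp: card_above_nxt)

lemma iter_block [simp]: "\<pi> ((nxt r ^^ n) x) = \<pi> x"
  by (induction n) auto

lemma nosuc_iff_card: "nosuc r x \<longleftrightarrow> card (above x) = 0"
  by (simp add: nosuc_iff)

lemma nright_eq: "nright r x = card (above x)"
  unfolding nright_def nosuc_iff_card card_above_iter by (rule Least_equality) auto

lemma nosuc_iter_nright: "nosuc r ((nxt r ^^ nright r x) x)"
  by (simp add: nosuc_iff_card card_above_iter nright_eq)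

lemma nosuc_max: "nosuc r x \<Longrightarrow> \<pi> y = \<pi> x \<Longrightarrow> (y, x) \<in> r"
  unfolding nosuc_iff above_def mem_block using le_total le_refl by blast

definition below :: "nat \<Rightarrow> nat set" where
  "below x = {y \<in> block r \<pi> x. (y, x) \<in> r \<and> y \<noteq> x}"

interpretation cv: shuf S "r\<inverse>" \<pi> by (rule conv)

lemma below_eq: "cv.above x = below x"
  unfolding cv.above_def below_def by auto

lemma nleft_eq: "nright (r\<inverse>) x = card (below x)"
  by (simp add: cv.nright_eq below_eq)

lemma lend_block [simp]: "\<pi> (lend r x) = \<pi> x"
  unfolding lend_def by simp

lemma lend_nosuc: "nosuc (r\<inverse>) (lend r x)"
  unfolding lend_def by (rule cv.nosuc_iter_nright)

lemma lend_le: "\<pi> y = \<pi> x \<Longrightarrow> (lend r x, y) \<in> r"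
  using cv.nosuc_max[OF lend_nosuc, of y x] by simp

lemma lend_eq_iff: "lend r x = lend r y \<longleftrightarrow> \<pi> x = \<pi> y"
  by (metis lend_block lend_le le_antisym)

lemma nleft_lend: "nright (r\<inverse>) (lend r x) = 0"
  using lend_nosuc cv.nosuc_iff_card cv.nright_eq by simp

lemma fin_below [simp]: "finite (below x)"
  unfolding below_def by simp

lemma card_split: "nright (r\<inverse>) x + nright r x + 1 = card (block r \<pi> x)"
proof -
  have "block r \<pi> x = below x \<union> (insert x (above x))"
    unfolding below_def above_def using le_total by (auto simp: mem_block)
  moreover have "below x \<inter> insert x (above x) = {}" "x \<notin> above x"
    unfolding below_def above_def using le_antisym by auto
  ultimately show ?thesis
    by (simp add: nright_eq nleft_eq card_Un_disjoint)
qed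

lemma nleft_le: assumes "\<pi> x = \<pi> y" shows "(x, y) \<in> r \<longleftrightarrow> nright (r\<inverse>) x \<le> nright (r\<inverse>) y"
proof -
  have *: "nright (r\<inverse>) x < nright (r\<inverse>) y" if "(x, y) \<in> r" "x \<noteq> y" "\<pi> x = \<pi> y" for x y
    unfolding nleft_eq
  proof (rule psubset_card_mono)
    show "below x \<subset> below y"
      using that block_cong[OF that(3)] le_trans le_antisym unfolding below_def by (auto simp: mem_block)
  qed simp
  from *[of x y] *[of y x] assms le_total[of x y] le_refl show ?thesis
    by (cases "x = y") (auto simp: not_le)
qed

lemma ex_nleft: assumes "n < card (block r \<pi> x)" shows "\<exists>y. \<pi> y = \<pi> x \<and> nright (r\<inverse>) y = n"
proof -
  \<comment> \<open>After \<open>n\<close> steps from the first point the right count has dropped by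
    \<open>n\<close>; \<open>card_split\<close> turns this into left count \<open>n\<close>.\<close>
  let ?y = "(nxt r ^^ n) (lend r x)"
  have b: "\<pi> ?y = \<pi> x" "block r \<pi> (lend r x) = block r \<pi> x" by (simp_all add: mem_block set_eq_iff)
  have "nright r ?y = nright r (lend r x) - n" by (simp add: nright_eq card_above_iter)
  then have "nright (r\<inverse>) ?y = n"
    using card_split[of ?y] card_split[of "lend r x"] assms b block_cong[OF b(1)] nleft_lend[of x] by simp
  then show ?thesis using b by blast
qed

text \<open>Only the greatest element of \<open>U\<close> and the least of \<open>V\<close> matter;
  convexity carries the separation to the others. If one of the sets is empty, unboundedness takes
  the place of density.\<close>

lemma insert_between:
  assumes fin: "finite U" "finite V" and c: "c \<in> S"
    and sep: "\<And>u v. u \<in> U \<Longrightarrow> v \<in> V \<Longrightarrow> (u, v) \<in> r \<and> \<pi> u \<noteq> \<pi> v"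
  shows "\<exists>z. card (block r \<pi> z) = c \<and> (\<forall>u\<in>U. (u, z) \<in> r \<and> \<pi> u \<noteq> \<pi> z) \<and> (\<forall>v\<in>V. (z, v) \<in> r \<and> \<pi> v \<noteq> \<pi> z)"
proof -
  have mx: "\<exists>m\<in>A. \<forall>z\<in>A. (z, m) \<in> r" if "finite A" "A \<noteq> {}" for A
    by (rule finite_max[OF that])
  have mn: "\<exists>m\<in>A. \<forall>z\<in>A. (m, z) \<in> r" if "finite A" "A \<noteq> {}" for A
    using cv.finite_max[OF that] by simp
  have up: "(u, z) \<in> r \<and> \<pi> u \<noteq> \<pi> z" if "(u, m) \<in> r" "(m, z) \<in> r" "\<pi> z \<noteq> \<pi> m" for u m z
    using that le_trans convex by metis
  have dn: "(z, v) \<in> r \<and> \<pi> v \<noteq> \<pi> z" if "(m, v) \<in> r" "(z, m) \<in> r" "\<pi> z \<noteq> \<pi> m" for v m z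
    using that le_trans convex by metis
  have A: "\<exists>z. (x, z) \<in> r \<and> \<pi> z \<noteq> \<pi> x \<and> card (block r \<pi> z) = c"
     "\<exists>z. (z, x) \<in> r \<and> \<pi> z \<noteq> \<pi> x \<and> card (block r \<pi> z) = c" for x
    using shuffle_mapD(7,8)[OF sm _ c] UNIV by auto
  consider "U = {}" "V = {}" | "U \<noteq> {}" "V = {}" | "U = {}" "V \<noteq> {}" | "U \<noteq> {}" "V \<noteq> {}" by blast
  then show ?thesis
  proof cases
    case 1
    then show ?thesis using A(1) by auto
  next
    case 2
    from mx[OF fin(1) 2(1)] obtain m where m: "m \<in> U" "\<forall>u\<in>U. (u, m) \<in> r" by blast
    from A(1)[of m] obtain z where z: "(m, z) \<in> r" "\<pi> z \<noteq> \<pi> m" "card (block r \<pi> z) = c" by blast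
    then show ?thesis using m 2 up by (intro exI[of _ z]) blast
  next
    case 3
    from mn[OF fin(2) 3(2)] obtain m where m: "m \<in> V" "\<forall>u\<in>V. (m, u) \<in> r" by blast
    from A(2)[of m] obtain z where z: "(z, m) \<in> r" "\<pi> z \<noteq> \<pi> m" "card (block r \<pi> z) = c" by blast
    then show ?thesis using m 3 dn by (intro exI[of _ z]) blast
  next
    case 4
    from mx[OF fin(1) 4(1)] obtain m where m: "m \<in> U" "\<forall>u\<in>U. (u, m) \<in> r" by blast
    from mn[OF fin(2) 4(2)] obtain n where n: "n \<in> V" "\<forall>u\<in>V. (n, u) \<in> r" by blast
    from sep[OF m(1) n(1)] have mn: "(m, n) \<in> r" "\<pi> m \<noteq> \<pi> n" by auto
    from shuffle_mapD(6)[OF sm c mn] obtain z where z: "(m, z) \<in> r" "(z, n) \<in> r" "\<pi> z \<noteq> \<pi> m" "\<pi> z \<noteq> \<pi> n" "card (block r \<pi> z) = c"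
      by blast
    then show ?thesis using m n up dn by (intro exI[of _ z]) blast
  qed
qed

end

text \<open>If \<open>P\<close> already meets the block of \<open>x\<close>, the matching block has
  the same size and the image is its point with the same left count. Otherwise a block of the right
  size is chosen between the images of the points on the two sides of \<open>x\<close>.\<close>

lemma shuf_extend:
  assumes A: "shuf S A \<pi>" and B: "shuf S B \<pi>'" and fin: "finite P" and comp: "compat (rho A) (rho B) P"
  shows "\<exists>y. compat (rho A) (rho B) (insert (x, y) P)"
proof -
  interpret A: shuf S A \<pi> by fact
  interpret B: shuf S B \<pi>' by fact
  note rho = rho_eq_iff[of A _ _ B] A.lend_eq_iff B.lend_eq_iff
  have P: "((a, a') \<in> A \<longleftrightarrow> (b, b') \<in> B)" "\<pi> a = \<pi> a' \<longleftrightarrow> \<pi>' b = \<pi>' b'"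
      "nright (A\<inverse>) a = nright (B\<inverse>) b" "nright A a = nright B b"
    if "(a, b) \<in> P" "(a', b') \<in> P" for a b a' b'
    using comp that unfolding compat_def rho by fastforce+
  have "\<exists>y. nright (A\<inverse>) x = nright (B\<inverse>) y \<and> nright A x = nright B y \<and>
    (\<forall>(a, b)\<in>P. ((x, a) \<in> A \<longleftrightarrow> (y, b) \<in> B) \<and> ((a, x) \<in> A \<longleftrightarrow> (b, y) \<in> B) \<and> (\<pi> x = \<pi> a \<longleftrightarrow> \<pi>' y = \<pi>' b))"
  proof (cases "\<exists>(a, b)\<in>P. \<pi> a = \<pi> x")
    case True
    then obtain a b where ab: "(a, b) \<in> P" "\<pi> a = \<pi> x" by blast
    have card: "card (block A \<pi> x) = card (block B \<pi>' b)"
      using A.card_split[of a] B.card_split[of b] P[OF ab(1) ab(1)] A.block_cong[OF ab(2)] by simp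
    have "nright (A\<inverse>) x < card (block B \<pi>' b)"
      using A.card_split[of x] card by simp
    from B.ex_nleft[OF this] obtain y where y: "\<pi>' y = \<pi>' b" "nright (B\<inverse>) y = nright (A\<inverse>) x" by blast
    have 1: "nright A x = nright B y"
      using A.card_split[of x] B.card_split[of y] card y B.block_cong[OF y(1)] by simp
    have "((x, c) \<in> A \<longleftrightarrow> (y, d) \<in> B) \<and> ((c, x) \<in> A \<longleftrightarrow> (d, y) \<in> B) \<and> (\<pi> x = \<pi> c \<longleftrightarrow> \<pi>' y = \<pi>' d)"
      if cd: "(c, d) \<in> P" for c d
    proof (cases "\<pi> c = \<pi> x")
      case True
      then have "\<pi>' d = \<pi>' y" using P(2)[OF ab(1) cd] ab(2) y(1) by simp
      then show ?thesis using True A.nleft_le[of x c] A.nleft_le[of c x] B.nleft_le[of y d] B.nleft_le[of d y]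
          y(2) P(3)[OF cd cd] by simp
    next
      case False
      then have "\<pi>' d \<noteq> \<pi>' y" using P(2)[OF ab(1) cd] ab(2) y(1) by auto
      then show ?thesis
        using False A.le_cong[of x a c] B.le_cong[of y b d] ab(2) y(1) P(1)[OF ab(1) cd] P(1)[OF cd ab(1)] by auto
    qed
    then show ?thesis using y(2) 1 by (intro exI[of _ y]) auto
  next
    case False
    let ?U = "{b. \<exists>a. (a, b) \<in> P \<and> (a, x) \<in> A}" and ?V = "{b. \<exists>a. (a, b) \<in> P \<and> (x, a) \<in> A}"
    have fU: "finite ?U" "finite ?V"
      by (rule finite_subset[OF _ finite_imageI[OF fin, of snd]]; force)+
    have "(u, v) \<in> B \<and> \<pi>' u \<noteq> \<pi>' v" if "u \<in> ?U" "v \<in> ?V" for u v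
    proof -
      from that obtain a a' where a: "(a, u) \<in> P" "(a, x) \<in> A" "(a', v) \<in> P" "(x, a') \<in> A" by blast
      then have "(a, a') \<in> A" using A.le_trans by blast
      moreover have "\<pi> a \<noteq> \<pi> a'" using A.convex[OF a(2,4)] False a(1) by auto
      ultimately show ?thesis using P(1,2)[OF a(1,3)] by blast
    qed
    from B.insert_between[OF fU A.card_block[of x] this] obtain z where
      z: "card (block B \<pi>' z) = card (block A \<pi> x)"
        "\<And>u. u \<in> ?U \<Longrightarrow> (u, z) \<in> B \<and> \<pi>' u \<noteq> \<pi>' z" "\<And>v. v \<in> ?V \<Longrightarrow> (z, v) \<in> B \<and> \<pi>' v \<noteq> \<pi>' z" by blast
    have "nright (A\<inverse>) x < card (block B \<pi>' z)"
      using A.card_split[of x] z by simp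
    from B.ex_nleft[OF this] obtain y where y: "\<pi>' y = \<pi>' z" "nright (B\<inverse>) y = nright (A\<inverse>) x" by blast
    have 1: "nright A x = nright B y"
      using A.card_split[of x] B.card_split[of y] z y B.block_cong[OF y(1)] by simp
    have "((x, c) \<in> A \<longleftrightarrow> (y, d) \<in> B) \<and> ((c, x) \<in> A \<longleftrightarrow> (d, y) \<in> B) \<and> (\<pi> x = \<pi> c \<longleftrightarrow> \<pi>' y = \<pi>' d)"
      if cd: "(c, d) \<in> P" for c d
    proof -
      have ne: "\<pi> c \<noteq> \<pi> x" "c \<noteq> x" using False cd by auto
      show ?thesis
      proof (cases "(c, x) \<in> A")
        case True
        then have "(x, c) \<notin> A" using ne A.le_antisym by blast
        moreover have "(d, z) \<in> B" "\<pi>' d \<noteq> \<pi>' z" using z(2) cd True by auto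
        then have "(d, y) \<in> B" "\<pi>' d \<noteq> \<pi>' y" using B.le_cong[of z y d] y by auto
        moreover then have "(y, d) \<notin> B" using B.le_antisym by auto
        ultimately show ?thesis using True ne by auto
      next
        case False
        then have "(x, c) \<in> A" using A.le_total by blast
        moreover have "(z, d) \<in> B" "\<pi>' d \<noteq> \<pi>' z" using z(3) cd calculation by auto
        then have "(y, d) \<in> B" "\<pi>' d \<noteq> \<pi>' y" using B.le_cong[of z y d] y by auto
        moreover then have "(d, y) \<notin> B" using B.le_antisym by auto
        ultimately show ?thesis using False ne by auto
      qed
    qed
    then show ?thesis using y(2) 1 by (intro exI[of _ y]) auto
  qed
  then obtain y where y: "nright (A\<inverse>) x = nright (B\<inverse>) y" "nright A x = nright B y"
    "\<And>a b. (a, b) \<in> P \<Longrightarrow> ((x, a) \<in> A \<longleftrightarrow> (y, b) \<in> B) \<and> ((a, x) \<in> A \<longleftrightarrow> (b, y) \<in> B) \<and> (\<pi> x = \<pi> a \<longleftrightarrow> \<pi>' y = \<pi>' b)"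
    by fast
  have "compat (rho A) (rho B) (insert (x, y) P)"
    unfolding compat_def rho
  proof (intro ballI)
    fix p q assume pq: "p \<in> insert (x, y) P" "q \<in> insert (x, y) P"
    obtain a b c d where ab: "p = (a, b)" "q = (c, d)" by (metis prod.exhaust)
    consider "p = (x, y)" "q = (x, y)" | "p = (x, y)" "(c, d) \<in> P" | "(a, b) \<in> P" "q = (x, y)" | "(a, b) \<in> P" "(c, d) \<in> P"
      using pq ab by auto
    then show "((fst p, fst q) \<in> A \<longleftrightarrow> (snd p, snd q) \<in> B) \<and> (\<pi> (fst p) = \<pi> (fst q) \<longleftrightarrow> \<pi>' (snd p) = \<pi>' (snd q)) \<and>
       nright (A\<inverse>) (fst p) = nright (B\<inverse>) (snd p) \<and> nright A (fst p) = nright B (snd p)"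
    proof cases
      case 1
      then show ?thesis using y(1,2) A.le_refl B.le_refl by simp
    next
      case 2
      then show ?thesis using y(1,2) y(3)[OF 2(2)] ab by simp
    next
      case 3
      then show ?thesis using y(3)[OF 3(1)] ab P(3,4)[OF 3(1) 3(1)] by auto
    next
      case 4
      then show ?thesis using ab P[OF 4] by simp
    qed
  qed
  then show ?thesis by blast
qed

lemma compat_swap: "compat \<rho> \<sigma> P \<longleftrightarrow> compat \<sigma> \<rho> (P\<inverse>)"
  unfolding compat_def by force

lemma (in mu_class) shuf_iso:
  assumes A: "shuf S A \<pi>" and B: "shuf S B \<pi>'"
    and C: "C 2 (\<lambda>xs. rho A (xs ! 0) (xs ! 1))" "C 2 (\<lambda>xs. rho B (xs ! 0) (xs ! 1))"
  obtains f where "iso A B f" "C 1 (\<lambda>xs. f (xs ! 0))" "C 1 (\<lambda>xs. inv f (xs ! 0))"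
proof -
  interpret A: shuf S A \<pi> by fact
  interpret B: shuf S B \<pi>' by fact
  have 1: "\<exists>x. compat (rho A) (rho B) (insert (x, y) P)" if "finite P" "compat (rho A) (rho B) P" for P y
  proof -
    \<comment> \<open>The back step is the forth step for the inverse partial map.\<close>
    have "\<exists>x. compat (rho B) (rho A) (insert (y, x) (P\<inverse>))"
      using shuf_extend[OF B A, of "P\<inverse>"] that compat_swap by auto
    moreover have "(insert (x, y) P)\<inverse> = insert (y, x) (P\<inverse>)" for x by auto
    ultimately show ?thesis using compat_swap[of "rho A" "rho B" "insert (_, y) P"] by simp
  qed
  have s1: "x = y" if "rho A x y = rho B z z" "rho A y x = rho B z z" for x y z
    using that A.le_antisym B.le_refl unfolding rho_eq_iff by blast
  have s2: "x = y" if "rho A z z = rho B x y" "rho A z z = rho B y x" for x y z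
    using that B.le_antisym A.le_refl unfolding rho_eq_iff by blast
  show thesis
  proof (rule back_and_forth[OF C shuf_extend[OF A B] 1 s2 s1])
    fix f g assume fg: "C 1 (\<lambda>xs. f (xs ! 0))" "C 1 (\<lambda>xs. g (xs ! 0))"
    "\<And>x. g (f x) = x" "\<And>y. f (g y) = y" "\<And>x x'. rho A x x' = rho B (f x) (f x')"
    have "bij f" using fg(3,4) by (intro o_bij[of g]) (auto simp: fun_eq_iff)
    moreover have "(x, x') \<in> A \<longleftrightarrow> (f x, f x') \<in> B" for x x'
      using fg(5)[of x x'] unfolding rho_eq_iff by blast
    ultimately have "iso A B f" unfolding iso_iff2 A.UNIV B.UNIV by blast
    moreover have "inv f = g" using fg(3,4) by (rule inv_equality)
    ultimately show thesis using that fg(1,2) by blast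
  qed auto
qed

lemma shuf_isomorphic:
  assumes "shuf S A \<pi>" "shuf S B \<pi>'"
  shows "isomorphic A B"
proof -
  \<comment> \<open>The class of all functions trivially has the closure properties; the effective
    lemma then yields bare existence.\<close>
  interpret mu_class "\<lambda>_ _. True" by unfold_locales auto
  from shuf_iso[OF assms] show ?thesis unfolding isomorphic_def by auto
qed

section \<open>Invariance and complexity of the block data\<close>

lemma isuc_iso: assumes "bij h" "\<And>x y. (x, y) \<in> r \<longleftrightarrow> (h x, h y) \<in> s"
  shows "isuc s (h x) (h y) \<longleftrightarrow> isuc r x y"
proof -
  have "(\<forall>z. Q z) \<longleftrightarrow> (\<forall>z. Q (h z))" for Q using assms(1) by (metis bij_pointE)
  from this[of "\<lambda>z. (h x, z) \<in> s \<longrightarrow> z = h x \<or> (h y, z) \<in> s"] show ?thesis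
    unfolding isuc_def using assms by (simp add: bij_is_inj inj_eq)
qed

text \<open>The count is defined from the order alone. In the lower bound this invariance carries
  first points of small blocks to first points of small blocks.\<close>

lemma nright_iso: assumes A: "shuf S A \<pi>" and B: "shuf T B \<pi>'" and h: "iso A B h"
  shows "nright B (h x) = nright A x"
proof -
  interpret A: shuf S A \<pi> by fact
  interpret B: shuf T B \<pi>' by fact
  have bij: "bij h" and le: "\<And>x y. (x, y) \<in> A \<longleftrightarrow> (h x, h y) \<in> B"
    using h unfolding iso_iff2 A.UNIV B.UNIV by auto
  note i = isuc_iso[OF bij le]
  have n: "nosuc B (h x) \<longleftrightarrow> nosuc A x" for x
    unfolding nosuc_def using i bij by (metis bij_pointE)
  have "nxt B (h x) = h (nxt A x)" for x
  proof (cases "nosuc A x")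
    case True
    then show ?thesis by (simp add: nxt_def n)
  next
    case False
    then show ?thesis using A.nxt_isuc[OF False] B.nxt_isuc[of "h x"] n i B.isuc_unique by blast
  qed
  then have "(nxt B ^^ n) (h x) = h ((nxt A ^^ n) x)" for n
    by (induction n) auto
  then show ?thesis unfolding nright_def by (simp add: n)
qed

lemma punctual_PRp: "punctual A \<Longrightarrow> PRp 2 (\<lambda>xs. (xs ! 0, xs ! 1) \<in> A)"
  unfolding punctual_def prim_rec_pred_def PRp_def ext_closure_def of_bool_def by metis

lemma rho_D3: assumes "PRp 2 (\<lambda>xs. (xs ! 0, xs ! 1) \<in> A)" and shuf: "shuf S A \<pi>"
  shows "D3 2 (\<lambda>xs. rho A (xs ! 0) (xs ! 1))"
proof -
  have le: "primf {} n a \<Longrightarrow> primf {} n b \<Longrightarrow> primf {} n (\<lambda>xs. of_bool ((a xs, b xs) \<in> A))" for n a b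
    using PR.lift2[of "\<lambda>x y. of_bool ((x, y) \<in> A)"] assms unfolding PRp_def by simp
  \<comment> \<open>Stated for any order, so that it also applies to the converse of the given one,
    which provides the left counts.\<close>
  have main: "D3 1 (\<lambda>xs. nxt A (xs ! 0)) \<and> D3 1 (\<lambda>xs. nright A (xs ! 0))"
    if shuf: "shuf S A \<pi>" and le: "\<And>n a b. primf {} n a \<Longrightarrow> primf {} n b \<Longrightarrow> primf {} n (\<lambda>xs. of_bool ((a xs, b xs) \<in> A))" for A
  proof -
    have i1: "ALLc (EXc PRp) 2 (\<lambda>xs. isuc A (xs ! 0) (xs ! 1))"
      unfolding isuc_def
      by (intro AE.conj E.ALLc_all AE.base E.base pr le; simp)
    have n1: "EXc PRp 2 (\<lambda>xs. \<not> isuc A (xs ! 0) (xs ! 1))"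
      unfolding isuc_def de_Morgan_conj not_all
      by (intro E.disj E.ex E.base pr le; simp)
    have i: "D3 2 (\<lambda>xs. of_bool (isuc A (xs ! 0) (xs ! 1)))"
      by (intro D3_of_bool AE_S3 E_S3 i1 n1)
    have i: "D3 n a \<Longrightarrow> D3 n b \<Longrightarrow> D3 n (\<lambda>xs. of_bool (isuc A (a xs) (b xs)))" for n a b
      by (rule D3.lift2[OF i])
    have "ALLc (EXc PRp) 1 (\<lambda>xs. \<forall>y. \<not> isuc A (xs ! 0) y)"
      by (intro E.ALLc_all E.lift2[where F = "\<lambda>x y. \<not> isuc A x y", OF n1] pr; simp)
    then have n2: "S3 1 (\<lambda>xs. nosuc A (xs ! 0))"
      unfolding nosuc_def by (rule AE_S3)
    \<comment> \<open>A characteristic function is in \<open>D3\<close> if the predicate and its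
      complement are in \<open>S3\<close>; here the complement only prefixes an existential
      quantifier to \<open>isuc\<close>.\<close>
    have "S3 1 (\<lambda>xs. \<exists>y. isuc A (xs ! 0) y)"
      by (intro S3.ex AE_S3 AE.lift2[where F = "\<lambda>x y. isuc A x y", OF i1] pr; simp)
    then have n3: "S3 1 (\<lambda>xs. \<not> nosuc A (xs ! 0))"
      unfolding nosuc_def by simp
    have n: "D3 n a \<Longrightarrow> D3 n (\<lambda>xs. of_bool (nosuc A (a xs)))" for n a
      by (rule D3.lift1[OF D3_of_bool[OF n2 n3]])
    have x: "D3 1 (\<lambda>xs. nxt A (xs ! 0))"
      unfolding nxt_def by (intro D3.least pr i n; simp?) (auto simp: nosuc_def)
    have "(f ^^ n) x = rec_nat x (\<lambda>_. f) n" for f and n and x :: nat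
      by (induction n) auto
    then have it: "D3 m a \<Longrightarrow> D3 m b \<Longrightarrow> D3 m (\<lambda>xs. (nxt A ^^ a xs) (b xs))" for m a b
      by (simp, intro D3.rec pr D3.lift1[OF x]) simp_all
    \<comment> \<open>Finiteness of the blocks makes the search for the last point total.\<close>
    have ex: "\<exists>n. nosuc A ((nxt A ^^ n) x)" for x
      using shuf.nosuc_iter_nright[OF shuf] by blast
    have "D3 1 (\<lambda>xs. nright A (xs ! 0))"
      unfolding nright_def by (intro D3.least pr n it; simp?) (rule ex)
    with x show ?thesis ..
  qed
  have le': "primf {} n a \<Longrightarrow> primf {} n b \<Longrightarrow> primf {} n (\<lambda>xs. of_bool ((a xs, b xs) \<in> A\<inverse>))" for n a b
    using le by simp
  from main[OF shuf le] main[OF shuf.conv[OF shuf] le']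
  have m: "D3 1 (\<lambda>xs. nright A (xs ! 0))" "D3 1 (\<lambda>xs. nxt (A\<inverse>) (xs ! 0))"
      "D3 1 (\<lambda>xs. nright (A\<inverse>) (xs ! 0))" by blast+
  have "(f ^^ n) x = rec_nat x (\<lambda>_. f) n" for f and n and x :: nat
    by (induction n) auto
  then have l: "D3 n a \<Longrightarrow> D3 n (\<lambda>xs. lend A (a xs))" for n a
    unfolding lend_def by (simp, intro D3.rec pr D3.lift1[OF m(2)] D3.lift1[OF m(3)]) simp_all
  have "D3 2 (\<lambda>xs. of_bool ((xs ! 0, xs ! 1) \<in> A))"
    using assms(1) unfolding PRp_def by (rule D3.primf_empty)
  then show ?thesis
    unfolding rho_def by (intro pr l D3.lift1[OF m(1)] D3.lift1[OF m(3)]; simp)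
qed

section \<open>The node order\<close>

text \<open>Nodes are lists whose head is the last digit.  Digits are compared in reverse, and a node
  precedes its descendants; so the children of \<open>q\<close> form a decreasing sequence with limit \<open>q\<close>.\<close>

definition nlt :: "nat list \<Rightarrow> nat list \<Rightarrow> bool" where
  "nlt s t \<longleftrightarrow> (rev s, rev t) \<in> lexord {(a, b). b < a}"

text \<open>Reversal turns the first difference seen from the root into a split above the deepest
  common ancestor \<open>q\<close>.\<close>

lemma nlt_iff: "nlt s t \<longleftrightarrow> (\<exists>xs. xs \<noteq> [] \<and> t = xs @ s) \<or>
    (\<exists>xs ys q a b. b < a \<and> s = xs @ a # q \<and> t = ys @ b # q)"
proof -
  have "(\<exists>a v. rev t = rev s @ a # v) \<longleftrightarrow> (\<exists>xs. xs \<noteq> [] \<and> t = xs @ s)"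
  proof
    assume "\<exists>a v. rev t = rev s @ a # v"
    then obtain a v where "rev t = rev s @ a # v" by blast
    then have "t = (rev v @ [a]) @ s" by (simp add: rev_swap)
    then show "\<exists>xs. xs \<noteq> [] \<and> t = xs @ s" by blast
  next
    assume "\<exists>xs. xs \<noteq> [] \<and> t = xs @ s"
    then obtain xs where "xs \<noteq> []" "t = xs @ s" by blast
    then show "\<exists>a v. rev t = rev s @ a # v" by (intro exI[of _ "hd (rev xs)"] exI[of _ "tl (rev xs)"]) simp
  qed
  moreover have "(\<exists>u a b v w. (a, b) \<in> {(a, b). b < a} \<and> rev s = u @ a # v \<and> rev t = u @ b # w) \<longleftrightarrow>
     (\<exists>xs ys q a b. b < a \<and> s = xs @ a # q \<and> t = ys @ b # q)"
  proof
    assume "\<exists>u a b v w. (a, b) \<in> {(a, b). b < a} \<and> rev s = u @ a # v \<and> rev t = u @ b # w"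
    then obtain u a b v w where "b < a" "rev s = u @ a # v" "rev t = u @ b # w" by blast
    then have "b < a \<and> s = rev v @ a # rev u \<and> t = rev w @ b # rev u"
      by (simp add: rev_swap)
    then show "\<exists>xs ys q a b. b < a \<and> s = xs @ a # q \<and> t = ys @ b # q" by blast
  next
    assume "\<exists>xs ys q a b. b < a \<and> s = xs @ a # q \<and> t = ys @ b # q"
    then obtain xs ys q a b where "b < a" "s = xs @ a # q" "t = ys @ b # q" by blast
    then show "\<exists>u a b v w. (a, b) \<in> {(a, b). b < a} \<and> rev s = u @ a # v \<and> rev t = u @ b # w"
      by (intro exI[of _ "rev q"] exI[of _ a] exI[of _ b] exI[of _ "rev xs"] exI[of _ "rev ys"]) simp
  qed
  moreover have "nlt s t \<longleftrightarrow> (\<exists>a v. rev t = rev s @ a # v) \<or>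
      (\<exists>u a b v w. (a, b) \<in> {(a, b). b < a} \<and> rev s = u @ a # v \<and> rev t = u @ b # w)"
    unfolding nlt_def lexord_def by (simp add: ex_disj_distrib)
  ultimately show ?thesis by (simp only:)
qed

lemma nlt_desc: "xs \<noteq> [] \<Longrightarrow> nlt s (xs @ s)"
  unfolding nlt_iff by blast

lemma nlt_child: "nlt s (n # s)"
  using nlt_desc[of "[n]" s] by simp

lemma nlt_branch: "b < a \<Longrightarrow> nlt (xs @ a # q) (ys @ b # q)"
  unfolding nlt_iff by blast

lemma nlt_trans: "nlt s t \<Longrightarrow> nlt t u \<Longrightarrow> nlt s u"
  unfolding nlt_def by (erule (1) lexord_trans) (auto simp: trans_def)

lemma nlt_irrefl: "\<not> nlt s s"
  unfolding nlt_def by (rule lexord_irreflexive) auto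

lemma nlt_total: "nlt s t \<or> s = t \<or> nlt t s"
  using lexord_linear[of "{(a, b). b < a}" "rev s" "rev t"] unfolding nlt_def
  by (metis (mono_tags, lifting) case_prodI linorder_cases mem_Collect_eq rev_is_rev_conv)

lemma nlt_asym: "nlt s t \<Longrightarrow> \<not> nlt t s"
  using nlt_trans nlt_irrefl by blast

section \<open>A shuffle in which small blocks are rare\<close>

fun tst :: "nat list \<Rightarrow> bool" where
  "tst [] = False"
| "tst (n # q) = (even n \<and> \<not> tst q)"

text \<open>
  An even digit \<open>2 * \<sigma>\<close> below a node \<open>u\<close> that is not a test node itself makes a test node for the candidate
  \<open>\<sigma>\<close> at level \<open>list_encode u\<close>; the candidate is correct iff every \<open>v\<close> is refuted.  The other nodes below \<open>u\<close>
  carry the blocks of size greater than \<open>k\<close>.  As long as \<open>v\<close> is not refuted, the \<open>m - k\<close> points at the child \<open>v\<close> of a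
  test node are adjacent to the \<open>k\<close> points of that node: everything in between is unavailable.
\<close>

locale shuffle_constr =
  fixes N :: "nat \<Rightarrow> nat" and k m :: nat and P :: "nat \<Rightarrow> nat \<Rightarrow> nat \<Rightarrow> nat \<Rightarrow> bool"
  assumes k: "k \<in> range N" "\<And>i. k \<le> N i" "0 < k" and m: "m \<in> range N" "k < m"
    and P: "\<And>l. \<exists>\<sigma>. \<forall>v. \<exists>w. P l \<sigma> v w"
begin

definition refu :: "nat list \<Rightarrow> nat \<Rightarrow> nat \<Rightarrow> bool" where
  "refu q v w \<longleftrightarrow> P (list_encode (tl q)) (hd q div 2) v w"

definition refuted :: "nat list \<Rightarrow> nat \<Rightarrow> bool" where
  "refuted q v \<longleftrightarrow> (\<exists>w. refu q v w)"

text \<open>The children of a test node open up one after another, each once all smaller ones are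
  refuted. Hence at most one available child is unrefuted.\<close>

fun avail :: "nat list \<Rightarrow> bool" where
  "avail [] = True"
| "avail (v # q) = (avail q \<and> (tst q \<longrightarrow> (\<forall>v'<v. refuted q v')))"

text \<open>Blocks of size \<open>k\<close> are reserved for test nodes: a node for a family member
  of size \<open>k\<close> stays empty, and a child of a test node has \<open>m\<close> points as
  soon as it no longer shares its parent's block.\<close>

fun bsize :: "nat list \<Rightarrow> nat" where
  "bsize [] = 0"
| "bsize (n # q) = (if tst (n # q) then k
     else if tst q then (if refuted q n then m else m - k)
     else if k < N (n div 2) then N (n div 2) else 0)"

fun rep :: "nat list \<Rightarrow> nat list" where
  "rep [] = []"
| "rep (v # q) = (if tst q \<and> \<not> refuted q v then q else v # q)"

definition Y :: "(nat list \<times> nat) set" where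
  "Y = {(t, j). avail t \<and> j < bsize t}"

definition yord :: "(nat list \<times> nat) rel" where
  "yord = {((s, i), (t, j)). (s, i) \<in> Y \<and> (t, j) \<in> Y \<and> (nlt s t \<or> s = t \<and> i \<le> j)}"

lemma Field_yord: "Field yord = Y"
  unfolding yord_def Field_def by auto

lemma Linear_order_yord: "Linear_order yord"
  unfolding order_on_defs Field_yord
proof (intro conjI)
  show "yord \<subseteq> Y \<times> Y" unfolding yord_def by auto
  show "refl_on Y yord" unfolding yord_def refl_on_def by auto
  show "trans yord" unfolding yord_def trans_def using nlt_trans by auto
  show "antisym yord" unfolding yord_def antisym_def using nlt_asym nlt_irrefl by auto
  show "total_on Y yord"
    unfolding total_on_def
  proof clarify
    fix s i t j assume "(s, i) \<in> Y" "(t, j) \<in> Y" "((t, j), (s, i)) \<notin> yord"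
    then show "((s, i), (t, j)) \<in> yord"
      using nlt_total[of s t] unfolding yord_def by auto
  qed
qed

lemma avail_append: "avail (xs @ q) \<Longrightarrow> avail q"
  by (induction xs) auto

lemma tst_rep: "tst t \<Longrightarrow> rep t = t"
  by (cases t) auto

lemma rep_cases: "rep t = t \<or> (\<exists>v. t = v # rep t \<and> tst (rep t) \<and> \<not> refuted (rep t) v)"
  by (cases t) auto

lemma rep_rep [simp]: "rep (rep t) = rep t"
  using rep_cases[of t] tst_rep by metis

lemma block_single:
  assumes "\<And>t'. rep t' = t \<Longrightarrow> t' = t" "rep t = t" "avail t"
  shows "block yord (\<lambda>(t, j). rep t) (t, j) = Pair t ` {..<bsize t}"
proof -
  have "rep t' = rep t \<longleftrightarrow> t' = t" for t' using assms(1,2) by metis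
  then show ?thesis
    unfolding block_def Field_yord Y_def using assms(3) by auto
qed

text \<open>Sizes above \<open>k\<close> come from an odd digit \<open>2 * i + 1\<close>. Size
  \<open>k\<close> comes from \<open>2 * \<sigma>\<close> with \<open>\<sigma>\<close> correct at
  level \<open>list_encode u\<close>: all children of that node are refuted, so none merges into
  it.\<close>

lemma ex_child: assumes u: "avail u" "\<not> tst u" and c: "c \<in> range N"
  shows "\<exists>n. (n # u, 0) \<in> Y \<and> card (block yord (\<lambda>(t, j). rep t) (n # u, 0)) = c \<and>
    (\<forall>t'. rep t' = n # u \<longrightarrow> t' = n # u)"
proof -
  have *: ?thesis if "\<And>t'. rep t' = n # u \<Longrightarrow> t' = n # u" "bsize (n # u) = c" for n
  proof -
    have "rep (n # u) = n # u" "avail (n # u)" using u by auto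
    note b = block_single[OF that(1) this]
    have "0 < c" using c k(2,3) by (auto intro: less_le_trans)
    then show ?thesis
      using that u b by (intro exI[of _ n]) (auto simp: Y_def card_image inj_on_def)
  qed
  show ?thesis
  proof (cases "c = k")
    case True
    obtain \<sigma> where \<sigma>: "\<forall>v. \<exists>w. P (list_encode u) \<sigma> v w" using P by blast
    show ?thesis
    proof (rule *)
      fix t' assume "rep t' = 2 * \<sigma> # u"
      then show "t' = 2 * \<sigma> # u" using rep_cases[of t'] \<sigma> by (auto simp: refuted_def refu_def)
    qed (use True u in auto)
  next
    case False
    obtain i where i: "c = N i" using c by auto
    then have "k < N i" using False k(2)[of i] by simp
    show ?thesis
    proof (rule *)
      fix t' assume "rep t' = (2 * i + 1) # u"
      then show "t' = (2 * i + 1) # u" using rep_cases[of t'] by auto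
    qed (use i \<open>k < N i\<close> u in auto)
  qed
qed

lemma ex_above: assumes "avail t" shows "\<exists>u xs. avail u \<and> \<not> tst u \<and> u = xs @ t"
proof (cases "tst t")
  case False
  then show ?thesis using assms by (intro exI[of _ t] exI[of _ "[]"]) simp
next
  case True
  \<comment> \<open>Child 0 of a test node is available from the start and, because of its parent,
    is not a test node.\<close>
  then show ?thesis using assms by (intro exI[of _ "0 # t"] exI[of _ "[0]"]) simp
qed

text \<open>All children of \<open>u\<close> fall into the gap, so \<open>ex_child\<close> can fill
  it with any size. The critical case is a test node \<open>t\<close> with \<open>t'\<close> at or
  below its child \<open>v\<close>: if \<open>v\<close> is refuted, child \<open>Suc v\<close> has
  opened in between; otherwise child \<open>v\<close> itself belongs to the block of
  \<open>t\<close>, so \<open>t'\<close> is a proper descendant of it and there is room under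
  \<open>v\<close>.\<close>

lemma ex_between: assumes t: "avail t" "avail t'" "nlt t t'" "rep t \<noteq> rep t'"
  shows "\<exists>u. avail u \<and> \<not> tst u \<and> (\<forall>n. nlt t (n # u) \<and> nlt (n # u) t')"
proof -
  have *: "\<exists>u. avail u \<and> \<not> tst u \<and> (\<forall>n. nlt t (n # u) \<and> nlt (n # u) (ys @ a # zs @ t))"
    if "avail (zs @ t)" "\<not> tst (zs @ t)" for ys a zs
  proof (intro exI conjI allI)
    \<comment> \<open>The digit is odd, so this is no test node, and larger than \<open>a\<close>,
      so it comes earlier.\<close>
    let ?u = "(2 * a + 3) # zs @ t"
    show "avail ?u" "\<not> tst ?u" using that by auto
    show "nlt t (n # ?u)" for n using nlt_desc[of "n # (2 * a + 3) # zs" t] by simp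
    show "nlt (n # ?u) (ys @ a # zs @ t)" for n
      using nlt_branch[of a "2 * a + 3" "[n]" "zs @ t" ys] by simp
  qed
  from t(3)[unfolded nlt_iff] show ?thesis
  proof (elim disjE exE conjE)
    fix xs assume "xs \<noteq> []" and t': "t' = xs @ t"
    then obtain ys v where xs: "xs = ys @ [v]" by (metis rev_exhaust)
    have av: "avail (v # t)" using t(2) avail_append[of ys "v # t"] t' xs by simp
    show ?thesis
    proof (cases "tst t")
      case False
      then show ?thesis using *[of "[]" ys v] t(1) t' xs by simp
    next
      case True
      show ?thesis
      proof (cases "refuted t v")
        case True
        show ?thesis
        proof (intro exI conjI allI)
          let ?u = "Suc v # t"
          show "avail ?u" "\<not> tst ?u" using av True \<open>tst t\<close> by (auto simp: less_Suc_eq)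
          show "nlt t (n # ?u)" for n using nlt_desc[of "[n, Suc v]" t] by simp
          show "nlt (n # ?u) t'" for n using nlt_branch[of v "Suc v" "[n]" t ys] t' xs by simp
        qed
      next
        case False
        then have "ys \<noteq> []" using t(4) t' xs \<open>tst t\<close> tst_rep by auto
        then obtain zs a where "ys = zs @ [a]" by (metis rev_exhaust)
        then show ?thesis using *[of "[v]" zs a] av t' xs \<open>tst t\<close> by simp
      qed
    qed
  next
    fix xs ys q a b assume 1: "b < a" "t = xs @ a # q" "t' = ys @ b # q"
    obtain u zs where u: "avail u" "\<not> tst u" "u = zs @ t" using ex_above[OF t(1)] by blast
    have "nlt t (n # u)" for n using nlt_desc[of "n # zs" t] u by simp
    moreover have "nlt (n # u) t'" for n using nlt_branch[OF 1(1), of "n # zs @ xs" q ys] 1 u by simp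
    ultimately show ?thesis using u by blast
  qed
qed

lemma rep_convex: assumes a: "avail t1" "avail t2" "avail t3" and l: "nlt t1 t2" "nlt t2 t3" and r: "rep t1 = rep t3"
  shows "rep t2 = rep t1"
proof -
  define p where "p = rep t1"
  have l13: "nlt t1 t3" using l nlt_trans by blast
  have ne: "t1 \<noteq> t3" using l13 nlt_irrefl by blast
  have uniq: "v = v'" if "avail (v # p)" "avail (v' # p)" "\<not> refuted p v" "\<not> refuted p v'" "tst p" for v v'
    using that by (metis avail.simps(2) linorder_neqE_nat)
  obtain v where t: "t1 = p" "t3 = v # p" "tst p" "\<not> refuted p v"
  proof -
    from rep_cases[of t1] show ?thesis
    proof
      assume "rep t1 = t1"
      then show ?thesis using that rep_cases[of t3] ne r p_def by metis
    next
      assume "\<exists>v. t1 = v # rep t1 \<and> tst (rep t1) \<and> \<not> refuted (rep t1) v"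
      then obtain v where v: "t1 = v # p" "tst p" "\<not> refuted p v" unfolding p_def by blast
      from rep_cases[of t3] show ?thesis
      proof
        assume "rep t3 = t3"
        then have "t3 = p" using r p_def by simp
        then show ?thesis using l13 v nlt_child[of p v] nlt_asym by blast
      next
        assume "\<exists>v. t3 = v # rep t3 \<and> tst (rep t3) \<and> \<not> refuted (rep t3) v"
        then obtain v' where v': "t3 = v' # p" "\<not> refuted p v'" using r p_def by metis
        then show ?thesis using uniq[of v v'] v a ne by blast
      qed
    qed
  qed
  from l(1)[unfolded nlt_iff] show ?thesis
  proof (elim disjE exE conjE)
    fix xs assume "xs \<noteq> []" "t2 = xs @ t1"
    then obtain ys w where t2: "t2 = ys @ w # p" using t(1) by (metis rev_exhaust append.assoc append_Cons append_Nil)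
    have aw: "avail (w # p)" using a(2) t2 avail_append by blast
    consider "w < v" | "w = v" "ys = []" | "w = v" "ys \<noteq> []" | "v < w" by (meson linorder_neqE_nat)
    then show ?thesis
    proof cases
      case 1
      then show ?thesis using nlt_branch[of w v "[]" p ys] l(2) t2 t(2) nlt_asym by auto
    next
      case 2
      then show ?thesis using t2 t tst_rep by auto
    next
      case 3
      then show ?thesis using nlt_desc[of ys "v # p"] l(2) t2 t(2) nlt_asym by auto
    next
      case 4
      then show ?thesis using aw t by auto
    qed
  next
    fix xs ys q a b assume 1: "b < a" "t1 = xs @ a # q" "t2 = ys @ b # q"
    then show ?thesis using nlt_branch[OF 1(1), of "v # xs" q ys] l(2) t nlt_asym by auto
  qed
qed

text \<open>An unrefuted child raises the size of a test block to \<open>k + (m - k) = m\<close>,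
  and the nonempty blocks named by other nodes exceed \<open>k\<close>. So a block of size
  \<open>k\<close> certifies that its candidate has survived every counterexample.\<close>

lemma block_size: assumes t: "(t, j) \<in> Y"
  shows "finite (block yord (\<lambda>(t, j). rep t) (t, j)) \<and> card (block yord (\<lambda>(t, j). rep t) (t, j)) \<in> range N"
    and "card (block yord (\<lambda>(t, j). rep t) (t, j)) = k \<Longrightarrow> tst t \<and> (\<forall>v. refuted t v)"
proof -
  let ?b = "block yord (\<lambda>(t, j). rep t) (t, j)"
  define p where "p = rep t"
  have p: "avail p" "p \<noteq> []" "rep p = p"
  proof -
    have t': "avail t" "t \<noteq> []" using t by (auto simp: Y_def)
    from rep_cases[of t] show "avail p" "p \<noteq> []"
      unfolding p_def[symmetric] using t' by (metis avail.simps(2), metis tst.simps(1))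
    show "rep p = p" by (simp add: p_def)
  qed
  have b: "?b = {(t', j'). avail t' \<and> j' < bsize t' \<and> rep t' = p}"
    unfolding block_def Field_yord Y_def p_def by auto
  have card: "card (Pair x ` {..<n}) = n" for x :: "nat list" and n :: nat by (simp add: card_image inj_on_def)
  consider "tst p" "\<forall>v. refuted p v" | "tst p" "\<exists>v. \<not> refuted p v" | "\<not> tst p" by blast
  then have "finite ?b \<and> card ?b \<in> range N \<and> (card ?b = k \<longrightarrow> tst t \<and> (\<forall>v. refuted t v))"
  proof cases
    case 1
    have r: "rep t' = p \<longleftrightarrow> t' = p" for t' using rep_cases[of t'] 1(2) p(3) by metis
    then have "?b = Pair p ` {..<bsize p}" unfolding b r using p(1) by auto
    moreover have "bsize p = k" using 1 p by (cases p) auto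
    ultimately show ?thesis using k(1) r[of t] 1 p_def by (simp add: card)
  next
    case 2
    \<comment> \<open>All smaller children are refuted, so this one is available, and it bars all
      larger ones.\<close>
    define v where "v = (LEAST v. \<not> refuted p v)"
    have v: "\<not> refuted p v" unfolding v_def using LeastI_ex[OF 2(2)] .
    have v': "v' < v \<Longrightarrow> refuted p v'" for v' unfolding v_def using not_less_Least by blast
    have av: "avail (v # p)" using p v' by auto
    have un: "avail (w # p) \<Longrightarrow> \<not> refuted p w \<Longrightarrow> w = v" for w
      using v v' 2 by (metis avail.simps(2) linorder_neqE_nat)
    have rv: "rep (v # p) = p" using 2(1) v by simp
    have "avail t' \<and> rep t' = p \<longleftrightarrow> t' = p \<or> t' = v # p" for t'
    proof
      assume h: "avail t' \<and> rep t' = p"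
      from rep_cases[of t'] show "t' = p \<or> t' = v # p"
      proof
        assume "\<exists>w. t' = w # rep t' \<and> tst (rep t') \<and> \<not> refuted (rep t') w"
        then obtain w where "t' = w # p" "\<not> refuted p w" using h by auto
        then show ?thesis using un[of w] h by simp
      qed (use h in simp)
    next
      assume "t' = p \<or> t' = v # p"
      then show "avail t' \<and> rep t' = p" using av rv p(1,3) by blast
    qed
    then have b': "?b = {(t', j'). (t' = p \<or> t' = v # p) \<and> j' < bsize t'}" unfolding b by blast
    have bs: "bsize p = k" "bsize (v # p) = m - k"
      subgoal using 2(1) p(2) by (cases p) auto
      subgoal using 2(1) v by simp
      done
    have "{(t', j'). (t' = x \<or> t' = y) \<and> j' < f t'} = Pair x ` {..<f x} \<union> Pair y ` {..<f y}"
      for x y :: "nat list" and f :: "nat list \<Rightarrow> nat" by auto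
    from this[of p "v # p" bsize] have "?b = Pair p ` {..<k} \<union> Pair (v # p) ` {..<m - k}"
      unfolding b' bs .
    moreover have "Pair p ` {..<k} \<inter> Pair (v # p) ` {..<m - k} = {}" by auto
    ultimately have "finite ?b \<and> card ?b = m" using m(2) by (simp add: card_Un_disjoint card)
    then show ?thesis using m by simp
  next
    case 3
    then have r: "rep t' = p \<longleftrightarrow> t' = p" for t' using rep_cases[of t'] p(3) by metis
    have "?b = Pair p ` {..<bsize p}" unfolding b r using p(1) by auto
    moreover have "t = p" using r[of t] p_def by blast
    moreover have "0 < bsize p" using t \<open>t = p\<close> by (auto simp: Y_def)
    then have "bsize p \<in> range N \<and> bsize p \<noteq> k"
      using 3 p m by (cases p) (auto split: if_splits)
    ultimately show ?thesis by (simp add: card)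
  qed
  then show "finite ?b \<and> card ?b \<in> range N" "card ?b = k \<Longrightarrow> tst t \<and> (\<forall>v. refuted t v)" by auto
qed

lemma shuffle_map_yord: "shuffle_map (range N) yord (\<lambda>(t, j). rep t)"
proof -
  let ?\<pi> = "\<lambda>(t, j::nat). rep t"
  have c: "\<pi>y = \<pi>x" if "((t1, j1), (t2, j2)) \<in> yord" "((t2, j2), (t3, j3)) \<in> yord" "rep t1 = rep t3"
      "\<pi>y = rep t2" "\<pi>x = rep t1" for \<pi>y \<pi>x t1 j1 t2 j2 t3 j3
    using that rep_convex[of t1 t2 t3] unfolding yord_def Y_def by auto
  have d: "\<exists>z. ((t, j), z) \<in> yord \<and> (z, (t', j')) \<in> yord \<and> ?\<pi> z \<noteq> rep t \<and> ?\<pi> z \<noteq> rep t' \<and> card (block yord ?\<pi> z) = c"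
    if h: "c \<in> range N" "((t, j), (t', j')) \<in> yord" "rep t \<noteq> rep t'" for t j t' j' c
  proof -
    have h': "(t, j) \<in> Y" "(t', j') \<in> Y" "avail t" "avail t'" "nlt t t'" using h unfolding yord_def Y_def by auto
    from ex_between[OF h'(3-5) h(3)] obtain u where u: "avail u" "\<not> tst u" "\<And>n. nlt t (n # u)" "\<And>n. nlt (n # u) t'" by blast
    from ex_child[OF u(1,2) h(1)] obtain n where n: "(n # u, 0) \<in> Y" "card (block yord ?\<pi> (n # u, 0)) = c"
      "\<And>t'. rep t' = n # u \<Longrightarrow> t' = n # u" by blast
    have "rep (n # u) = n # u" using u by simp
    moreover have "rep t \<noteq> n # u" "rep t' \<noteq> n # u" using n(3) u(3,4) nlt_irrefl by metis+
    ultimately show ?thesis using n(1,2) u(3,4) h' by (intro exI[of _ "(n # u, 0)"]) (auto simp: yord_def simp del: rep.simps)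
  qed
  have ab: "\<exists>z. ((t, j), z) \<in> yord \<and> ?\<pi> z \<noteq> rep t \<and> card (block yord ?\<pi> z) = c"
    if h: "c \<in> range N" "(t, j) \<in> Y" for t j c
  proof -
    from h(2) have "avail t" by (simp add: Y_def)
    from ex_above[OF this] obtain u xs where u: "avail u" "\<not> tst u" "u = xs @ t" by blast
    from ex_child[OF u(1,2) h(1)] obtain n where n: "(n # u, 0) \<in> Y" "card (block yord ?\<pi> (n # u, 0)) = c"
      "\<And>t'. rep t' = n # u \<Longrightarrow> t' = n # u" by blast
    have l: "nlt t (n # u)" using nlt_desc[of "n # xs" t] u by simp
    have "rep (n # u) = n # u" using u by simp
    moreover have "rep t \<noteq> n # u" using n(3) l nlt_irrefl by metis
    ultimately show ?thesis using n(1,2) l h by (intro exI[of _ "(n # u, 0)"]) (auto simp: yord_def simp del: rep.simps)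
  qed
  have be: "\<exists>z. (z, (t, j)) \<in> yord \<and> ?\<pi> z \<noteq> rep t \<and> card (block yord ?\<pi> z) = c"
    if h: "c \<in> range N" "(t, j) \<in> Y" for t j c
  proof -
    from h(2) have "avail t" "t \<noteq> []" by (auto simp add: Y_def)
    then obtain xs a where t: "t = xs @ [a]" by (metis rev_exhaust)
    \<comment> \<open>\<open>a\<close> is the digit of \<open>t\<close> next to the root; a larger
      odd digit there precedes \<open>t\<close>.\<close>
    let ?u = "[2 * a + 3]"
    have u: "avail ?u" "\<not> tst ?u" by auto
    from ex_child[OF u h(1)] obtain n where n: "(n # ?u, 0) \<in> Y" "card (block yord ?\<pi> (n # ?u, 0)) = c"
      "\<And>t'. rep t' = n # ?u \<Longrightarrow> t' = n # ?u" by blast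
    have l: "nlt (n # ?u) t" using nlt_branch[of a "2 * a + 3" "[n]" "[]" xs] t by simp
    have "rep (n # ?u) = n # ?u" using u by simp
    moreover have "rep t \<noteq> n # ?u" using n(3) l nlt_irrefl by metis
    ultimately show ?thesis using n(1,2) l h by (intro exI[of _ "(n # ?u, 0)"]) (auto simp: yord_def simp del: rep.simps)
  qed
  have ne: "Y \<noteq> {}"
  proof -
    have "([0], 0) \<in> Y" using k by (simp add: Y_def)
    then show ?thesis by blast
  qed
  show ?thesis
    unfolding shuffle_map_def Field_yord
    apply (intro conjI)
    subgoal using Linear_order_yord by (simp add: Field_yord)
    subgoal by (rule ne)
    subgoal using block_size(1) by auto
    subgoal using c by fastforce
    subgoal using d by fastforce
    subgoal using ab by fastforce
    subgoal using be by fastforce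
    done
qed

end

section \<open>Primitive recursive presentation of the shuffle\<close>

lemma PR_tst [pr]: assumes "primf {} n f" shows "primf {} n (\<lambda>xs. of_bool (tst (list_decode (f xs))))"
proof -
  have "rec_list 0 (\<lambda>a l r. of_bool (even a \<and> r = 0)) l = (of_bool (tst l) :: nat)" for l
    by (induction l) auto
  moreover have "primf {} n (\<lambda>xs. rec_list 0 (\<lambda>a l r. of_bool (even a \<and> r = 0)) (list_decode (f xs)))"
    by (intro PR.rec_list pr assms) simp_all
  ultimately show ?thesis by simp
qed

lemma list_code_head_tail: "list_decode (ctl c) = tl (list_decode c)" "list_decode c \<noteq> [] \<Longrightarrow> chd c = hd (list_decode c)"
proof -
  have c: "c = list_encode (list_decode c)" by simp
  show "list_decode (ctl c) = tl (list_decode c)" by (metis c ctl_encode list_encode_inverse)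
  show "list_decode c \<noteq> [] \<Longrightarrow> chd c = hd (list_decode c)" by (metis c chd_encode)
qed

text \<open>Ancestors are suffixes, so the existential lists of \<open>nlt_iff\<close> become
  positions bounded by the lengths, and the order becomes primitive recursive.\<close>

lemma nlt_code: "nlt (list_decode a) (list_decode b) \<longleftrightarrow>
    (\<exists>i\<le>clen b. 0 < i \<and> cdrop i b = a) \<or>
    (\<exists>i<clen a. \<exists>j<clen b. ctl (cdrop i a) = ctl (cdrop j b) \<and> chd (cdrop j b) < chd (cdrop i a))"
proof -
  define s t where "s = list_decode a" and "t = list_decode b"
  have ab: "a = list_encode s" "b = list_encode t" by (simp_all add: s_def t_def)
  have 1: "(\<exists>xs. xs \<noteq> [] \<and> t = xs @ s) \<longleftrightarrow> (\<exists>i\<le>length t. 0 < i \<and> drop i t = s)"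
  proof
    assume "\<exists>xs. xs \<noteq> [] \<and> t = xs @ s"
    then obtain xs where "xs \<noteq> []" "t = xs @ s" by blast
    then show "\<exists>i\<le>length t. 0 < i \<and> drop i t = s" by (intro exI[of _ "length xs"]) simp
  next
    assume "\<exists>i\<le>length t. 0 < i \<and> drop i t = s"
    then obtain i where i: "i \<le> length t" "0 < i" "drop i t = s" by blast
    then show "\<exists>xs. xs \<noteq> [] \<and> t = xs @ s"
      by (intro exI[of _ "take i t"]) (auto simp flip: i(3))
  qed
  have drop_eq: "(\<exists>xs. t = xs @ a # q) \<longleftrightarrow> (\<exists>i<length t. drop i t = a # q)" for t :: "nat list" and a q
  proof
    assume "\<exists>xs. t = xs @ a # q"
    then obtain xs where "t = xs @ a # q" by blast
    then show "\<exists>i<length t. drop i t = a # q" by (intro exI[of _ "length xs"]) simp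
  next
    assume "\<exists>i<length t. drop i t = a # q"
    then obtain i where "drop i t = a # q" by blast
    then show "\<exists>xs. t = xs @ a # q" by (intro exI[of _ "take i t"]) (metis append_take_drop_id)
  qed
  have "(\<exists>xs ys q a b. b < a \<and> s = xs @ a # q \<and> t = ys @ b # q) \<longleftrightarrow>
     (\<exists>q a b. b < a \<and> (\<exists>xs. s = xs @ a # q) \<and> (\<exists>ys. t = ys @ b # q))" by blast
  also have "\<dots> \<longleftrightarrow> (\<exists>q a b. b < a \<and> (\<exists>i<length s. drop i s = a # q) \<and> (\<exists>j<length t. drop j t = b # q))"
    unfolding drop_eq ..
  also have "\<dots> \<longleftrightarrow> (\<exists>i<length s. \<exists>j<length t. tl (drop i s) = tl (drop j t) \<and> hd (drop j t) < hd (drop i s))"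
  proof
    assume "\<exists>q a b. b < a \<and> (\<exists>i<length s. drop i s = a # q) \<and> (\<exists>j<length t. drop j t = b # q)"
    then obtain q a b i j where *: "b < a" "i < length s" "drop i s = a # q" "j < length t" "drop j t = b # q" by blast
    show "\<exists>i<length s. \<exists>j<length t. tl (drop i s) = tl (drop j t) \<and> hd (drop j t) < hd (drop i s)"
      by (rule exI[of _ i], intro conjI *(2), rule exI[of _ j]) (simp add: * del: hd_drop_conv_nth)
  next
    assume "\<exists>i<length s. \<exists>j<length t. tl (drop i s) = tl (drop j t) \<and> hd (drop j t) < hd (drop i s)"
    then obtain i j where *: "i < length s" "j < length t" "tl (drop i s) = tl (drop j t)" "hd (drop j t) < hd (drop i s)" by blast
    then have "drop i s = hd (drop i s) # tl (drop i s)" "drop j t = hd (drop j t) # tl (drop i s)"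
      by (metis drop_eq_Nil list.collapse not_le)+
    then show "\<exists>q a b. b < a \<and> (\<exists>i<length s. drop i s = a # q) \<and> (\<exists>j<length t. drop j t = b # q)"
      using * by blast
  qed
  finally show ?thesis
    unfolding nlt_iff s_def[symmetric] t_def[symmetric] 1 unfolding ab
    by (simp add: list_encode_eq chd_encode tl_drop[symmetric] cong: conj_cong)
qed

lemma PR_nlt [pr]: assumes "primf {} n f" "primf {} n g"
  shows "primf {} n (\<lambda>xs. of_bool (nlt (list_decode (f xs)) (list_decode (g xs))))"
proof -
  have "primf {} 2 (\<lambda>xs. of_bool (nlt (list_decode (xs ! 0)) (list_decode (xs ! 1))))"
    unfolding nlt_code by (intro pr; simp)
  from PR.lift2[OF this assms] show ?thesis .
qed

text \<open>The next element has to be found by bounded search. An increasing primitive recursive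
  sequence inside the set dominates its enumeration and supplies the bound.\<close>

lemma enumerate_prim_rec:
  assumes X: "PRp 1 (\<lambda>xs. xs ! 0 \<in> X)" and a: "primf {} 1 (\<lambda>xs. a (xs ! 0))" "strict_mono a" "range a \<subseteq> X"
  shows "infinite X" "primf {} 1 (\<lambda>xs. enumerate X (xs ! 0))" "enumerate X n \<le> a n"
proof -
  show inf: "infinite X"
    using a(2,3) by (meson finite_subset range_inj_infinite strict_mono_imp_inj_on)
  have step: "enumerate X (Suc n) = (LEAST z. z \<in> X \<and> enumerate X n < z)" for n
    using enumerate_Suc''[OF inf] .
  have aX: "a n \<in> X" for n using a(3) by blast
  show le: "enumerate X n \<le> a n" for n
  proof (induction n)
    case 0
    then show ?case by (simp add: enumerate_0 Least_le aX)
  next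
    case (Suc n)
    have "a n < a (Suc n)" using a(2) by (simp add: strict_mono_less)
    then show ?case unfolding step using Suc aX by (intro Least_le) auto
  qed
  \<comment> \<open>The alternative \<open>z = a (Suc n)\<close> makes the bounded search succeed
    for every \<open>r\<close>. For \<open>r = enumerate X n\<close> that number is an element above
    \<open>r\<close> anyway, so the minimum is the intended one.\<close>
  let ?f = "\<lambda>n r. LEAST z. z \<in> X \<and> r < z \<or> z = a (Suc n)"
  have "rec_nat (enumerate X 0) ?f n = enumerate X n" for n
  proof (induction n)
    case (Suc n)
    have "enumerate X n < a (Suc n)" using le[of n] a(2) by (simp add: le_less_trans strict_mono_less)
    then have "?f n (enumerate X n) = (LEAST z. z \<in> X \<and> enumerate X n < z)" using aX by metis
    then show ?case using Suc step by simp
  qed simp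
  moreover have "primf {} 1 (\<lambda>xs. rec_nat (enumerate X 0) ?f (xs ! 0))"
    by (intro PR.rec PR.const pr PR.bounded_least[where b = "\<lambda>xs. a (Suc (xs ! 0))"] PR.lift1[OF a(1)]
        PR.lift1[OF X[unfolded PRp_def]]; simp?) auto
  ultimately show "primf {} 1 (\<lambda>xs. enumerate X (xs ! 0))" by simp
qed

text \<open>\<open>Z\<close> presents the sizes as enumerable from below: \<open>u\<close> witnesses
  that member \<open>i\<close> has more than \<open>j\<close> points.\<close>

locale pr_shuffle_constr = shuffle_constr +
  fixes Z :: "nat \<Rightarrow> nat \<Rightarrow> nat \<Rightarrow> bool"
  assumes Z: "\<And>i j. j < N i \<longleftrightarrow> (\<exists>u. Z i j u)"
    and Z_PR: "PRp 3 (\<lambda>xs. Z (xs ! 0) (xs ! 1) (xs ! 2))"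
    and P_PR: "PRp 4 (\<lambda>xs. P (xs ! 0) (xs ! 1) (xs ! 2) (xs ! 3))"
begin

text \<open>The approximations of \<open>avail\<close> and \<open>Y\<close> in which all witnesses are below \<open>s\<close>.\<close>

fun avail_at :: "nat \<Rightarrow> nat list \<Rightarrow> bool" where
  "avail_at s [] = True"
| "avail_at s (v # q) = (avail_at s q \<and> (tst q \<longrightarrow> (\<forall>v'<v. \<exists>w<s. refu q v' w)))"

definition in_at :: "nat list \<Rightarrow> nat \<Rightarrow> nat \<Rightarrow> bool" where
  "in_at t j s \<longleftrightarrow> t \<noteq> [] \<and> avail_at s t \<and>
    (if tst t then j < k
     else if tst (tl t) then j < m - k \<or> j < m \<and> (\<exists>w<s. refu (tl t) (hd t) w)
     else (\<exists>u<s. Z (hd t div 2) k u) \<and> (\<exists>u<s. Z (hd t div 2) j u))"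

text \<open>Recording the first stage at which a point shows turns the enumerable set
  \<open>Y\<close> into a primitive recursive set with exactly one code for each point.\<close>

definition X :: "nat set" where
  "X = {c. in_at (list_decode (p1 c)) (p1 (p2 c)) (p2 (p2 c)) \<and>
    (\<forall>s<p2 (p2 c). \<not> in_at (list_decode (p1 c)) (p1 (p2 c)) s)}"

definition dec :: "nat \<Rightarrow> nat list \<times> nat" where
  "dec c = (list_decode (p1 c), p1 (p2 c))"

lemma bounded_witness: "(\<forall>i<n. \<exists>w. Q i w) \<Longrightarrow> \<exists>s. \<forall>i<n. \<exists>w<s. Q i w" for n :: nat and Q :: "nat \<Rightarrow> nat \<Rightarrow> bool"
proof (induction n)
  case (Suc n)
  then obtain s w where "\<forall>i<n. \<exists>w<s. Q i w" "Q n w" by auto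
  then show ?case
    by (intro exI[of _ "max s (Suc w)"]) (metis less_SucE less_max_iff_disj lessI)
qed simp

lemma avail_at_mono: "avail_at s t \<Longrightarrow> s \<le> s' \<Longrightarrow> avail_at s' t"
  by (induction t) (auto, meson less_le_trans)

lemma avail_iff: "avail t \<longleftrightarrow> (\<exists>s. avail_at s t)"
proof (induction t)
  case (Cons v q)
  show ?case
  proof
    assume a: "avail (v # q)"
    then obtain s where s: "avail_at s q" using Cons by auto
    show "\<exists>s. avail_at s (v # q)"
    proof (cases "tst q")
      case True
      then obtain s' where "\<forall>v'<v. \<exists>w<s'. refu q v' w"
        using a bounded_witness[of v "refu q"] by (auto simp: refuted_def)
      then show ?thesis using avail_at_mono[OF s, of "max s s'"]
        by (intro exI[of _ "max s s'"]) (auto simp: less_max_iff_disj)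
    qed (use s in auto)
  qed (use Cons in \<open>auto simp: refuted_def\<close>)
qed simp

text \<open>All conditions are monotone in the stage, so the finitely many witnesses for a point fit
  under one \<open>s\<close>.\<close>

lemma ex_in_at: "(\<exists>s. in_at t j s) \<longleftrightarrow> (t, j) \<in> Y"
proof (cases t)
  case Nil
  then show ?thesis by (simp add: in_at_def Y_def)
next
  case (Cons n q)
  let ?b = "\<lambda>s. if tst t then j < k
     else if tst q then j < m - k \<or> j < m \<and> (\<exists>w<s. refu q n w)
     else (\<exists>u<s. Z (n div 2) k u) \<and> (\<exists>u<s. Z (n div 2) j u)"
  have b: "in_at t j s \<longleftrightarrow> avail_at s t \<and> ?b s" for s
    unfolding in_at_def Cons by simp
  have mono: "?b s \<Longrightarrow> s \<le> s' \<Longrightarrow> ?b s'" for s s'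
    by (auto split: if_splits) (meson less_le_trans)+
  have "(\<exists>s. in_at t j s) \<longleftrightarrow> (\<exists>s. avail_at s t) \<and> (\<exists>s. ?b s)"
  proof
    assume "(\<exists>s. avail_at s t) \<and> (\<exists>s. ?b s)"
    then obtain s s' where s: "avail_at s t" "?b s'" by blast
    then have "in_at t j (max s s')"
      unfolding b using avail_at_mono[OF s(1), of "max s s'"] mono[OF s(2), of "max s s'"] by simp
    then show "\<exists>s. in_at t j s" ..
  next
    assume "\<exists>s. in_at t j s"
    then show "(\<exists>s. avail_at s t) \<and> (\<exists>s. ?b s)" unfolding b by blast
  qed
  also have "(\<exists>s. ?b s) \<longleftrightarrow> j < bsize t"
  proof (cases "tst t \<or> tst q")
    case True
    then show ?thesis using Cons m by (auto simp: refuted_def intro: lessI)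
  next
    case False
    have "(\<exists>s. ?b s) \<longleftrightarrow> (\<exists>u. Z (n div 2) k u) \<and> (\<exists>u. Z (n div 2) j u)"
    proof
      assume "(\<exists>u. Z (n div 2) k u) \<and> (\<exists>u. Z (n div 2) j u)"
      then obtain u u' where "Z (n div 2) k u" "Z (n div 2) j u'" by blast
      moreover have "u < Suc (max u u')" "u' < Suc (max u u')" by auto
      ultimately show "\<exists>s. ?b s" using False by (intro exI[of _ "Suc (max u u')"]) metis
    qed (use False in auto)
    then show ?thesis using False Cons by (auto simp flip: Z)
  qed
  finally show ?thesis by (simp add: Y_def avail_iff)
qed

lemma bij_dec: "bij_betw dec X Y"
  unfolding bij_betw_def
proof
  show "inj_on dec X"
  proof (rule inj_onI)
    fix c d assume "c \<in> X" "d \<in> X" "dec c = dec d"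
    then have "p1 c = p1 d" "p1 (p2 c) = p1 (p2 d)" "p2 (p2 c) = p2 (p2 d)"
      unfolding dec_def X_def by (auto simp: list_decode_eq) (meson linorder_neqE_nat)
    then show "c = d" by (metis p_simps(3))
  qed
  show "dec ` X = Y"
  proof (intro equalityI subsetI)
    fix y assume "y \<in> dec ` X"
    then show "y \<in> Y" unfolding dec_def X_def using ex_in_at by auto
  next
    fix y assume y: "y \<in> Y"
    obtain t j where tj: "y = (t, j)" by fastforce
    then have ex: "\<exists>s. in_at t j s" using y ex_in_at by simp
    define s where "s = (LEAST s. in_at t j s)"
    have "prod_encode (list_encode t, prod_encode (j, s)) \<in> X"
      unfolding X_def s_def using LeastI_ex[OF ex] not_less_Least by auto
    moreover have "dec (prod_encode (list_encode t, prod_encode (j, s))) = y" by (simp add: dec_def tj)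
    ultimately show "y \<in> dec ` X" by force
  qed
qed

lemma PR_Z: "primf {} n a \<Longrightarrow> primf {} n b \<Longrightarrow> primf {} n c \<Longrightarrow> primf {} n (\<lambda>xs. of_bool (Z (a xs) (b xs) (c xs)))"
  by (rule PR.lift3[OF Z_PR[unfolded PRp_def]])

text \<open>The guard excludes the empty list, on which \<open>hd\<close> and \<open>chd\<close>
  need not agree.\<close>

lemma PR_refu: assumes "primf {} n a" "primf {} n b" "primf {} n c"
  shows "primf {} n (\<lambda>xs. of_bool (tst (list_decode (a xs)) \<longrightarrow> refu (list_decode (a xs)) (b xs) (c xs)))"
proof -
  have *: "(tst (list_decode a) \<longrightarrow> refu (list_decode a) b c) \<longleftrightarrow> (tst (list_decode a) \<longrightarrow> P (ctl a) (chd a div 2) b c)"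
    for a b c
  proof (cases "list_decode a = []")
    case False
    then have "chd a = hd (list_decode a)" "list_encode (tl (list_decode a)) = ctl a"
      using list_code_head_tail[of a] by (auto simp flip: list_code_head_tail)
    then show ?thesis by (simp add: refu_def)
  qed simp
  show ?thesis unfolding * by (intro pr assms PR.lift4[OF P_PR[unfolded PRp_def]])
qed

lemma PR_avail_at: assumes "primf {} n a" "primf {} n b"
  shows "primf {} n (\<lambda>xs. of_bool (avail_at (a xs) (list_decode (b xs))))"
proof -
  let ?h = "\<lambda>v c r s. of_bool (r = 1 \<and> (tst (list_decode c) \<longrightarrow>
    (\<forall>v'<v. \<exists>w<s. tst (list_decode c) \<longrightarrow> refu (list_decode c) v' w))) :: nat"
  have "rec_list 1 (\<lambda>v l r. ?h v (list_encode l) r s) t = (of_bool (avail_at s t) :: nat)" for s t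
    by (induction t) auto
  moreover have "primf {} 2 (\<lambda>xs. rec_list 1 (\<lambda>v l r. ?h v (list_encode l) r (xs ! 0)) (list_decode (xs ! 1)))"
    by (intro PR.rec_list pr PR_refu; simp)
  ultimately have "primf {} 2 (\<lambda>xs. of_bool (avail_at (xs ! 0) (list_decode (xs ! 1))))" by simp
  from PR.lift2[OF this assms] show ?thesis .
qed

lemma PR_in_at: assumes "primf {} n a" "primf {} n b" "primf {} n c"
  shows "primf {} n (\<lambda>xs. of_bool (in_at (list_decode (a xs)) (b xs) (c xs)))"
proof -
  have *: "in_at (list_decode t) j s \<longleftrightarrow> t \<noteq> 0 \<and> avail_at s (list_decode t) \<and>
    (if tst (list_decode t) then j < k
     else if tst (list_decode (ctl t)) then j < m - k \<or> j < m \<and>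
       (\<exists>w<s. tst (list_decode (ctl t)) \<longrightarrow> refu (list_decode (ctl t)) (chd t) w)
     else (\<exists>u<s. Z (chd t div 2) k u) \<and> (\<exists>u<s. Z (chd t div 2) j u))" for t j s
  proof (cases "list_decode t = []")
    case True
    then have "t = 0" by (metis list_decode_inverse list_encode.simps(1))
    then show ?thesis by (simp add: in_at_def)
  next
    case False
    then have "t \<noteq> 0" by (metis list_decode.simps(1))
    then show ?thesis by (simp add: in_at_def False list_code_head_tail)
  qed
  have "primf {} 3 (\<lambda>xs. of_bool (in_at (list_decode (xs ! 0)) (xs ! 1) (xs ! 2)))"
    unfolding * by (intro pr PR_refu PR_avail_at PR_Z PR.const; simp)
  from PR.lift3[OF this assms] show ?thesis .
qed

lemma PR_X: "PRp 1 (\<lambda>xs. xs ! 0 \<in> X)"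
  unfolding PRp_def X_def mem_Collect_eq by (intro pr PR_in_at; simp)

text \<open>First points of the test nodes directly below the root, present from stage 0. They are
  the sequence required by \<open>enumerate_prim_rec\<close> and, for trivial \<open>P\<close>, also
  the known sequence of small blocks.\<close>

definition seed :: "nat \<Rightarrow> nat" where
  "seed n = prod_encode (list_encode [2 * n], prod_encode (0, 0))"

lemma prod_encode_less: "a < b \<Longrightarrow> prod_encode (a, c) < prod_encode (b, c)"
proof -
  assume "a < b"
  moreover have "triangle x \<le> triangle y" if "x \<le> y" for x y
    using that by (induction rule: dec_induct) auto
  ultimately show ?thesis unfolding prod_encode_def by (simp add: add_le_less_mono)
qed

lemma PR_seed: "primf {} 1 (\<lambda>xs. seed (xs ! 0))"
  unfolding seed_def by (simp, intro pr; simp)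

lemma strict_mono_seed: "strict_mono seed"
  unfolding seed_def by (rule strict_monoI) (simp add: prod_encode_less)

lemma in_at_seed: "in_at [2 * n] 0 0"
  unfolding in_at_def using k by simp

lemma seed_X: "seed n \<in> X"
  unfolding X_def seed_def using in_at_seed by simp

lemma dec_seed: "dec (seed n) = ([2 * n], 0)"
  by (simp add: dec_def seed_def)

section \<open>The punctual copy and its small blocks\<close>

definition el :: "nat \<Rightarrow> nat list \<times> nat" where
  "el n = dec (enumerate X n)"

lemma inf_X: "infinite X"
  by (rule enumerate_prim_rec(1)[OF PR_X PR_seed strict_mono_seed]) (auto simp: seed_X)

lemma PR_enum: "primf {} n a \<Longrightarrow> primf {} n (\<lambda>xs. enumerate X (a xs))"
  by (rule PR.lift1, rule enumerate_prim_rec(2)[OF PR_X PR_seed strict_mono_seed]) (auto simp: seed_X)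

lemma bij_el: "bij_betw el UNIV Y"
  using bij_betw_trans[OF bij_enumerate[OF inf_X] bij_dec] unfolding el_def comp_def .

lemma el_Y: "el n \<in> Y"
  using bij_el bij_betwE by blast

definition B :: "nat rel" where
  "B = {(x, y). (el x, el y) \<in> yord}"

lemma Field_B: "Field B = UNIV"
proof -
  have "(x, x) \<in> B" for x
    unfolding B_def yord_def using el_Y[of x] by (auto split: prod.splits)
  then show ?thesis unfolding Field_def by blast
qed

lemma iso_B: "iso B yord el"
  unfolding iso_iff2 Field_B Field_yord using bij_el by (auto simp: B_def)

lemma lin_B: "linear_order_on UNIV B"
  using iso_Linear_order[OF iso_B Linear_order_yord] by (simp add: Field_B)

definition bl :: "nat \<Rightarrow> nat list" where
  "bl x = rep (fst (el x))"

lemma shuf_B: "shuf (range N) B bl"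
proof
  have "shuffle_map (range N) B (\<lambda>x. case el x of (t, j) \<Rightarrow> rep t)"
    by (rule shuffle_map_iso[OF shuffle_map_yord iso_B])
  then show "shuffle_map (range N) B bl" unfolding bl_def by (simp add: case_prod_beta)
  show "Field B = UNIV" by (rule Field_B)
qed

lemma punctual_B: "punctual B"
proof -
  have "(x, y) \<in> B \<longleftrightarrow> nlt (fst (el x)) (fst (el y)) \<or> fst (el x) = fst (el y) \<and> snd (el x) \<le> snd (el y)" for x y
    unfolding B_def yord_def using el_Y[of x] el_Y[of y] by (auto split: prod.splits)
  then have *: "(x, y) \<in> B \<longleftrightarrow> nlt (list_decode (p1 (enumerate X x))) (list_decode (p1 (enumerate X y))) \<or>
     p1 (enumerate X x) = p1 (enumerate X y) \<and> p1 (p2 (enumerate X x)) \<le> p1 (p2 (enumerate X y))" for x y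
    by (simp add: el_def dec_def list_decode_eq)
  have "primf {} 2 (\<lambda>xs. of_bool ((xs ! 0, xs ! 1) \<in> B))"
    unfolding * by (intro pr PR_enum; simp)
  then show ?thesis
    using lin_B unfolding punctual_def prim_rec_pred_def ext_closure_def of_bool_def by metis
qed

lemma block_B: "card (block B bl x) = card (block yord (\<lambda>(t, j). rep t) (el x))"
proof (rule bij_betw_same_card[of el])
  have "block yord (\<lambda>(t, j). rep t) (el x) = {y \<in> Y. rep (fst y) = bl x}"
    unfolding block_def Field_yord bl_def by (auto split: prod.splits)
  moreover have "block B bl x = {y. rep (fst (el y)) = bl x}"
    unfolding block_def Field_B bl_def by auto
  moreover have "el ` {y. rep (fst (el y)) = bl x} = {y \<in> range el. rep (fst y) = bl x}" by auto
  ultimately show "bij_betw el (block B bl x) (block yord (\<lambda>(t, j). rep t) (el x))"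
    using bij_el unfolding bij_betw_def by (auto intro: inj_on_subset)
qed

text \<open>The two counts add up to block size \<open>k\<close>, and by \<open>block_size\<close>
  such a block sits on a test node with a correct candidate.\<close>

lemma first_of_small: assumes "nright (B\<inverse>) x = 0" "nright B x = k - 1"
  shows "tst (fst (el x))" "\<And>v. refuted (fst (el x)) v" "bl x = fst (el x)"
proof -
  interpret B: shuf "range N" B bl by (rule shuf_B)
  obtain t j where tj: "el x = (t, j)" by fastforce
  have "card (block B bl x) = k" using B.card_split[of x] assms k(3) by simp
  then have "card (block yord (\<lambda>(t, j). rep t) (t, j)) = k" unfolding block_B tj .
  from block_size(2)[OF _ this] el_Y[of x] tj
  show "tst (fst (el x))" "\<And>v. refuted (fst (el x)) v" by auto
  then show "bl x = fst (el x)" unfolding bl_def by (simp add: tst_rep)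
qed

definition idx :: "nat \<Rightarrow> nat" where
  "idx n = (LEAST i. enumerate X i = seed n)"

lemma enum_idx: "enumerate X (idx n) = seed n"
proof -
  have "\<exists>i. enumerate X i = seed n" using seed_X range_enumerate[OF inf_X] by (metis imageE)
  then show ?thesis unfolding idx_def by (rule LeastI_ex)
qed

lemma el_idx: "el (idx n) = ([2 * n], 0)"
  by (simp add: el_def enum_idx dec_seed)

text \<open>An element of an increasing enumeration occurs at a position not exceeding its value, so
  \<open>seed\<close> bounds the search.\<close>

lemma PR_idx: "primf {} 1 (\<lambda>xs. idx (xs ! 0))"
  unfolding idx_def
proof (rule PR.bounded_least[where b = "\<lambda>xs. seed (xs ! 0)"])
  fix xs :: "nat list"
  show "\<exists>i\<le>seed (xs ! 0). enumerate X i = seed (xs ! 0)"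
    using enum_idx[of "xs ! 0"] le_enumerate[OF inf_X, of "idx (xs ! 0)"] by metis
qed (intro pr PR_enum PR.lift1[OF PR_seed] PR_seed; simp)+

text \<open>With all children refuted nothing merges into \<open>[2 * n]\<close>, so the block
  consists of the \<open>k\<close> points of that node, the seed being the first.\<close>

lemma small_idx: assumes "\<And>v. refuted [2 * n] v"
  shows "nright (B\<inverse>) (idx n) = 0" "nright B (idx n) = k - 1"
proof -
  interpret B: shuf "range N" B bl by (rule shuf_B)
  have r: "t' = [2 * n]" if "rep t' = [2 * n]" for t'
    using rep_cases[of t'] assms that by auto
  have bl: "bl (idx n) = [2 * n]" by (simp add: bl_def el_idx)
  have inj: "inj el" using bij_el by (simp add: bij_betw_def)
  have "B.below (idx n) = {}"
  proof -
    have "y = idx n" if "bl y = bl (idx n)" "(y, idx n) \<in> B" for y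
    proof -
      have "fst (el y) = [2 * n]" using that(1) bl r[of "fst (el y)"] by (simp add: bl_def)
      moreover have "(el y, ([2 * n], 0)) \<in> yord" using that(2) by (simp add: B_def el_idx)
      ultimately have "el y = el (idx n)" unfolding el_idx yord_def by (cases "el y") (auto simp: nlt_irrefl)
      then show ?thesis using inj by (simp add: inj_eq)
    qed
    then show ?thesis unfolding B.below_def by (auto simp: B.mem_block)
  qed
  then show 1: "nright (B\<inverse>) (idx n) = 0" by (simp add: B.nleft_eq)
  have "card (block B bl (idx n)) = k"
    unfolding block_B el_idx by (subst block_single) (use r in \<open>auto simp: card_image inj_on_def\<close>)
  then show "nright B (idx n) = k - 1" using B.card_split[of "idx n"] 1 by simp
qed

end

section \<open>Isomorphisms and shuffles of a family\<close>

lemma Field_pullback: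
  assumes "Linear_order s" "bij_betw b A (Field s)"
  shows "Field {(x, y). x \<in> A \<and> y \<in> A \<and> (b x, b y) \<in> s} = A"
    and "iso {(x, y). x \<in> A \<and> y \<in> A \<and> (b x, b y) \<in> s} s b"
proof -
  have "(b x, b x) \<in> s" if "x \<in> A" for x
    using assms that unfolding order_on_defs refl_on_def bij_betw_def by blast
  then show F: "Field {(x, y). x \<in> A \<and> y \<in> A \<and> (b x, b y) \<in> s} = A"
    unfolding Field_def by blast
  show "iso {(x, y). x \<in> A \<and> y \<in> A \<and> (b x, b y) \<in> s} s b"
    unfolding iso_iff2 F using assms(2) by auto
qed

lemma finite_Well_order: assumes "Linear_order r" "finite (Field r)" shows "Well_order r"
proof -
  have r: "trans r" "antisym r" "r \<subseteq> Field r \<times> Field r" using assms(1) unfolding order_on_defs by auto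
  then have "trans (r - Id)" by (simp add: trans_diff_Id)
  then have "acyclic (r - Id)" by (simp add: acyclic_def trancl_id)
  moreover have "finite (r - Id)"
    by (rule finite_subset[of _ "Field r \<times> Field r"]) (use r(3) assms(2) in auto)
  ultimately show ?thesis using assms(1) unfolding well_order_on_def by (simp add: finite_acyclic_wf)
qed

text \<open>Two well-orders on one finite set are isomorphic; pulling \<open>s\<close> back along a
  bijection puts both orders on \<open>Field r\<close>.\<close>

lemma finite_isomorphic:
  assumes "Linear_order r" "Linear_order s" "finite (Field r)" "finite (Field s)" "card (Field r) = card (Field s)"
  shows "isomorphic r s"
proof -
  obtain b where b: "bij_betw b (Field r) (Field s)"
    using assms(3-5) finite_same_card_bij by blast
  let ?r' = "{(x, y). x \<in> Field r \<and> y \<in> Field r \<and> (b x, b y) \<in> s}"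
  note F = Field_pullback[OF assms(2) b]
  have "Well_order ?r'"
    by (rule finite_Well_order[OF iso_Linear_order[OF F(2) assms(2)]]) (simp only: F(1) assms(3))
  then have "well_order_on (Field r) ?r'" unfolding F(1) .
  then have "(r, ?r') \<in> ordIso"
    by (rule finite_well_order_on_ordIso[OF assms(3) finite_Well_order[OF assms(1,3)]])
  then obtain f where "iso r ?r' f" unfolding ordIso_def by blast
  then show ?thesis using comp_iso[OF _ F(2)] unfolding isomorphic_def by blast
qed

lemma isomorphic_card: "isomorphic r s \<Longrightarrow> card (Field r) = card (Field s)"
  unfolding isomorphic_def iso_iff2 by (auto intro: bij_betw_same_card)

lemma isomorphic_sym: assumes "isomorphic r s" shows "isomorphic s r"
proof -
  from assms obtain f where f: "bij_betw f (Field r) (Field s)"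
    "\<And>a b. a \<in> Field r \<Longrightarrow> b \<in> Field r \<Longrightarrow> (a, b) \<in> r \<longleftrightarrow> (f a, f b) \<in> s"
    unfolding isomorphic_def iso_iff2 by blast
  let ?g = "inv_into (Field r) f"
  have "?g a \<in> Field r" "f (?g a) = a" if "a \<in> Field s" for a
    using that f(1) by (simp_all add: bij_betw_def f_inv_into_f inv_into_into)
  then have "iso s r ?g" unfolding iso_iff2 using f bij_betw_inv_into by metis
  then show ?thesis unfolding isomorphic_def by blast
qed

lemma isomorphic_trans: "isomorphic r s \<Longrightarrow> isomorphic s t \<Longrightarrow> isomorphic r t"
  unfolding isomorphic_def using comp_iso by blast

text \<open>A reduced fraction with denominator \<open>2 ^ e\<close> is labelled by the second
  component of \<open>e\<close>. Every number is the second component of arbitrarily large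
  \<open>e\<close>, so each label is dense. Other denominators get an unspecified label.\<close>

definition label :: "rat \<Rightarrow> nat" where
  "label q = p2 (THE e. snd (quotient_of q) = 2 ^ e)"

lemma label_dense: assumes "p < q" shows "\<exists>r. p < r \<and> r < q \<and> label r = i"
proof -
  obtain n where n: "2 / (q - p) < 2 ^ n"
    using real_arch_pow[of 2 "real_of_rat (2 / (q - p))"]
    by (auto simp flip: of_rat_less[where 'a = real] simp: of_rat_power)
  define e where "e = prod_encode (n, i)"
  have "n \<le> e" unfolding e_def by (rule le_prod_encode_1)
  then have "(2::rat) ^ n \<le> 2 ^ e" by simp
  with n have "2 / (q - p) < 2 ^ e" by (rule less_le_trans)
  then have e: "2 < (q - p) * 2 ^ e" using assms by (simp add: pos_divide_less_eq mult.commute)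
  \<comment> \<open>One of the next two integers above \<open>p * 2 ^ e\<close> is odd and so gives
    a reduced fraction; it stays below \<open>q * 2 ^ e\<close> because the scaled interval is
    longer than 2.\<close>
  define a0 where "a0 = \<lfloor>p * 2 ^ e\<rfloor> + 1"
  define a where "a = (if odd a0 then a0 else a0 + 1)"
  have a: "odd a" "a0 \<le> a" "a \<le> a0 + 1" unfolding a_def by auto
  have "p * 2 ^ e < of_int a0" "of_int a0 \<le> p * 2 ^ e + 1" unfolding a0_def by linarith+
  then have l: "p * 2 ^ e < of_int a" "of_int a < q * 2 ^ e"
    using a e by (simp_all add: algebra_simps)
  let ?r = "Fract a (2 ^ e)"
  have r: "?r = of_int a / 2 ^ e" by (simp add: Fract_of_int_quotient)
  have "coprime a (2 ^ e)" using a by simp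
  then have "quotient_of ?r = (a, 2 ^ e)" by (simp add: quotient_of_Fract)
  then have "label ?r = i" unfolding label_def by (simp add: e_def the_equality)
  moreover have "p < ?r" "?r < q" unfolding r using l by (simp_all add: field_simps)
  ultimately show ?thesis by blast
qed

lemma Shuffle_nonempty: fixes F :: "nat \<Rightarrow> 'a rel" shows "\<exists>L. L \<in> Shuffle F"
proof -
  have refl: "isomorphic r r" for r :: "'a rel"
    unfolding isomorphic_def iso_iff2 by (intro exI[of _ id]) auto
  have "rat_sum (\<lambda>q. F (label q)) \<in> Shuffle F"
    unfolding Shuffle_def using label_dense refl by (intro CollectI exI[of _ "\<lambda>q. F (label q)"]) metis
  then show ?thesis by blast
qed

lemma Shuffle_shuffle_map:
  fixes F :: "'i \<Rightarrow> 'a rel"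
  assumes F: "\<And>i. Linear_order (F i)" "\<And>i. finite (Field (F i))" "\<And>i. Field (F i) \<noteq> {}"
    and L: "L \<in> Shuffle F"
  shows "shuffle_map (range (\<lambda>i. card (Field (F i)))) L fst"
proof -
  from L obtain G where L: "L = rat_sum G" and G: "\<And>q. \<exists>i. isomorphic (G q) (F i)"
    "\<And>p q i. p < q \<Longrightarrow> \<exists>r. p < r \<and> r < q \<and> isomorphic (G r) (F i)" unfolding Shuffle_def by blast
  have GL: "Linear_order (G q)" for q
    using G(1)[of q] iso_Linear_order F(1) unfolding isomorphic_def by metis
  have GF: "finite (Field (G q)) \<and> Field (G q) \<noteq> {} \<and> card (Field (G q)) \<in> range (\<lambda>i. card (Field (F i)))" for q
  proof -
    obtain i where i: "isomorphic (G q) (F i)" using G by blast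
    then have "card (Field (G q)) = card (Field (F i))" by (rule isomorphic_card)
    moreover have "card (Field (F i)) \<noteq> 0" using F by simp
    ultimately show ?thesis by (auto simp: card_eq_0_iff intro: ccontr)
  qed
  have g: "refl_on (Field (G q)) (G q)" "trans (G q)" "antisym (G q)" "total_on (Field (G q)) (G q)" for q
    using GL[of q] unfolding order_on_defs by auto
  have mem: "((p, x), (q, y)) \<in> L \<longleftrightarrow> x \<in> Field (G p) \<and> y \<in> Field (G q) \<and> (p < q \<or> p = q \<and> (x, y) \<in> G p)" for p x q y
    unfolding L rat_sum_def by auto
  have Fld: "Field L = {(q, x). x \<in> Field (G q)}"
  proof (intro equalityI subsetI)
    fix z assume "z \<in> Field L"
    then show "z \<in> {(q, x). x \<in> Field (G q)}" unfolding Field_def L rat_sum_def by auto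
  next
    fix z assume "z \<in> {(q, x). x \<in> Field (G q)}"
    then have "(z, z) \<in> L" using g(1) by (auto simp: mem refl_on_def)
    then show "z \<in> Field L" unfolding Field_def by blast
  qed
  have lin: "Linear_order L"
    unfolding order_on_defs
  proof (intro conjI)
    show "L \<subseteq> Field L \<times> Field L" by (auto simp: Field_def)
    show "refl_on (Field L) L" unfolding refl_on_def Fld using g(1) by (auto simp: mem refl_on_def)
    show "trans L" unfolding trans_def using g(2) by (auto simp: mem trans_def)
    show "antisym L" unfolding antisym_def using g(3) by (auto simp: mem antisym_def)
    show "total_on (Field L) L" unfolding total_on_def Fld using g(4) by (auto simp: mem total_on_def) blast
  qed
  have blk: "block L fst (q, x) = Pair q ` Field (G q)" for q and x :: 'a
    unfolding block_def Fld by auto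
  have blk: "finite (block L fst (q, x))" "card (block L fst (q, x)) = card (Field (G q))" for q and x :: 'a
    using GF[of q] by (simp_all add: blk card_image inj_on_def)
  have dense: "\<exists>r x. p < r \<and> r < q \<and> x \<in> Field (G r) \<and> card (Field (G r)) = c"
    if h: "p < q" "c \<in> range (\<lambda>i. card (Field (F i)))" for p q c
  proof -
    obtain i where i: "c = card (Field (F i))" using h(2) by blast
    obtain r where r: "p < r" "r < q" "isomorphic (G r) (F i)" using G(2)[OF h(1)] by blast
    then have "card (Field (G r)) = c" using isomorphic_card i by blast
    then show ?thesis using r GF[of r] by (auto simp: ex_in_conv)
  qed
  show ?thesis
    unfolding shuffle_map_def
  proof (intro conjI ballI allI impI lin)
    show "Field L \<noteq> {}" using GF unfolding Fld by (simp add: ex_in_conv)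
  next
    fix z assume "z \<in> Field L"
    then show "finite (block L fst z)" "card (block L fst z) \<in> range (\<lambda>i. card (Field (F i)))"
      using blk GF by (cases z; simp)+
  next
    fix x y z :: "rat \<times> 'a" assume "(x, y) \<in> L \<and> (y, z) \<in> L \<and> fst x = fst z"
    then show "fst y = fst x" by (cases x; cases y; cases z) (auto simp: mem)
  next
    fix x y :: "rat \<times> 'a" and c assume c: "c \<in> range (\<lambda>i. card (Field (F i)))" and "(x, y) \<in> L \<and> fst x \<noteq> fst y"
    then obtain p a q b where *: "x = (p, a)" "y = (q, b)" "p < q" "a \<in> Field (G p)" "b \<in> Field (G q)"
      by (cases x; cases y) (auto simp: mem)
    from dense[OF *(3) c] obtain r d where "p < r" "r < q" "d \<in> Field (G r)" "card (Field (G r)) = c" by blast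
    then show "\<exists>z. (x, z) \<in> L \<and> (z, y) \<in> L \<and> fst z \<noteq> fst x \<and> fst z \<noteq> fst y \<and> card (block L fst z) = c"
      using * by (intro exI[of _ "(r, d)"]) (simp add: mem blk)
  next
    fix x :: "rat \<times> 'a" and c assume c: "c \<in> range (\<lambda>i. card (Field (F i)))" and "x \<in> Field L"
    then obtain p a where *: "x = (p, a)" "a \<in> Field (G p)" unfolding Fld by auto
    from dense[OF _ c, of p "p + 1"] obtain r d where "p < r" "d \<in> Field (G r)" "card (Field (G r)) = c" by auto
    then show "\<exists>z. (x, z) \<in> L \<and> fst z \<noteq> fst x \<and> card (block L fst z) = c"
      using * by (intro exI[of _ "(r, d)"]) (simp add: mem blk)
    from dense[OF _ c, of "p - 1" p] obtain r d where "r < p" "d \<in> Field (G r)" "card (Field (G r)) = c" by auto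
    then show "\<exists>z. (z, x) \<in> L \<and> fst z \<noteq> fst x \<and> card (block L fst z) = c"
      using * by (intro exI[of _ "(r, d)"]) (simp add: mem blk)
  qed
qed

lemma shuffle_map_infinite: assumes "shuffle_map S r \<pi>" shows "infinite (Field r)"
proof
  note S = shuffle_mapD[OF assms]
  assume "finite (Field r)"
  from finite_Linear_order_max[OF S(1) this S(2) order_refl]
  obtain m where m: "m \<in> Field r" "\<And>z. z \<in> Field r \<Longrightarrow> (z, m) \<in> r" by blast
  from S(7)[OF m(1) S(4)[OF m(1)]] obtain z where z: "(m, z) \<in> r" "\<pi> z \<noteq> \<pi> m" by blast
  then have "(z, m) \<in> r" using m(2)[of z] by (auto simp: Field_def)
  then show False using S(1) z unfolding order_on_defs antisym_def by blast
qed

text \<open>Unboundedness makes the field infinite, so an enumeration moves \<open>L\<close> onto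
  the natural numbers, where back-and-forth applies.\<close>

lemma shuf_isomorphic_countable:
  fixes L :: "'a :: countable rel"
  assumes A: "shuf S A \<pi>" and L: "shuffle_map S L \<pi>'"
  shows "isomorphic A L"
proof -
  have inf: "infinite (Field L)" by (rule shuffle_map_infinite[OF L])
  have b: "bij_betw (from_nat_into (Field L)) UNIV (Field L)"
    by (rule bij_betw_from_nat_into[OF _ inf]) simp
  note F = Field_pullback[OF shuffle_mapD(1)[OF L] b]
  let ?B = "{(x, y). x \<in> UNIV \<and> y \<in> UNIV \<and> (from_nat_into (Field L) x, from_nat_into (Field L) y) \<in> L}"
  have "shuf S ?B (\<lambda>x. \<pi>' (from_nat_into (Field L) x))"
    by (intro shuf.intro shuffle_map_iso[OF L F(2)] F(1))
  from shuf_isomorphic[OF A this] show ?thesis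
    using isomorphic_trans F(2) unfolding isomorphic_def by blast
qed

section \<open>Unique witnesses\<close>

lemma E_AE: "EXc PRp n Q \<Longrightarrow> ALLc (EXc PRp) n Q"
  by (rule ALLcI[where Q = "\<lambda>ys. Q (tl ys)"]) (auto intro: E.subst vec)

text \<open>A value of a \<open>\<Delta>\<^sup>0\<^sub>3\<close> function has \<open>\<Pi>\<^sup>0\<^sub>2\<close> witnesses; the least one, together with the
  least counterexamples for its predecessors, is again a \<open>\<Pi>\<^sup>0\<^sub>2\<close> witness, and it is unique.\<close>

lemma unique_witness:
  assumes "D3 1 (\<lambda>xs. g (xs ! 0))"
  shows "\<exists>P G. PRp 4 (\<lambda>xs. P (xs ! 0) (xs ! 1) (xs ! 2) (xs ! 3)) \<and> primf {} 1 (\<lambda>xs. G (xs ! 0)) \<and>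
    (\<forall>x. \<exists>!\<sigma>. \<forall>v. \<exists>w. P x \<sigma> v w) \<and> (\<forall>x \<sigma>. (\<forall>v. \<exists>w. P x \<sigma> v w) \<longrightarrow> G \<sigma> = g x)"
proof -
  from assms have "S3 2 (\<lambda>ys. g (tl ys ! 0) = hd ys)"
    unfolding D3_def FG_def by (simp add: numeral_2_eq_2)
  then obtain Q1 Q2 where Q: "\<And>xs. length xs = 2 \<Longrightarrow> g (tl xs ! 0) = hd xs \<longleftrightarrow> (\<exists>u. Q1 (u # xs))"
    "\<And>xs. length xs = 3 \<Longrightarrow> Q1 xs \<longleftrightarrow> (\<forall>v. Q2 (v # xs))" "EXc PRp 4 Q2"
    unfolding S3_def EXc_def[of "ALLc _"] ALLc_def by (auto simp: numeral_eq_Suc)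
  \<comment> \<open>\<open>p\<close> codes a witness together with the proposed value, so that a
    least valid \<open>p\<close> can be singled out.\<close>
  define E where "E x p v = Q2 [v, p1 p, p2 p, x]" for x p v
  have g: "g x = y \<longleftrightarrow> (\<exists>u. \<forall>v. E x (prod_encode (u, y)) v)" for x y
    using Q(1)[of "[y, x]"] Q(2)[of "[_, y, x]"] by (simp add: E_def)
  have ex: "\<exists>p. \<forall>v. E x p v" for x using g[of x "g x"] by blast
  have val: "p2 p = g x" if "\<forall>v. E x p v" for x p
    using g[of x "p2 p"] that by (auto intro!: exI[of _ "p1 p"])
  \<comment> \<open>\<open>\<sigma>\<close> codes \<open>p\<close> and the list of least
    counterexamples to all smaller numbers. Storing them avoids an existential quantifier over
    counterexamples, which would leave \<open>\<Pi>\<^sup>0\<^sub>2\<close>; fixing the length and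
    the entries makes \<open>\<sigma>\<close> unique.\<close>
  define R where "R x \<sigma> \<longleftrightarrow> (\<forall>v. E x (p1 \<sigma>) v) \<and> clen (p2 \<sigma>) = p1 \<sigma> \<and>
    (\<forall>i<p1 \<sigma>. \<not> E x i (cnth (p2 \<sigma>) i) \<and> (\<forall>v<cnth (p2 \<sigma>) i. E x i v))" for x \<sigma>
  have R_ex: "\<exists>\<sigma>. R x \<sigma>" for x
  proof -
    define p where "p = (LEAST p. \<forall>v. E x p v)"
    have p: "\<forall>v. E x p v" unfolding p_def using LeastI_ex[OF ex] .
    define c where "c i = (LEAST v. \<not> E x i v)" for i
    have "\<exists>v. \<not> E x i v" if "i < p" for i using not_less_Least[OF that[unfolded p_def]] by blast
    then have c: "\<not> E x i (c i)" if "i < p" for i unfolding c_def using that by (metis (mono_tags, lifting) LeastI_ex)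
    have c': "E x i v" if "v < c i" for i v using not_less_Least[OF that[unfolded c_def]] by blast
    have "R x (prod_encode (p, list_encode (map c [0..<p])))"
      unfolding R_def using p c c' by simp
    then show ?thesis ..
  qed
  have R_unique: "\<sigma> = \<tau>" if R: "R x \<sigma>" "R x \<tau>" for x \<sigma> \<tau>
  proof -
    have 1: "p1 \<sigma> = p1 \<tau>"
      using R unfolding R_def by (metis linorder_neqE_nat)
    have "cnth (p2 \<sigma>) i = cnth (p2 \<tau>) i" if "i < p1 \<sigma>" for i
      using R that 1 unfolding R_def by (metis linorder_neqE_nat)
    then have "cnth (list_encode (list_decode (p2 \<sigma>))) i = cnth (list_encode (list_decode (p2 \<tau>))) i" if "i < p1 \<sigma>" for i
      using that by simp
    moreover have "length (list_decode (p2 \<sigma>)) = p1 \<sigma>" "length (list_decode (p2 \<tau>)) = p1 \<sigma>"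
      using R 1 unfolding R_def clen_def by simp_all
    ultimately have "list_decode (p2 \<sigma>) = list_decode (p2 \<tau>)"
      by (intro nth_equalityI) (simp_all del: list_decode_inverse)
    then show ?thesis using 1 by (metis list_decode_eq p_simps(3))
  qed
  have E: "EXc PRp n (\<lambda>xs. E (a xs) (b xs) (c xs))" if "primf {} n a" "primf {} n b" "primf {} n c" for n a b c
    unfolding E_def using Q(3) by (rule E.subst) (simp add: numeral_eq_Suc, intro vec pr that)
  obtain T where T: "PRp 5 T" "\<And>xs. length xs = 4 \<Longrightarrow> Q2 xs \<longleftrightarrow> (\<exists>w. T (w # xs))"
    using Q(3) unfolding EXc_def by (auto simp: numeral_eq_Suc)
  \<comment> \<open>The complement of \<open>E\<close> is universal over a primitive recursive
    predicate and so fits into \<open>\<Pi>\<^sup>0\<^sub>2\<close>.\<close>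
  have notE: "\<not> E x p v \<longleftrightarrow> (\<forall>w. \<not> T [w, v, p1 p, p2 p, x])" for x p v
    unfolding E_def using T(2)[of "[v, p1 p, p2 p, x]"] by simp
  have T': "EXc PRp n (\<lambda>xs. \<not> T [a xs, b xs, c xs, d xs, e xs])"
    if "primf {} n a" "primf {} n b" "primf {} n c" "primf {} n d" "primf {} n e" for n a b c d e
    by (rule E.base, intro pr, rule primf_vec[OF T(1)[unfolded PRp_def]]) (simp add: numeral_eq_Suc, intro vec that)
  have "ALLc (EXc PRp) 2 (\<lambda>xs. R (xs ! 0) (xs ! 1))"
    unfolding R_def notE
    by (intro AE.conj AE.ball E.ALLc_all E_AE E T' pr E.base; simp?; intro pr; simp)
  then obtain P where P: "EXc PRp 3 P" "\<And>xs. length xs = 2 \<Longrightarrow> R (xs ! 0) (xs ! 1) \<longleftrightarrow> (\<forall>v. P (v # xs))"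
    unfolding ALLc_def by (auto simp: numeral_eq_Suc)
  then obtain P' where P': "PRp 4 P'" "\<And>xs. length xs = 3 \<Longrightarrow> P xs \<longleftrightarrow> (\<exists>v. P' (v # xs))"
    unfolding EXc_def by (auto simp: numeral_eq_Suc)
  have R: "R x \<sigma> \<longleftrightarrow> (\<forall>v. \<exists>w. P' [w, v, x, \<sigma>])" for x \<sigma>
    using P(2)[of "[x, \<sigma>]"] P'(2)[of "[_, x, \<sigma>]"] by simp
  show ?thesis
  proof (intro exI[of _ "\<lambda>x \<sigma> v w. P' [w, v, x, \<sigma>]"] exI[of _ "\<lambda>\<sigma>. p2 (p1 \<sigma>)"] conjI allI impI)
    show "PRp 4 (\<lambda>xs. P' [xs ! 3, xs ! 2, xs ! 0, xs ! 1])"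
      unfolding PRp_def
      by (rule primf_vec[OF P'(1)[unfolded PRp_def]]) (simp add: numeral_eq_Suc, intro vec pr; simp)
    show "primf {} 1 (\<lambda>xs. p2 (p1 (xs ! 0)))" by (intro pr) simp
    show "p2 (p1 \<sigma>) = g x" if "\<forall>v. \<exists>w. P' [w, v, x, \<sigma>]" for x \<sigma>
      using that val unfolding R[symmetric] R_def by blast
    show "\<exists>!\<sigma>. \<forall>v. \<exists>w. P' [w, v, x, \<sigma>]" for x
      unfolding R[symmetric] using R_ex R_unique by blast
  qed
qed

section \<open>Degrees\<close>

lemma le_PR_iff: "f \<le>\<^sub>P\<^sub>R g \<longleftrightarrow> primf {g} 1 (\<lambda>xs. f (xs ! 0))"
proof -
  have "(\<forall>xs. length xs = 1 \<longrightarrow> f (xs ! 0) = h xs) \<longleftrightarrow> (\<forall>x. f x = h [x])" for h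
    by (auto simp: length_Suc_conv)
  then show ?thesis unfolding le_PR_def ext_closure_def by simp
qed

lemma le_PR_refl: "g \<le>\<^sub>P\<^sub>R g"
  unfolding le_PR_def using prim_rec_in.query[of g "{g}"] by (intro exI[of _ "\<lambda>xs. g (xs ! 0)"]) simp

lemma le_PR_trans: "f \<le>\<^sub>P\<^sub>R g \<Longrightarrow> g \<le>\<^sub>P\<^sub>R h \<Longrightarrow> f \<le>\<^sub>P\<^sub>R h"
  unfolding le_PR_iff by (rule pr_class.primf_imp[OF pr_class_primf]) auto

lemma below_degree_representative:
  assumes "d \<in> PR_degrees"
  obtains g where "\<And>f. below_degree f d \<longleftrightarrow> f \<le>\<^sub>P\<^sub>R g"
proof -
  from assms obtain g where d: "d = {(f, g). f \<le>\<^sub>P\<^sub>R g \<and> g \<le>\<^sub>P\<^sub>R f} `` {g}"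
    unfolding PR_degrees_def by (elim quotientE)
  have "below_degree f d \<longleftrightarrow> f \<le>\<^sub>P\<^sub>R g" for f
    unfolding below_degree_def d using le_PR_refl le_PR_trans by auto
  then show thesis by (rule that)
qed

text \<open>More than \<open>j\<close> points are witnessed by a coded list of \<open>j + 1\<close>
  distinct elements, a \<open>\<Sigma>\<^sup>0\<^sub>1\<close> condition. Without a bound on the
  domain this only approaches the size from below.\<close>

lemma family_size:
  assumes F: "computable_family F" "\<And>i. finite (Field (F i))"
  obtains Z where "PRp 3 (\<lambda>xs. Z (xs ! 0) (xs ! 1) (xs ! 2))"
    "\<And>i j. j < card (Field (F i)) \<longleftrightarrow> (\<exists>u. Z i j u)"
proof -
  have lin: "Linear_order (F i)" for i using F(1) unfolding computable_family_def by blast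
  have fld: "x \<in> Field (F i) \<longleftrightarrow> (x, x) \<in> F i" for x i
    using lin[of i] unfolding order_on_defs refl_on_def Field_def by blast
  have 1: "EXc PRp 3 (\<lambda>xs. (xs ! 1, xs ! 2) \<in> F (xs ! 0))"
    using F(1) computable_pred_E(1) unfolding computable_family_def by blast
  have 2: "EXc PRp n (\<lambda>xs. a xs \<in> Field (F (b xs)))" if "primf {} n a" "primf {} n b" for n a b
    unfolding fld by (rule E.lift3[where F = "\<lambda>i x y. (x, y) \<in> F i", OF 1]) (rule that)+
  have 3: "j < card (Field (F i)) \<longleftrightarrow>
    (\<exists>c. \<forall>a<Suc j. cnth c a \<in> Field (F i) \<and> (\<forall>b<a. cnth c b \<noteq> cnth c a))" for i j
  proof
    assume "j < card (Field (F i))"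
    then have j: "Suc j \<le> card (Field (F i))" by simp
    let ?l = "sorted_list_of_set (Field (F i))"
    have l: "length ?l = card (Field (F i))" "distinct ?l" "set ?l = Field (F i)" using F(2) by auto
    show "\<exists>c. \<forall>a<Suc j. cnth c a \<in> Field (F i) \<and> (\<forall>b<a. cnth c b \<noteq> cnth c a)"
    proof (intro exI[of _ "list_encode ?l"] allI impI conjI)
      fix a assume "a < Suc j"
      then have a: "a < length ?l" using j l(1) by simp
      then show "cnth (list_encode ?l) a \<in> Field (F i)" using l(3) nth_mem by fastforce
      fix b assume "b < a"
      then show "cnth (list_encode ?l) b \<noteq> cnth (list_encode ?l) a"
        using a l(2) by (simp add: nth_eq_iff_index_eq)
    qed
  next
    assume "\<exists>c. \<forall>a<Suc j. cnth c a \<in> Field (F i) \<and> (\<forall>b<a. cnth c b \<noteq> cnth c a)"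
    then obtain c where c: "\<And>a. a < Suc j \<Longrightarrow> cnth c a \<in> Field (F i)"
      "\<And>a b. a < Suc j \<Longrightarrow> b < a \<Longrightarrow> cnth c b \<noteq> cnth c a" by blast
    have "inj_on (cnth c) {..<Suc j}" using c(2) by (intro inj_onI) (metis lessThan_iff linorder_neqE_nat)
    then have "Suc j \<le> card (Field (F i))"
      using card_inj_on_le[of "cnth c" "{..<Suc j}" "Field (F i)"] c(1) F(2) by auto
    then show "j < card (Field (F i))" by simp
  qed
  have "EXc PRp 2 (\<lambda>xs. xs ! 1 < card (Field (F (xs ! 0))))"
    unfolding 3 by (intro E.ex E.ball E.conj 2 pr E.base; simp?; intro pr; simp)
  then obtain Q where Q: "PRp 3 Q" "\<And>xs. length xs = 2 \<Longrightarrow> xs ! 1 < card (Field (F (xs ! 0))) \<longleftrightarrow> (\<exists>u. Q (u # xs))"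
    unfolding EXc_def by (auto simp: numeral_eq_Suc)
  show thesis
  proof (rule that[of "\<lambda>i j u. Q [u, i, j]"])
    show "PRp 3 (\<lambda>xs. Q [xs ! 2, xs ! 0, xs ! 1])"
      unfolding PRp_def
      by (rule primf_vec[OF Q(1)[unfolded PRp_def]]) (simp add: numeral_eq_Suc, intro vec pr; simp)
    show "j < card (Field (F i)) \<longleftrightarrow> (\<exists>u. Q [u, i, j])" for i j using Q(2)[of "[i, j]"] by simp
  qed
qed

section \<open>The lower bound\<close>

text \<open>The code of the list \<open>g n, ..., g 0\<close> with the newest value first; hence the
  index \<open>n - x\<close> for \<open>g x\<close>.\<close>

definition history :: "(nat \<Rightarrow> nat) \<Rightarrow> nat \<Rightarrow> nat" where
  "history g n = rec_nat 0 (\<lambda>i r. Suc (prod_encode (g i, r))) (Suc n)"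

lemma cnth_history: assumes "x \<le> n" shows "cnth (history g n) (n - x) = g x"
proof -
  have "rec_nat 0 (\<lambda>i r. Suc (prod_encode (g i, r))) n = list_encode (rev (map g [0..<n]))" for n
    by (induction n) auto
  from this[of "Suc n"] show ?thesis
    using assms by (simp only: history_def) (subst cnth_encode, simp, simp add: rev_nth del: upt_Suc)
qed

lemma (in pr_class) history: assumes "C 1 (\<lambda>xs. g (xs ! 0))" shows "C 1 (\<lambda>xs. history g (xs ! 0))"
  unfolding history_def by (intro rec pr lift1[OF assms]) simp_all

text \<open>The node \<open>t i\<close> containing the image of seed \<open>i\<close> is primitive
  recursive in \<open>g0\<close>. A primitive recursive reduction must also bound the search for a
  sufficiently high level, and counting levels provides the bound \<open>x\<close>.\<close>

lemma pr_compute_from_iso: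
  assumes B1: "pr_shuffle_constr N k m (\<lambda>_ _ _ _. True) Z" and B2: "pr_shuffle_constr N k m P Z"
    and uniq: "\<forall>l. \<exists>!\<sigma>. \<forall>v. \<exists>w. P l \<sigma> v w"
    and G: "primf {} 1 (\<lambda>xs. G (xs ! 0))" "\<forall>l \<sigma>. (\<forall>v. \<exists>w. P l \<sigma> v w) \<longrightarrow> G \<sigma> = history g l"
    and h: "iso (pr_shuffle_constr.B N k m (\<lambda>_ _ _ _. True) Z) (pr_shuffle_constr.B N k m P Z) h"
      "primf {g0} 1 (\<lambda>xs. h (xs ! 0))"
  shows "g \<le>\<^sub>P\<^sub>R g0"
proof -
  interpret B1: pr_shuffle_constr N k m "\<lambda>_ _ _ _. True" Z by fact
  interpret B2: pr_shuffle_constr N k m P Z by fact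
  interpret C: pr_class "primf {g0}" by (rule pr_class_primf)
  have h': "iso (B1.B\<inverse>) (B2.B\<inverse>) h" using h(1) unfolding iso_iff2 by auto
  define y where "y i = h (B1.idx i)" for i
  define t where "t i = fst (B2.el (y i))" for i
  have small: "nright (B1.B\<inverse>) (B1.idx i) = 0" "nright B1.B (B1.idx i) = k - 1" for i
    by (rule B1.small_idx; simp add: B1.refuted_def B1.refu_def)+
  have y: "nright (B2.B\<inverse>) (y i) = 0" "nright B2.B (y i) = k - 1" for i
    unfolding y_def using nright_iso[OF B1.shuf_B B2.shuf_B h(1)] small
      nright_iso[OF shuf.conv[OF B1.shuf_B] shuf.conv[OF B2.shuf_B] h'] by simp_all
  note t = B2.first_of_small[OF y, folded t_def]
  have y_inj: "i = j" if "y i = y j" for i j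
  proof -
    have "inj h" using h(1) unfolding iso_iff2 B1.Field_B by (simp add: bij_betw_def)
    then have "B1.idx i = B1.idx j" using that unfolding y_def by (simp add: inj_eq)
    then have "B1.el (B1.idx i) = B1.el (B1.idx j)" by simp
    then show ?thesis unfolding B1.el_idx by simp
  qed
  \<comment> \<open>First points of one block coincide, so different seeds lead to different
    nodes.\<close>
  have t_inj: "i = j" if "t i = t j" for i j
  proof (rule y_inj)
    interpret S: shuf "range N" B2.B B2.bl by (rule B2.shuf_B)
    have "B2.bl (y i) = B2.bl (y j)" using t(3) that by simp
    then show "y i = y j" using S.nleft_le[of "y i" "y j"] S.nleft_le[of "y j" "y i"] y(1) S.le_antisym by simp
  qed
  have P: "\<forall>v. \<exists>w. P (list_encode (tl (t i))) (hd (t i) div 2) v w" for i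
    using t(2)[of i] unfolding B2.refuted_def B2.refu_def by blast
  \<comment> \<open>Nodes with the same parent compete at the same level; uniqueness of the correct
    candidate makes their digits equal.\<close>
  have tl_inj: "i = j" if "tl (t i) = tl (t j)" for i j
  proof (rule t_inj)
    have "hd (t i) div 2 = hd (t j) div 2" using uniq P[of i] P[of j, folded that] by blast
    moreover have "t i \<noteq> [] \<and> even (hd (t i))" for i using t(1)[of i] by (cases "t i") auto
    ultimately have "hd (t i) = hd (t j)" by (metis dvd_mult_div_cancel)
    then show "t i = t j" using that \<open>\<And>i. t i \<noteq> [] \<and> even (hd (t i))\<close> by (metis list.collapse)
  qed
  have big: "\<exists>i\<le>x. x \<le> list_encode (tl (t i))" for x
  proof (rule ccontr)
    assume "\<not> (\<exists>i\<le>x. x \<le> list_encode (tl (t i)))"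
    then have "(\<lambda>i. list_encode (tl (t i))) ` {..x} \<subseteq> {..<x}" by auto
    moreover have "inj_on (\<lambda>i. list_encode (tl (t i))) {..x}"
      by (intro inj_onI) (simp add: list_encode_eq tl_inj)
    ultimately have "card {..x} \<le> card {..<x}" by (meson card_inj_on_le finite_lessThan)
    then show False by simp
  qed
  define c where "c i = p1 (enumerate B2.X (y i))" for i
  have tc: "t i = list_decode (c i)" for i
    by (simp add: t_def B2.el_def B2.dec_def c_def)
  have ctl: "list_encode (tl (t i)) = ctl (c i)" for i
    unfolding tc list_code_head_tail(1)[symmetric] by simp
  have chd: "hd (t i) = chd (c i)" for i
    unfolding tc by (rule list_code_head_tail(2)[symmetric]) (use t(1)[of i] tc[of i] in \<open>cases "t i"; auto\<close>)
  define i where "i x = (LEAST i. x \<le> ctl (c i))" for x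
  \<comment> \<open>The level reached is at least \<open>x\<close>, so the segment extracted from
    its candidate contains \<open>g x\<close>.\<close>
  have "g x = cnth (G (chd (c (i x)) div 2)) (ctl (c (i x)) - x)" for x
  proof -
    have "x \<le> ctl (c (i x))" unfolding i_def using big[of x] unfolding ctl by (metis (mono_tags, lifting) LeastI)
    then show ?thesis using G(2)[rule_format, OF P[of "i x", rule_format]] unfolding ctl chd by (simp add: cnth_history)
  qed
  moreover have c: "primf {g0} n a \<Longrightarrow> primf {g0} n (\<lambda>xs. c (a xs))" for n a
    unfolding c_def y_def
    by (intro pr C.lift1[OF C.primf_empty[OF B2.PR_enum[where a = "\<lambda>xs. xs ! 0"]]] PR.var
      C.lift1[OF h(2)] C.lift1[OF C.primf_empty[OF B1.PR_idx]]) simp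
  moreover have "primf {g0} 1 (\<lambda>xs. i (xs ! 0))"
    unfolding i_def
    by (rule C.bounded_least[where b = "\<lambda>xs. xs ! 0"]) (intro pr c; simp | use big in \<open>simp add: ctl\<close>)+
  ultimately show ?thesis
    unfolding le_PR_iff
    by (simp, intro pr c C.lift1[OF C.primf_empty[OF G(1)]]; simp)
qed

section \<open>Comparison of a given presentation with the constructed copies\<close>

theorem theorem3p7:
  fixes F :: "nat \<Rightarrow> nat rel"
  assumes "computable_family F"
    and "\<And>i. finite (Field (F i))"
    and "\<And>i. Field (F i) \<noteq> {}"
    and "\<exists>i j. \<not> isomorphic (F i) (F j)"
  shows "(\<exists>A. punctual_presentation A (Shuffle F)) \<and>
    (\<forall>A. punctual_presentation A (Shuffle F) \<longrightarrow> PrCat A = Cone_Delta3)"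
proof -
  have lin: "Linear_order (F i)" for i using assms(1) unfolding computable_family_def by blast
  define N where "N i = card (Field (F i))" for i
  obtain Z where Z: "PRp 3 (\<lambda>xs. Z (xs ! 0) (xs ! 1) (xs ! 2))" "\<And>i j. j < N i \<longleftrightarrow> (\<exists>u. Z i j u)"
    using family_size[OF assms(1,2)] unfolding N_def by metis
  obtain i0 j0 where "\<not> isomorphic (F i0) (F j0)" using assms(4) by blast
  \<comment> \<open>Finite linear orders are determined by their size, so two types mean two
    sizes.\<close>
  then have ne: "N i0 \<noteq> N j0" using finite_isomorphic[OF lin lin assms(2) assms(2)] unfolding N_def by blast
  define k where "k = (LEAST c. c \<in> range N)"
  have k: "k \<in> range N" "k \<le> N i" for i
    unfolding k_def by (rule LeastI[of _ "N 0"], simp) (simp add: Least_le)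
  have k0: "0 < k" using k(1) assms(2,3) by (auto simp: N_def card_gt_0_iff)
  obtain m where m: "m \<in> range N" "k < m"
  proof -
    have "k < N i0 \<or> k < N j0" using k(2)[of i0] k(2)[of j0] ne by linarith
    then show thesis using that by blast
  qed
  have constr: "pr_shuffle_constr N k m P Z"
    if "PRp 4 (\<lambda>xs. P (xs ! 0) (xs ! 1) (xs ! 2) (xs ! 3))" "\<And>l. \<exists>\<sigma>. \<forall>v. \<exists>w. P l \<sigma> v w" for P
    by unfold_locales (use that k k0 m Z in auto)
  have "PRp 4 (\<lambda>xs. True)" unfolding PRp_def by (simp add: PR.const)
  \<comment> \<open>With trivial \<open>P\<close> every candidate is correct, so every seed starts a
    small block.\<close>
  then have c1: "pr_shuffle_constr N k m (\<lambda>_ _ _ _. True) Z" by (intro constr) auto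
  let ?B1 = "pr_shuffle_constr.B N k m (\<lambda>_ _ _ _. True) Z"
  note sm = Shuffle_shuffle_map[of F, OF lin assms(2,3), folded N_def]
  have pres: "\<exists>\<pi> :: nat \<Rightarrow> rat. shuf (range N) A \<pi>" if pp: "punctual_presentation A (Shuffle F)" for A
  proof -
    obtain L f where L: "L \<in> Shuffle F" "iso A L f" "punctual A"
      using pp unfolding punctual_presentation_def isomorphic_def by blast
    have A: "Field A = UNIV"
      using L(3) unfolding punctual_def order_on_defs refl_on_def Field_def by blast
    have "shuf (range N) A (\<lambda>x. fst (f x))"
      by (intro shuf.intro shuffle_map_iso[OF sm[OF L(1)] L(2)] A)
    then show ?thesis by blast
  qed
  \<comment> \<open>The copy with trivial \<open>P\<close> doubles as the required punctual
    presentation.\<close>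
  have ex: "punctual_presentation ?B1 (Shuffle F)"
  proof -
    obtain L where L: "L \<in> Shuffle F" using Shuffle_nonempty by blast
    have "isomorphic ?B1 L"
      by (rule shuf_isomorphic_countable[OF pr_shuffle_constr.shuf_B[OF c1] sm[OF L]])
    then show ?thesis unfolding punctual_presentation_def
      using pr_shuffle_constr.punctual_B[OF c1] L by blast
  qed
  have "d \<in> Cone_Delta3" if A: "punctual_presentation A (Shuffle F)" and d: "d \<in> PrCat A" for A d
  proof -
    obtain \<pi> :: "nat \<Rightarrow> rat" where \<pi>: "shuf (range N) A \<pi>" using pres[OF A] by blast
    have dd: "d \<in> PR_degrees" using d unfolding PrCat_def by blast
    obtain g0 where g0: "\<And>f. below_degree f d \<longleftrightarrow> f \<le>\<^sub>P\<^sub>R g0"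
      using below_degree_representative[OF dd] by metis
    have isos: "\<exists>f. iso A B f \<and> f \<le>\<^sub>P\<^sub>R g0 \<and> inv f \<le>\<^sub>P\<^sub>R g0" if "shuf (range N) B \<pi>'" "punctual B" for B and \<pi>' :: "nat \<Rightarrow> nat list"
    proof -
      have "isomorphic A B" by (rule shuf_isomorphic[OF \<pi> that(1)])
      then show ?thesis using d that(2) unfolding PrCat_def by (simp add: g0)
    qed
    have "g \<le>\<^sub>P\<^sub>R g0" if "Delta0_fun 3 g" for g
    proof -
      have "D3 1 (\<lambda>xs. history g (xs ! 0))" using that D3.history unfolding Delta0_fun_iff by blast
      from unique_witness[OF this] obtain P G where P: "PRp 4 (\<lambda>xs. P (xs ! 0) (xs ! 1) (xs ! 2) (xs ! 3))"
        and G: "primf {} 1 (\<lambda>xs. G (xs ! 0))" and ex1: "\<forall>x. \<exists>!\<sigma>. \<forall>v. \<exists>w. P x \<sigma> v w"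
        and val: "\<forall>x \<sigma>. (\<forall>v. \<exists>w. P x \<sigma> v w) \<longrightarrow> G \<sigma> = history g x"
        by (elim exE conjE) (rule that)
      have ex: "\<exists>\<sigma>. \<forall>v. \<exists>w. P x \<sigma> v w" for x using ex1 by blast
      have c2: "pr_shuffle_constr N k m P Z" using P ex by (rule constr)
      let ?B2 = "pr_shuffle_constr.B N k m P Z"
      \<comment> \<open>The map from \<open>?B1\<close> to \<open>?B2\<close> runs through
        \<open>A\<close>; the clause on inverses in \<open>PrCat\<close> bounds its first
        half.\<close>
      obtain f1 where f1: "iso A ?B1 f1" "inv f1 \<le>\<^sub>P\<^sub>R g0"
        using isos[OF pr_shuffle_constr.shuf_B[OF c1] pr_shuffle_constr.punctual_B[OF c1]] by blast
      obtain f2 where f2: "iso A ?B2 f2" "f2 \<le>\<^sub>P\<^sub>R g0"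
        using isos[OF pr_shuffle_constr.shuf_B[OF c2] pr_shuffle_constr.punctual_B[OF c2]] by blast
      have F: "Field A = UNIV" "Field ?B1 = UNIV"
        using shuf.UNIV[OF \<pi>] pr_shuffle_constr.Field_B[OF c1] by auto
      have b: "bij f1" and le: "\<And>x y. (x, y) \<in> A \<longleftrightarrow> (f1 x, f1 y) \<in> ?B1"
        using f1(1) unfolding iso_iff2 F by auto
      have "iso ?B1 A (inv f1)"
        unfolding iso_iff2 F by (simp add: b bij_imp_bij_inv le surj_f_inv_f bij_is_surj)
      then have "iso ?B1 ?B2 (f2 \<circ> inv f1)" using f2(1) by (rule comp_iso)
      moreover have "primf {g0} 1 (\<lambda>xs. (f2 \<circ> inv f1) (xs ! 0))"
        using f1(2) f2(2) unfolding le_PR_iff comp_def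
        by - (rule pr_class.lift1[OF pr_class_primf])
      ultimately show ?thesis by (rule pr_compute_from_iso[OF c1 c2 ex1 G val])
    qed
    then show ?thesis unfolding Cone_Delta3_def using dd g0 by blast
  qed
  moreover have "d \<in> PrCat A" if A: "punctual_presentation A (Shuffle F)" and d: "d \<in> Cone_Delta3" for A d
  proof -
    obtain \<pi> :: "nat \<Rightarrow> rat" where \<pi>: "shuf (range N) A \<pi>" using pres[OF A] by blast
    have pA: "punctual A" using A unfolding punctual_presentation_def by blast
    have "\<exists>f. iso A B f \<and> below_degree f d \<and> below_degree (inv f) d" if B: "punctual B" "isomorphic A B" for B
    proof -
      have "punctual_presentation B (Shuffle F)"
        using A B isomorphic_sym isomorphic_trans unfolding punctual_presentation_def by blast
      then obtain \<pi>' :: "nat \<Rightarrow> rat" where \<pi>': "shuf (range N) B \<pi>'" using pres by blast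
      \<comment> \<open>Back-and-forth inside the class \<open>D3\<close> delivers the isomorphism
        and its inverse as \<open>\<Delta>\<^sup>0\<^sub>3\<close> functions, both below every
        degree of the cone.\<close>
      obtain f where "iso A B f" "D3 1 (\<lambda>xs. f (xs ! 0))" "D3 1 (\<lambda>xs. inv f (xs ! 0))"
        using D3.shuf_iso[OF \<pi> \<pi>' rho_D3[OF punctual_PRp[OF pA] \<pi>] rho_D3[OF punctual_PRp[OF B(1)] \<pi>']] .
      then show ?thesis using d unfolding Cone_Delta3_def Delta0_fun_iff by blast
    qed
    then show ?thesis using d unfolding PrCat_def Cone_Delta3_def by blast
  qed
  ultimately show ?thesis using ex by blast
qed

end
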